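(* Assume $(X,T)$ has the b.i.p.-property and $\phi$ satisfies (H* ), (S1) and (S2). Then $P_G(\phi)$ is finite and, for a.e. $\omega\in\Omega$, $$\sum_{n\in J_\omega(\Omega^* )}s^n\,\mathcal Z^\omega_n\ \begin{cases}<\infty,& 0<s<e^{-P_G(\phi)},\\ =\infty,& s=e^{-P_G(\phi)}.\end{cases}$$
   Context: Let $(\Omega,\mathcal F,P)$ be a probability space and $\theta:\Omega\to\Omega$ an invertible, bimeasurable, $P$-preserving, ergodic map. Let $\ell:\Omega\to\mathbb N\cup\{\infty\}$ be measurable with $\ell_\omega>1$, and for a.e. $\omega$ let $A_\omega=(\alpha_{ij}(\omega))_{0\le i<\ell_\omega,\,0\le j<\ell_{\theta\omega}}$ be a $\{0,1\}$-matrix depending measurably on $\omega$ such that every row contains an entry $1$. Put $X_\omega=\{x=(x_0,x_1,\dots): x_i<\ell_{\theta^i\omega},\ \alpha_{x_ix_{i+1}}(\theta^i\omega)=1\ \forall i\ge0\}$, $T_\omega:X_\omega\to X_{\theta\omega}$ the left shift, $X=\{(\omega,x):x\in X_\omega\}$, $T^n_\omega=T_{\theta^{n-1}\omega}\circ\cdots\circ T_\omega$. A word $w=(w_0,\dots,w_{n-1})$ is $\omega$-admissible if $w_i<\ell_{\theta^i\omega}$ for all $i<n$ and $\alpha_{w_iw_{i+1}}(\theta^i\omega)=1$ for $i<n-1$; $\mathcal W^n_\omega$ is the set of such words of length $n$; $[w]_\omega=\{x\in X_\omega: x_i=w_i,\ i<n\}$; $\Omega_w=\{\omega: w\in\mathcal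 W^n_\omega\}$; $\mathcal W^n$ is the set of words $w$ of length $n$ with $P(\Omega_w)>0$. $(X,T)$ is topologically mixing if for all $a,b\in\mathcal W^1$ there is an $\mathbb N$-valued random variable $N_{ab}$ with $[a]_\omega\cap(T^n_\omega)^{-1}[b]_{\theta^n\omega}\ne\emptyset$ whenever $\omega\in\Omega_a$, $n\ge N_{ab}(\omega)$, $\theta^n\omega\in\Omega_b$. Big image property: there exist measurable $\Omega_{bi}$ with $P(\Omega_{bi})>0$ and finite sets $\mathcal I^\omega_{bi}\subset\mathcal W^1_\omega$ ($\omega\in\Omega_{bi}$) such that for every $c\in\mathcal W^1_{\theta^{-1}\omega}$ there is $b\in\mathcal I^\omega_{bi}$ with $\alpha_{cb}(\theta^{-1}\omega)=1$. Big preimage property: there exist measurable $\Omega_{bp}$ with $P(\Omega_{bp})>0$ and finite sets $\mathcal I^\omega_{bp}\subset\mathcal W^1_{\theta^{-1}\omega}$ ($\omega\in\Omega_{bp}$) such that for every $c\in\mathcal W^1_\omega$ there is $b\in\mathcal I^\omega_{bp}$ with $\alpha_{bc}(\theta^{-1}\omega)=1$. b.i.p.-property: topologically mixing plus both properties. A potential is a measurable $\phi:X\to\mathbb R$, $(\omega,x)\mapsto\phi^\omega(x)$; $\phi^\omega_n(x)=\sum_{k=0}^{n-1}\phi^{\theta^k\omega}(T^k_\omega x)$; $V^\omega_n(\phi)=\sup\{|\phi^\omega(x)-\phi^\omega(y)|: x_i=y_i\ (i<n)\}$. $\phi$ is $k$-Hölder if there are $r\in(0,1)$ and a random variable $\kappa\ge1$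 with $\int\log\kappa\,dP<\infty$ and $V^\omega_j(\phi)\le\kappa(\omega)r^j$ for all $j\ge k$, a.e. $\omega$; then $B_\omega:=\exp\sum_{j\ge1}\kappa(\theta^{-j}\omega)r^j$. Ruelle operator $L^\omega_\phi f(x)=\sum_{y\in X_\omega,T_\omega y=x}e^{\phi^\omega(y)}f(y)$, $L^{\omega,n}_\phi=L^{\theta^{n-1}\omega}_\phi\circ\cdots\circ L^\omega_\phi$. (H2): $\phi$ is 2-Hölder and $\int\log B\,dP<\infty$. (H* ): (H2) holds and $V^\omega_1(\phi)<\infty$ for a.e. $\omega\in\theta^{-1}(\Omega_{bi}\cup\Omega_{bp})$. (S1): $\int\log M_\omega\,dP<\infty$, $M_\omega=\sup_{x\in X_{\theta\omega}}L^\omega_\phi1(x)$. (S2): $\int\log m_\omega\,dP>-\infty$, $m_\omega=\inf_{x\in X_{\theta\omega}}L^\omega_\phi1(x)$. Fix $a\in\mathcal W^1$ and a measurable family $\xi_\omega\in X_\omega$ with $\xi_\omega\in[a]_\omega$ for $\omega\in\Omega_a$. $\mathcal W^n_\omega(a,a)=\{w\in\mathcal W^n_\omega: w_0=a,\ \alpha_{w_{n-1}a}(\theta^{n-1}\omega)=1\}$; $e^{\phi^\omega_m([v])}:=\sup_{x\in[v]_\omega}e^{\phi^\omega_m(x)}$; $Z^\omega_n(a)=\sum_{w\in\mathcal W^n_\omega(a,a)}e^{\phi^\omega_n([wa])}$; $\mathcal Z^\omega_n=L^{\omega,n}_\phi(1)(\xi_{\theta^n\omega})$. $J_\omega(\Omega')=\{n\in\mathbb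 N:\theta^n\omega\in\Omega'\}$. Fix $N$ such that $\Omega^*=\{\omega\in\Omega_a:N_{aa}(\omega)\le N\}$ has positive measure. $P_G(\phi)=\lim_{n\to\infty,n\in J_\omega(\Omega^* )}\frac1n\log Z^\omega_n(a)$ (relative Gurevič pressure), which exists for a.e. $\omega\in\Omega^*$, is a.s. constant and independent of $a,N$. *)

theory Defs
  imports "HOL-Probability.Probability"
begin

definition theta_inv :: "'w measure \<Rightarrow> ('w \<Rightarrow> 'w) \<Rightarrow> 'w \<Rightarrow> 'w" where
  "theta_inv M \<theta> = the_inv_into (space M) \<theta>"

definition invertible_ergodic_mps :: "'w measure \<Rightarrow> ('w \<Rightarrow> 'w) \<Rightarrow> bool" where
  "invertible_ergodic_mps M \<theta> \<longleftrightarrow>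
     prob_space M \<and>
     bij_betw \<theta> (space M) (space M) \<and>
     \<theta> \<in> M \<rightarrow>\<^sub>M M \<and> theta_inv M \<theta> \<in> M \<rightarrow>\<^sub>M M \<and>
     (\<forall>A\<in>sets M. emeasure M (\<theta> -` A \<inter> space M) = emeasure M A) \<and>
     (\<forall>A\<in>sets M. \<theta> -` A \<inter> space M = A \<longrightarrow> measure M A = 0 \<or> measure M A = 1)"

definition fiber :: "('w \<Rightarrow> 'w) \<Rightarrow> ('w \<Rightarrow> enat) \<Rightarrow> ('w \<Rightarrow> nat \<Rightarrow> nat \<Rightarrow> bool) \<Rightarrow> 'w \<Rightarrow> (nat \<Rightarrow> nat) set" where
  "fiber \<theta> l \<alpha> \<omega> = {x. \<forall>i. enat (x i) < l ((\<theta>^^i) \<omega>) \<and> \<alpha> ((\<theta>^^i) \<omega>) (x i) (x (Suc i))}"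

definition Xset :: "'w measure \<Rightarrow> ('w \<Rightarrow> 'w) \<Rightarrow> ('w \<Rightarrow> enat) \<Rightarrow> ('w \<Rightarrow> nat \<Rightarrow> nat \<Rightarrow> bool) \<Rightarrow> ('w \<times> (nat \<Rightarrow> nat)) set" where
  "Xset M \<theta> l \<alpha> = {(\<omega>, x). \<omega> \<in> space M \<and> x \<in> fiber \<theta> l \<alpha> \<omega>}"

definition cyl :: "('w \<Rightarrow> 'w) \<Rightarrow> ('w \<Rightarrow> enat) \<Rightarrow> ('w \<Rightarrow> nat \<Rightarrow> nat \<Rightarrow> bool) \<Rightarrow> 'w \<Rightarrow> nat list \<Rightarrow> (nat \<Rightarrow> nat) set" where
  "cyl \<theta> l \<alpha> \<omega> w = {x \<in> fiber \<theta> l \<alpha> \<omega>. \<forall>i<length w. x i = w ! i}"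

definition admissible :: "('w \<Rightarrow> 'w) \<Rightarrow> ('w \<Rightarrow> enat) \<Rightarrow> ('w \<Rightarrow> nat \<Rightarrow> nat \<Rightarrow> bool) \<Rightarrow> 'w \<Rightarrow> nat list \<Rightarrow> bool" where
  "admissible \<theta> l \<alpha> \<omega> w \<longleftrightarrow>
     (\<forall>i<length w. enat (w ! i) < l ((\<theta>^^i) \<omega>)) \<and>
     (\<forall>i. Suc i < length w \<longrightarrow> \<alpha> ((\<theta>^^i) \<omega>) (w ! i) (w ! Suc i))"

definition Omega_letter :: "'w measure \<Rightarrow> ('w \<Rightarrow> enat) \<Rightarrow> nat \<Rightarrow> 'w set" where
  "Omega_letter M l a = {\<omega> \<in> space M. enat a < l \<omega>}"

definition W1 :: "'w measure \<Rightarrow> ('w \<Rightarrow> enat) \<Rightarrow> nat set" where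
  "W1 M l = {a. measure M (Omega_letter M l a) > 0}"

definition random_shift :: "'w measure \<Rightarrow> ('w \<Rightarrow> 'w) \<Rightarrow> ('w \<Rightarrow> enat) \<Rightarrow> ('w \<Rightarrow> nat \<Rightarrow> nat \<Rightarrow> bool) \<Rightarrow> bool" where
  "random_shift M \<theta> l \<alpha> \<longleftrightarrow>
     invertible_ergodic_mps M \<theta> \<and>
     l \<in> M \<rightarrow>\<^sub>M count_space UNIV \<and>
     (\<forall>\<omega>\<in>space M. l \<omega> > 1) \<and>
     (\<forall>i j. (\<lambda>\<omega>. \<alpha> \<omega> i j) \<in> M \<rightarrow>\<^sub>M count_space UNIV) \<and>
     (AE \<omega> in M. \<forall>i. enat i < l \<omega> \<longrightarrow> (\<exists>j. enat j < l (\<theta> \<omega>) \<and> \<alpha> \<omega> i j))"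

definition top_mixing :: "'w measure \<Rightarrow> ('w \<Rightarrow> 'w) \<Rightarrow> ('w \<Rightarrow> enat) \<Rightarrow> ('w \<Rightarrow> nat \<Rightarrow> nat \<Rightarrow> bool)
    \<Rightarrow> (nat \<Rightarrow> nat \<Rightarrow> 'w \<Rightarrow> nat) \<Rightarrow> bool" where
  "top_mixing M \<theta> l \<alpha> Nmix \<longleftrightarrow>
     (\<forall>a\<in>W1 M l. \<forall>b\<in>W1 M l.
        Nmix a b \<in> M \<rightarrow>\<^sub>M count_space UNIV \<and>
        (\<forall>\<omega> n. \<omega> \<in> Omega_letter M l a \<and> n \<ge> Nmix a b \<omega> \<and> (\<theta>^^n) \<omega> \<in> Omega_letter M l b \<longrightarrow>
           (\<exists>x\<in>fiber \<theta> l \<alpha> \<omega>. x 0 = a \<and> x n = b)))"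

definition big_image :: "'w measure \<Rightarrow> ('w \<Rightarrow> 'w) \<Rightarrow> ('w \<Rightarrow> enat) \<Rightarrow> ('w \<Rightarrow> nat \<Rightarrow> nat \<Rightarrow> bool)
    \<Rightarrow> 'w set \<Rightarrow> ('w \<Rightarrow> nat set) \<Rightarrow> bool" where
  "big_image M \<theta> l \<alpha> \<Omega>bi Ibi \<longleftrightarrow>
     \<Omega>bi \<in> sets M \<and> measure M \<Omega>bi > 0 \<and>
     (\<forall>\<omega>\<in>\<Omega>bi. finite (Ibi \<omega>) \<and> Ibi \<omega> \<subseteq> {b. enat b < l \<omega>} \<and>
        (\<forall>c. enat c < l (theta_inv M \<theta> \<omega>) \<longrightarrow> (\<exists>b\<in>Ibi \<omega>. \<alpha> (theta_inv M \<theta> \<omega>) c b)))"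

definition big_preimage :: "'w measure \<Rightarrow> ('w \<Rightarrow> 'w) \<Rightarrow> ('w \<Rightarrow> enat) \<Rightarrow> ('w \<Rightarrow> nat \<Rightarrow> nat \<Rightarrow> bool)
    \<Rightarrow> 'w set \<Rightarrow> ('w \<Rightarrow> nat set) \<Rightarrow> bool" where
  "big_preimage M \<theta> l \<alpha> \<Omega>bp Ibp \<longleftrightarrow>
     \<Omega>bp \<in> sets M \<and> measure M \<Omega>bp > 0 \<and>
     (\<forall>\<omega>\<in>\<Omega>bp. finite (Ibp \<omega>) \<and> Ibp \<omega> \<subseteq> {b. enat b < l (theta_inv M \<theta> \<omega>)} \<and>
        (\<forall>c. enat c < l \<omega> \<longrightarrow> (\<exists>b\<in>Ibp \<omega>. \<alpha> (theta_inv M \<theta> \<omega>) b c)))"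

definition potential :: "'w measure \<Rightarrow> ('w \<Rightarrow> 'w) \<Rightarrow> ('w \<Rightarrow> enat) \<Rightarrow> ('w \<Rightarrow> nat \<Rightarrow> nat \<Rightarrow> bool)
    \<Rightarrow> ('w \<Rightarrow> (nat \<Rightarrow> nat) \<Rightarrow> real) \<Rightarrow> bool" where
  "potential M \<theta> l \<alpha> \<phi> \<longleftrightarrow>
     (\<lambda>(\<omega>, x). \<phi> \<omega> x) \<in> borel_measurable
        (restrict_space (M \<Otimes>\<^sub>M PiM UNIV (\<lambda>_. count_space UNIV)) (Xset M \<theta> l \<alpha>))"

definition birkhoff :: "('w \<Rightarrow> 'w) \<Rightarrow> ('w \<Rightarrow> (nat \<Rightarrow> nat) \<Rightarrow> real) \<Rightarrow> 'w \<Rightarrow> nat \<Rightarrow> (nat \<Rightarrow> nat) \<Rightarrow> real" where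
  "birkhoff \<theta> \<phi> \<omega> n x = (\<Sum>k<n. \<phi> ((\<theta>^^k) \<omega>) (\<lambda>i. x (i + k)))"

definition variation :: "('w \<Rightarrow> 'w) \<Rightarrow> ('w \<Rightarrow> enat) \<Rightarrow> ('w \<Rightarrow> nat \<Rightarrow> nat \<Rightarrow> bool)
    \<Rightarrow> ('w \<Rightarrow> (nat \<Rightarrow> nat) \<Rightarrow> real) \<Rightarrow> 'w \<Rightarrow> nat \<Rightarrow> ereal" where
  "variation \<theta> l \<alpha> \<phi> \<omega> n =
     (SUP xy \<in> {(x, y). x \<in> fiber \<theta> l \<alpha> \<omega> \<and> y \<in> fiber \<theta> l \<alpha> \<omega> \<and> (\<forall>i<n. x i = y i)}.
        ereal \<bar>\<phi> \<omega> (fst xy) - \<phi> \<omega> (snd xy)\<bar>)"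

definition holder_with :: "'w measure \<Rightarrow> ('w \<Rightarrow> 'w) \<Rightarrow> ('w \<Rightarrow> enat) \<Rightarrow> ('w \<Rightarrow> nat \<Rightarrow> nat \<Rightarrow> bool)
    \<Rightarrow> ('w \<Rightarrow> (nat \<Rightarrow> nat) \<Rightarrow> real) \<Rightarrow> nat \<Rightarrow> real \<Rightarrow> ('w \<Rightarrow> real) \<Rightarrow> bool" where
  "holder_with M \<theta> l \<alpha> \<phi> k r \<kappa> \<longleftrightarrow>
     0 < r \<and> r < 1 \<and> \<kappa> \<in> borel_measurable M \<and> (\<forall>\<omega>\<in>space M. 1 \<le> \<kappa> \<omega>) \<and>
     (\<integral>\<^sup>+\<omega>. ennreal (ln (\<kappa> \<omega>)) \<partial>M) < \<infinity> \<and>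
     (AE \<omega> in M. \<forall>j\<ge>k. variation \<theta> l \<alpha> \<phi> \<omega> j \<le> ereal (\<kappa> \<omega> * r ^ j))"

text \<open>(H2): 2-Hoelder and int log B < infinity, log B_omega = sum_{j\<ge>1} kappa(theta^{-j} omega) r^j.\<close>
definition H2 :: "'w measure \<Rightarrow> ('w \<Rightarrow> 'w) \<Rightarrow> ('w \<Rightarrow> enat) \<Rightarrow> ('w \<Rightarrow> nat \<Rightarrow> nat \<Rightarrow> bool)
    \<Rightarrow> ('w \<Rightarrow> (nat \<Rightarrow> nat) \<Rightarrow> real) \<Rightarrow> bool" where
  "H2 M \<theta> l \<alpha> \<phi> \<longleftrightarrow>
     (\<exists>r \<kappa>. holder_with M \<theta> l \<alpha> \<phi> 2 r \<kappa> \<and>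
        (\<integral>\<^sup>+\<omega>. (\<Sum>j. ennreal (\<kappa> ((theta_inv M \<theta> ^^ Suc j) \<omega>) * r ^ Suc j)) \<partial>M) < \<infinity>)"

definition Hstar :: "'w measure \<Rightarrow> ('w \<Rightarrow> 'w) \<Rightarrow> ('w \<Rightarrow> enat) \<Rightarrow> ('w \<Rightarrow> nat \<Rightarrow> nat \<Rightarrow> bool)
    \<Rightarrow> ('w \<Rightarrow> (nat \<Rightarrow> nat) \<Rightarrow> real) \<Rightarrow> 'w set \<Rightarrow> 'w set \<Rightarrow> bool" where
  "Hstar M \<theta> l \<alpha> \<phi> \<Omega>bi \<Omega>bp \<longleftrightarrow>
     H2 M \<theta> l \<alpha> \<phi> \<and>
     (AE \<omega> in M. \<theta> \<omega> \<in> \<Omega>bi \<union> \<Omega>bp \<longrightarrow> variation \<theta> l \<alpha> \<phi> \<omega> 1 < \<infinity>)"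

definition scons :: "nat \<Rightarrow> (nat \<Rightarrow> nat) \<Rightarrow> nat \<Rightarrow> nat" where
  "scons a x = (\<lambda>i. case i of 0 \<Rightarrow> a | Suc j \<Rightarrow> x j)"

text \<open>L^omega f (x) = sum over y in X_omega with T y = x, i.e. y = a x, of e^{phi(y)} f(y).\<close>
definition ruelle :: "('w \<Rightarrow> 'w) \<Rightarrow> ('w \<Rightarrow> enat) \<Rightarrow> ('w \<Rightarrow> nat \<Rightarrow> nat \<Rightarrow> bool)
    \<Rightarrow> ('w \<Rightarrow> (nat \<Rightarrow> nat) \<Rightarrow> real) \<Rightarrow> 'w \<Rightarrow> ((nat \<Rightarrow> nat) \<Rightarrow> ennreal) \<Rightarrow> (nat \<Rightarrow> nat) \<Rightarrow> ennreal" where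
  "ruelle \<theta> l \<alpha> \<phi> \<omega> f x =
     (\<Sum>a. if scons a x \<in> fiber \<theta> l \<alpha> \<omega>
           then ennreal (exp (\<phi> \<omega> (scons a x))) * f (scons a x) else 0)"

fun ruelle_iter :: "('w \<Rightarrow> 'w) \<Rightarrow> ('w \<Rightarrow> enat) \<Rightarrow> ('w \<Rightarrow> nat \<Rightarrow> nat \<Rightarrow> bool)
    \<Rightarrow> ('w \<Rightarrow> (nat \<Rightarrow> nat) \<Rightarrow> real) \<Rightarrow> 'w \<Rightarrow> nat \<Rightarrow> ((nat \<Rightarrow> nat) \<Rightarrow> ennreal) \<Rightarrow> (nat \<Rightarrow> nat) \<Rightarrow> ennreal" where
  "ruelle_iter \<theta> l \<alpha> \<phi> \<omega> 0 f = f"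
| "ruelle_iter \<theta> l \<alpha> \<phi> \<omega> (Suc n) f = ruelle \<theta> l \<alpha> \<phi> ((\<theta>^^n) \<omega>) (ruelle_iter \<theta> l \<alpha> \<phi> \<omega> n f)"

definition eln :: "ennreal \<Rightarrow> ereal" where
  "eln x = (if x = 0 then -\<infinity> else if x = \<top> then \<infinity> else ereal (ln (enn2real x)))"

definition Msup :: "('w \<Rightarrow> 'w) \<Rightarrow> ('w \<Rightarrow> enat) \<Rightarrow> ('w \<Rightarrow> nat \<Rightarrow> nat \<Rightarrow> bool)
    \<Rightarrow> ('w \<Rightarrow> (nat \<Rightarrow> nat) \<Rightarrow> real) \<Rightarrow> 'w \<Rightarrow> ennreal" where
  "Msup \<theta> l \<alpha> \<phi> \<omega> = (SUP x \<in> fiber \<theta> l \<alpha> (\<theta> \<omega>). ruelle \<theta> l \<alpha> \<phi> \<omega> (\<lambda>_. 1) x)"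

definition minf :: "('w \<Rightarrow> 'w) \<Rightarrow> ('w \<Rightarrow> enat) \<Rightarrow> ('w \<Rightarrow> nat \<Rightarrow> nat \<Rightarrow> bool)
    \<Rightarrow> ('w \<Rightarrow> (nat \<Rightarrow> nat) \<Rightarrow> real) \<Rightarrow> 'w \<Rightarrow> ennreal" where
  "minf \<theta> l \<alpha> \<phi> \<omega> = (INF x \<in> fiber \<theta> l \<alpha> (\<theta> \<omega>). ruelle \<theta> l \<alpha> \<phi> \<omega> (\<lambda>_. 1) x)"

text \<open>(S1): int log M dP < infinity (positive part integrable); (S2): int log m dP > -infinity.\<close>
definition S1 :: "'w measure \<Rightarrow> ('w \<Rightarrow> 'w) \<Rightarrow> ('w \<Rightarrow> enat) \<Rightarrow> ('w \<Rightarrow> nat \<Rightarrow> nat \<Rightarrow> bool)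
    \<Rightarrow> ('w \<Rightarrow> (nat \<Rightarrow> nat) \<Rightarrow> real) \<Rightarrow> bool" where
  "S1 M \<theta> l \<alpha> \<phi> \<longleftrightarrow> Msup \<theta> l \<alpha> \<phi> \<in> borel_measurable M \<and>
     (\<integral>\<^sup>+\<omega>. e2ennreal (eln (Msup \<theta> l \<alpha> \<phi> \<omega>)) \<partial>M) < \<infinity>"

definition S2 :: "'w measure \<Rightarrow> ('w \<Rightarrow> 'w) \<Rightarrow> ('w \<Rightarrow> enat) \<Rightarrow> ('w \<Rightarrow> nat \<Rightarrow> nat \<Rightarrow> bool)
    \<Rightarrow> ('w \<Rightarrow> (nat \<Rightarrow> nat) \<Rightarrow> real) \<Rightarrow> bool" where
  "S2 M \<theta> l \<alpha> \<phi> \<longleftrightarrow> minf \<theta> l \<alpha> \<phi> \<in> borel_measurable M \<and>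
     (\<integral>\<^sup>+\<omega>. e2ennreal (- eln (minf \<theta> l \<alpha> \<phi> \<omega>)) \<partial>M) < \<infinity>"

definition loop_words :: "('w \<Rightarrow> 'w) \<Rightarrow> ('w \<Rightarrow> enat) \<Rightarrow> ('w \<Rightarrow> nat \<Rightarrow> nat \<Rightarrow> bool) \<Rightarrow> 'w \<Rightarrow> nat \<Rightarrow> nat \<Rightarrow> nat list set" where
  "loop_words \<theta> l \<alpha> \<omega> n a =
     {w. length w = n \<and> admissible \<theta> l \<alpha> \<omega> w \<and> w ! 0 = a \<and> \<alpha> ((\<theta>^^(n - 1)) \<omega>) (last w) a}"

definition Zloop :: "('w \<Rightarrow> 'w) \<Rightarrow> ('w \<Rightarrow> enat) \<Rightarrow> ('w \<Rightarrow> nat \<Rightarrow> nat \<Rightarrow> bool)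
    \<Rightarrow> ('w \<Rightarrow> (nat \<Rightarrow> nat) \<Rightarrow> real) \<Rightarrow> nat \<Rightarrow> nat \<Rightarrow> 'w \<Rightarrow> ennreal" where
  "Zloop \<theta> l \<alpha> \<phi> a n \<omega> =
     (\<integral>\<^sup>+w. (SUP x \<in> cyl \<theta> l \<alpha> \<omega> (w @ [a]). ennreal (exp (birkhoff \<theta> \<phi> \<omega> n x)))
        \<partial>count_space (loop_words \<theta> l \<alpha> \<omega> n a))"

definition Zcal :: "('w \<Rightarrow> 'w) \<Rightarrow> ('w \<Rightarrow> enat) \<Rightarrow> ('w \<Rightarrow> nat \<Rightarrow> nat \<Rightarrow> bool)
    \<Rightarrow> ('w \<Rightarrow> (nat \<Rightarrow> nat) \<Rightarrow> real) \<Rightarrow> ('w \<Rightarrow> nat \<Rightarrow> nat) \<Rightarrow> nat \<Rightarrow> 'w \<Rightarrow> ennreal" where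
  "Zcal \<theta> l \<alpha> \<phi> \<xi> n \<omega> = ruelle_iter \<theta> l \<alpha> \<phi> \<omega> n (\<lambda>_. 1) (\<xi> ((\<theta>^^n) \<omega>))"

definition Jset :: "('w \<Rightarrow> 'w) \<Rightarrow> 'w set \<Rightarrow> 'w \<Rightarrow> nat set" where
  "Jset \<theta> \<Omega>' \<omega> = {n. 1 \<le> n \<and> (\<theta>^^n) \<omega> \<in> \<Omega>'}"

definition Omega_star :: "'w measure \<Rightarrow> ('w \<Rightarrow> enat) \<Rightarrow> (nat \<Rightarrow> nat \<Rightarrow> 'w \<Rightarrow> nat) \<Rightarrow> nat \<Rightarrow> nat \<Rightarrow> 'w set" where
  "Omega_star M l Nmix a N = {\<omega> \<in> Omega_letter M l a. Nmix a a \<omega> \<le> N}"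

definition is_gurevic_pressure :: "'w measure \<Rightarrow> ('w \<Rightarrow> 'w) \<Rightarrow> ('w \<Rightarrow> enat) \<Rightarrow> ('w \<Rightarrow> nat \<Rightarrow> nat \<Rightarrow> bool)
    \<Rightarrow> ('w \<Rightarrow> (nat \<Rightarrow> nat) \<Rightarrow> real) \<Rightarrow> nat \<Rightarrow> 'w set \<Rightarrow> ereal \<Rightarrow> bool" where
  "is_gurevic_pressure M \<theta> l \<alpha> \<phi> a \<Omega>s p \<longleftrightarrow>
     (AE \<omega> in M. \<omega> \<in> \<Omega>s \<longrightarrow>
        ((\<lambda>n. eln (Zloop \<theta> l \<alpha> \<phi> a n \<omega>) / ereal (real n)) \<longlongrightarrow> p)
          (sequentially \<sqinter> principal (Jset \<theta> \<Omega>s \<omega>)))"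

definition Zseries :: "('w \<Rightarrow> 'w) \<Rightarrow> ('w \<Rightarrow> enat) \<Rightarrow> ('w \<Rightarrow> nat \<Rightarrow> nat \<Rightarrow> bool)
    \<Rightarrow> ('w \<Rightarrow> (nat \<Rightarrow> nat) \<Rightarrow> real) \<Rightarrow> ('w \<Rightarrow> nat \<Rightarrow> nat) \<Rightarrow> 'w set \<Rightarrow> real \<Rightarrow> 'w \<Rightarrow> ennreal" where
  "Zseries \<theta> l \<alpha> \<phi> \<xi> \<Omega>s s \<omega> =
     (\<Sum>n. if n \<in> Jset \<theta> \<Omega>s \<omega> then ennreal (s ^ n) * Zcal \<theta> l \<alpha> \<phi> \<xi> n \<omega> else 0)"

end

(* Let u_n(omega) and -v_n(omega) be the logarithms of the supremum and of the infimum of L^n 1 on the fiber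
   over theta^n omega, widened by the distortion log B there. Then u and v are subadditive with
   u + v >= 0. Big images, mixing and big preimages bound u_n + v_n at theta^(-n) eta uniformly in n, for
   almost every eta, so the means of (u_n + v_n) / n tend to 0 and the upper halves of Kingman's theorem
   for u and v match: u_n / n -> p and v_n / n -> -p. Both partition functions lie between exp (-v_n) and
   exp u_n up to subexponential factors, which gives the pressure and the convergence for s < exp (-p).
   If the terms exp (-p n) Z_n tended to 0 along the visits to a set of positive measure, then u_n - p n
   would drop by a fixed amount at a positive frequency of times, contradicting u_n / n -> p. *)
theory Submission
  imports Defs
begin

text \<open>With an infinite alphabet and a 2-Hoelder potential, distortion compares only points
  with the same first letter. To compare different first letters uniformly in \<open>n\<close>, the
  past of \<open>\<eta>\<close> is searched for a \<open>\<zeta>\<close> with big images, far enough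
  back for mixing. The block from \<open>\<zeta>\<close> to \<open>\<eta>\<close> stays fixed while
  \<open>n\<close> grows, so it costs a constant; at its two ends, where only one letter is shared,
  the finite one-letter variation is used. This bounds the gap at the points \<open>n\<close> steps
  before a fixed endpoint, not along a forward orbit. Forward it can be used in two ways: in mean,
  because \<open>\<theta>\<close> preserves integrals, and at visits to a set on which the constant
  is uniform. Keeping \<open>u\<close> and \<open>v\<close> as two subadditive sequences turns a
  lower bound for one into an upper bound for the other. So only upper bounds are needed from
  ergodic theory, and these come from one fact: the Birkhoff sums of a function with negative mean
  are almost surely bounded above.\<close>

lemma suminf_ge_infinitely_often:
  fixes f :: "nat \<Rightarrow> ennreal"
  assumes c: "c > 0" and io: "\<And>m. \<exists>n\<ge>m. ennreal c \<le> f n"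
  shows "(\<Sum>n. f n) = \<infinity>"
proof (rule ccontr)
  assume "(\<Sum>n. f n) \<noteq> \<infinity>"
  then obtain t where t: "(\<Sum>n. f n) = ennreal t" "0 \<le> t" by (cases "\<Sum>n. f n") auto
  have inf: "infinite {n. ennreal c \<le> f n}" using io by (auto simp: infinite_nat_iff_unbounded_le)
  have "real k * c \<le> t" for k
  proof -
    obtain F where F: "finite F" "card F = k" "F \<subseteq> {n. ennreal c \<le> f n}"
      using infinite_arbitrarily_large[OF inf] by blast
    have "ennreal (real k * c) = (\<Sum>n\<in>F. ennreal c)"
      using F c by (simp add: ennreal_mult ennreal_of_nat_eq_real_of_nat)
    also have "\<dots> \<le> sum f F" using F by (intro sum_mono) auto
    also have "\<dots> \<le> (\<Sum>n. f n)" by (rule sum_le_suminf) (use F in auto)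
    finally show ?thesis using t by (simp add: ennreal_le_iff)
  qed
  moreover obtain k :: nat where "real k > t / c" using reals_Archimedean2 by blast
  ultimately show False using c by (metis divide_less_eq not_less)
qed

lemma eln_exp [simp]: "eln (ennreal (exp x)) = ereal x"
  by (simp add: eln_def)

lemma e2ennreal_eln_top: "e2ennreal (eln x) = \<top> \<longleftrightarrow> x = \<top>"
  by (auto simp: eln_def e2ennreal_ereal e2ennreal_neg)

text \<open>At the times in \<open>J\<close> beyond \<open>m\<close> the two bounds make
  \<open>Z n\<close> positive and finite, so \<open>eln\<close> is an ordinary logarithm there.
  Dividing by \<open>n\<close> removes the constants and leaves the arbitrarily small slope
  error.\<close>

lemma log_average_tendsto:
  assumes low: "\<And>n. n \<in> J \<Longrightarrow> n \<ge> m \<Longrightarrow> ennreal (exp (f n)) \<le> Z n"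
    and up: "\<And>n. n \<in> J \<Longrightarrow> n \<ge> m \<Longrightarrow> Z n \<le> ennreal (exp (g n))"
    and f: "\<And>\<epsilon>. \<epsilon> > 0 \<Longrightarrow> \<exists>C. \<forall>n. (p - \<epsilon>) * real n - C \<le> f n"
    and g: "\<And>\<epsilon>. \<epsilon> > 0 \<Longrightarrow> \<exists>C. \<forall>n. g n \<le> C + (p + \<epsilon>) * real n"
  shows "((\<lambda>n. eln (Z n) / ereal (real n)) \<longlongrightarrow> ereal p) (sequentially \<sqinter> principal J)"
proof -
  define h where "h n = ln (enn2real (Z n))" for n
  have Z: "Z n = ennreal (exp (h n)) \<and> f n \<le> h n \<and> h n \<le> g n" if "n \<in> J" "n \<ge> m" for n
  proof -
    have pos: "0 < Z n" using less_le_trans[OF _ low[OF that]] by simp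
    have fin: "Z n < \<top>" using le_less_trans[OF up[OF that]] by simp
    have eq: "Z n = ennreal (exp (h n))" unfolding h_def using pos fin by (simp add: enn2real_positive_iff)
    then show ?thesis using low[OF that] up[OF that] by (simp add: ennreal_le_iff)
  qed
  have "((\<lambda>n. h n / real n) \<longlongrightarrow> p) (sequentially \<sqinter> principal J)"
  proof (rule tendstoI)
    fix e :: real assume e: "e > 0"
    obtain C where C: "\<And>n. (p - e / 2) * real n - C \<le> f n" using f[of "e / 2"] e by auto
    obtain D where D: "\<And>n. g n \<le> D + (p + e / 2) * real n" using g[of "e / 2"] e by auto
    obtain n1 :: nat where n1: "real n1 > (\<bar>C\<bar> + \<bar>D\<bar>) / (e / 2)" using reals_Archimedean2 by blast
    have "dist (h n / real n) p < e" if n: "n \<in> J" "n \<ge> max (max m n1) 1" for n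
    proof -
      have pos: "real n > 0" using n by simp
      have "\<bar>C\<bar> + \<bar>D\<bar> < e / 2 * real n1" using n1 e by (simp add: divide_less_eq mult.commute)
      also have "\<dots> \<le> e / 2 * real n" using n e by (intro mult_left_mono) auto
      finally have small: "\<bar>C\<bar> + \<bar>D\<bar> < e / 2 * real n" .
      have "h n < (p + e) * real n" "(p - e) * real n < h n"
        using Z[of n] n C[of n] D[of n] small unfolding distrib_right left_diff_distrib by auto
      then have "h n / real n < p + e" "p - e < h n / real n" using pos by (auto simp: divide_less_eq less_divide_eq)
      then show ?thesis by (simp add: dist_real_def abs_less_iff)
    qed
    then show "\<forall>\<^sub>F n in sequentially \<sqinter> principal J. dist (h n / real n) p < e"
      unfolding eventually_inf_principal eventually_sequentially by blast
  qed
  then have "((\<lambda>n. ereal (h n / real n)) \<longlongrightarrow> ereal p) (sequentially \<sqinter> principal J)" by (rule tendsto_ereal)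
  moreover have "\<forall>\<^sub>F n in sequentially \<sqinter> principal J. eln (Z n) / ereal (real n) = ereal (h n / real n)"
    unfolding eventually_inf_principal eventually_sequentially
    by (intro exI[of _ "max m 1"]) (use Z in \<open>auto simp: eln_exp\<close>)
  ultimately show ?thesis by (subst tendsto_cong)
qed

section \<open>Invertible ergodic maps\<close>

locale ergodic_mps =
  fixes M :: "'w measure" and \<theta> :: "'w \<Rightarrow> 'w"
  assumes mps: "invertible_ergodic_mps M \<theta>"
begin

section \<open>Orbits in both directions and invariance of the measure\<close>

abbreviation \<theta>i :: "'w \<Rightarrow> 'w" where "\<theta>i \<equiv> theta_inv M \<theta>"

lemma prob_space_M: "prob_space M"
  and bij_theta: "bij_betw \<theta> (space M) (space M)"
  and measurable_theta [measurable]: "\<theta> \<in> M \<rightarrow>\<^sub>M M"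
  and measurable_theta_inv [measurable]: "\<theta>i \<in> M \<rightarrow>\<^sub>M M"
  using mps unfolding invertible_ergodic_mps_def by auto

sublocale prob_space M by (rule prob_space_M)

lemma measurable_theta_funpow [measurable]: "(\<theta> ^^ n) \<in> M \<rightarrow>\<^sub>M M"
  and measurable_theta_inv_funpow [measurable]: "(\<theta>i ^^ n) \<in> M \<rightarrow>\<^sub>M M"
  by (induction n; simp)+

lemma theta_space [simp]: "\<omega> \<in> space M \<Longrightarrow> (\<theta> ^^ n) \<omega> \<in> space M"
  and theta_inv_space [simp]: "\<omega> \<in> space M \<Longrightarrow> (\<theta>i ^^ n) \<omega> \<in> space M"
  using measurable_space[OF measurable_theta_funpow] measurable_space[OF measurable_theta_inv_funpow] by auto

lemma theta_space1 [simp]: "\<omega> \<in> space M \<Longrightarrow> \<theta> \<omega> \<in> space M"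
  and theta_inv_space1 [simp]: "\<omega> \<in> space M \<Longrightarrow> \<theta>i \<omega> \<in> space M"
  using theta_space[of \<omega> 1] theta_inv_space[of \<omega> 1] by auto

lemma theta_inv_theta [simp]: "\<omega> \<in> space M \<Longrightarrow> \<theta>i (\<theta> \<omega>) = \<omega>"
  using bij_theta by (simp add: theta_inv_def bij_betw_def the_inv_into_f_f)

lemma theta_theta_inv [simp]: "\<omega> \<in> space M \<Longrightarrow> \<theta> (\<theta>i \<omega>) = \<omega>"
  using bij_theta by (simp add: theta_inv_def bij_betw_def f_the_inv_into_f)

lemma theta_theta_inv_funpow [simp]: "\<omega> \<in> space M \<Longrightarrow> (\<theta> ^^ n) ((\<theta>i ^^ n) \<omega>) = \<omega>"
proof (induction n arbitrary: \<omega>)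
  case (Suc n)
  have "(\<theta> ^^ Suc n) ((\<theta>i ^^ Suc n) \<omega>) = (\<theta> ^^ n) (\<theta> (\<theta>i ((\<theta>i ^^ n) \<omega>)))"
    unfolding funpow_Suc_right[of n \<theta>] by simp
  then show ?case using Suc by simp
qed simp

lemma theta_inv_theta_funpow [simp]: "\<omega> \<in> space M \<Longrightarrow> (\<theta>i ^^ n) ((\<theta> ^^ n) \<omega>) = \<omega>"
proof (induction n arbitrary: \<omega>)
  case (Suc n)
  have "(\<theta>i ^^ Suc n) ((\<theta> ^^ Suc n) \<omega>) = (\<theta>i ^^ n) (\<theta>i (\<theta> ((\<theta> ^^ n) \<omega>)))"
    unfolding funpow_Suc_right[of n \<theta>i] by simp
  then show ?case using Suc by simp
qed simp

lemma theta_inv_funpow_le: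
  assumes "\<omega> \<in> space M" "m \<le> n"
  shows "(\<theta> ^^ m) ((\<theta>i ^^ n) \<omega>) = (\<theta>i ^^ (n - m)) \<omega>"
proof -
  have "(\<theta>i ^^ n) \<omega> = (\<theta>i ^^ m) ((\<theta>i ^^ (n - m)) \<omega>)"
    using assms(2) by (simp flip: funpow_add comp_apply[where f="\<theta>i ^^ _" and g="\<theta>i ^^ _"])
  then show ?thesis using assms(1) by simp
qed

lemma theta_theta_inv_funpow2 [simp]: "\<omega> \<in> space M \<Longrightarrow> (\<theta> ^^ m) ((\<theta>i ^^ (n + m)) \<omega>) = (\<theta>i ^^ n) \<omega>"
  using theta_inv_funpow_le[of \<omega> m "n + m"] by simp

lemma theta_funpow_le:
  assumes "\<omega> \<in> space M" "m \<le> n"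
  shows "(\<theta>i ^^ m) ((\<theta> ^^ n) \<omega>) = (\<theta> ^^ (n - m)) \<omega>"
proof -
  have "(\<theta> ^^ n) \<omega> = (\<theta> ^^ m) ((\<theta> ^^ (n - m)) \<omega>)"
    using assms(2) by (simp flip: funpow_add comp_apply[where f="\<theta> ^^ _" and g="\<theta> ^^ _"])
  then show ?thesis using assms(1) by simp
qed

lemma distr_theta: "distr M M \<theta> = M"
  using mps by (intro measure_eqI) (auto simp: emeasure_distr invertible_ergodic_mps_def)

lemma distr_theta_inv: "distr M M \<theta>i = M"
proof -
  have "distr M M \<theta>i = distr (distr M M \<theta>) M \<theta>i" by (simp add: distr_theta)
  also have "\<dots> = distr M M (\<theta>i \<circ> \<theta>)"
    by (rule distr_distr) auto
  also have "\<dots> = distr M M (\<lambda>\<omega>. \<omega>)"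
    by (rule distr_cong) auto
  finally show ?thesis by (simp add: distr_id2)
qed

lemma distr_theta_funpow: "distr M M (\<theta> ^^ n) = M"
proof (induction n)
  case 0
  then show ?case by (simp add: distr_id)
next
  case (Suc n)
  have "distr M M (\<theta> ^^ Suc n) = distr (distr M M (\<theta> ^^ n)) M \<theta>"
    by (subst distr_distr) auto
  then show ?case by (simp only: Suc distr_theta)
qed

lemma distr_theta_inv_funpow: "distr M M (\<theta>i ^^ n) = M"
proof (induction n)
  case 0
  then show ?case by (simp add: distr_id)
next
  case (Suc n)
  have "distr M M (\<theta>i ^^ Suc n) = distr (distr M M (\<theta>i ^^ n)) M \<theta>i"
    by (subst distr_distr) auto
  then show ?case by (simp only: Suc distr_theta_inv)
qed

lemma AE_theta_funpow: "AE \<omega> in M. P \<omega> \<Longrightarrow> AE \<omega> in M. P ((\<theta> ^^ n) \<omega>)"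
  using AE_distrD[OF measurable_theta_funpow[of n], of P] by (simp only: distr_theta_funpow)

lemma AE_theta_inv_funpow: "AE \<omega> in M. P \<omega> \<Longrightarrow> AE \<omega> in M. P ((\<theta>i ^^ n) \<omega>)"
  using AE_distrD[OF measurable_theta_inv_funpow[of n], of P] by (simp only: distr_theta_inv_funpow)

lemma AE_orbit:
  assumes "AE \<omega> in M. P \<omega>"
  shows "AE \<omega> in M. \<forall>n. P ((\<theta> ^^ n) \<omega>) \<and> P ((\<theta>i ^^ n) \<omega>)"
  using AE_theta_funpow[OF assms] AE_theta_inv_funpow[OF assms] by (simp add: AE_all_countable)

lemma integrable_theta_funpow:
  "integrable M f \<Longrightarrow> integrable M (\<lambda>\<omega>. f ((\<theta> ^^ n) \<omega>) :: real)"
  using integrable_distr[OF measurable_theta_funpow, of n f] by (simp add: distr_theta_funpow)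

lemma integral_theta_funpow:
  assumes "f \<in> borel_measurable M"
  shows "(\<integral>\<omega>. f ((\<theta> ^^ n) \<omega>) \<partial>M) = (\<integral>\<omega>. f \<omega> \<partial>M :: real)"
  using integral_distr[OF measurable_theta_funpow, of f n] assms by (simp add: distr_theta_funpow)

lemma integral_theta_inv_funpow:
  assumes "f \<in> borel_measurable M"
  shows "(\<integral>\<omega>. f ((\<theta>i ^^ n) \<omega>) \<partial>M) = (\<integral>\<omega>. f \<omega> \<partial>M :: real)"
  using integral_distr[OF measurable_theta_inv_funpow, of f n] assms by (simp add: distr_theta_inv_funpow)

text \<open>Ergodicity is given for strictly invariant sets. The points whose orbit eventually stays
  in \<open>A\<close> form such a set \<open>A'\<close>. It contains \<open>A\<close> up to a null
  set, and it is the increasing union of the sets \<open>D n\<close> of measure at most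
  \<open>prob A\<close>, so both sets have the same measure.\<close>

lemma invariant_prob_0_1:
  assumes [measurable]: "A \<in> sets M" and inv: "AE \<omega> in M. \<omega> \<in> A \<longrightarrow> \<theta> \<omega> \<in> A"
  shows "prob A = 0 \<or> prob A = 1"
proof -
  define A' where "A' = {\<omega> \<in> space M. \<exists>n. \<forall>m\<ge>n. (\<theta> ^^ m) \<omega> \<in> A}"
  have meas [measurable]: "A' \<in> sets M" unfolding A'_def by measurable
  have "\<theta> -` A' \<inter> space M = A'"
  proof (intro set_eqI iffI)
    fix \<omega> assume "\<omega> \<in> \<theta> -` A' \<inter> space M"
    then obtain n where n: "\<omega> \<in> space M" "\<And>m. m \<ge> n \<Longrightarrow> (\<theta> ^^ m) (\<theta> \<omega>) \<in> A" unfolding A'_def by auto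
    have "(\<theta> ^^ m) \<omega> \<in> A" if m: "m \<ge> Suc n" for m
    proof -
      obtain k where "m = Suc k" "k \<ge> n" using m by (cases m) auto
      then show ?thesis using n(2)[of k] by (simp add: funpow_swap1)
    qed
    then show "\<omega> \<in> A'" unfolding A'_def using n(1) by blast
  next
    fix \<omega> assume "\<omega> \<in> A'"
    then obtain n where n: "\<omega> \<in> space M" "\<And>m. m \<ge> n \<Longrightarrow> (\<theta> ^^ m) \<omega> \<in> A" unfolding A'_def by auto
    have "(\<theta> ^^ m) (\<theta> \<omega>) \<in> A" if "m \<ge> n" for m
      using n(2)[of "Suc m"] that by (simp add: funpow_swap1)
    then show "\<omega> \<in> \<theta> -` A' \<inter> space M" using n unfolding A'_def by auto
  qed
  then have zo: "prob A' = 0 \<or> prob A' = 1"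
    using mps meas unfolding invertible_ergodic_mps_def by auto
  have "AE \<omega> in M. \<forall>n. (\<theta> ^^ n) \<omega> \<in> A \<longrightarrow> \<theta> ((\<theta> ^^ n) \<omega>) \<in> A"
    using AE_orbit[OF inv] by eventually_elim auto
  then have fwd: "AE \<omega> in M. \<omega> \<in> A \<longrightarrow> (\<forall>n. (\<theta> ^^ n) \<omega> \<in> A)"
  proof eventually_elim
    case (elim \<omega>)
    have "\<omega> \<in> A \<Longrightarrow> (\<theta> ^^ n) \<omega> \<in> A" for n
      by (induction n) (use elim in auto)
    then show ?case by auto
  qed
  have le1: "prob A \<le> prob A'"
  proof (rule finite_measure_mono_AE)
    show "AE x in M. x \<in> A \<longrightarrow> x \<in> A'"
      using fwd AE_space by eventually_elim (auto simp: A'_def)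
  qed simp
  define D where "D n = {\<omega> \<in> space M. \<forall>m\<ge>n. (\<theta> ^^ m) \<omega> \<in> A}" for n
  have D [measurable]: "D n \<in> sets M" for n unfolding D_def by measurable
  have "(\<lambda>n. prob (D n)) \<longlonglongrightarrow> prob (\<Union>n. D n)"
    by (rule finite_Lim_measure_incseq) (auto simp: incseq_def D_def)
  moreover have "(\<Union>n. D n) = A'" unfolding A'_def D_def by auto
  moreover have "prob (D n) \<le> prob A" for n
  proof -
    have "prob (D n) \<le> prob ((\<theta> ^^ n) -` A \<inter> space M)"
      by (rule finite_measure_mono) (auto simp: D_def)
    also have "\<dots> = measure (distr M M (\<theta> ^^ n)) A" by (simp add: measure_distr)
    finally show ?thesis by (simp add: distr_theta_funpow)
  qed
  ultimately have "prob A' \<le> prob A" by (auto intro!: LIMSEQ_le_const2)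
  then show ?thesis using zo le1 by auto
qed

section \<open>Birkhoff sums and the maximal ergodic inequality\<close>

definition birk :: "('w \<Rightarrow> real) \<Rightarrow> nat \<Rightarrow> 'w \<Rightarrow> real" where
  "birk g n \<omega> = (\<Sum>k<n. g ((\<theta> ^^ k) \<omega>))"

lemma birk_0: "birk g 0 \<omega> = 0"
  by (simp add: birk_def)

lemma birk_Suc: "birk g (Suc n) \<omega> = g \<omega> + birk g n (\<theta> \<omega>)"
  unfolding birk_def by (subst sum.lessThan_Suc_shift) (simp add: funpow_swap1)

lemma borel_measurable_birk [measurable]: "g \<in> borel_measurable M \<Longrightarrow> birk g n \<in> borel_measurable M"
  unfolding birk_def by (intro borel_measurable_sum measurable_compose[OF measurable_theta_funpow])

lemma integrable_birk: "integrable M g \<Longrightarrow> integrable M (birk g n)"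
  unfolding birk_def by (intro Bochner_Integration.integrable_sum integrable_theta_funpow)

text \<open>Garsia's argument: where the maximum \<open>F N\<close> is positive it is attained by a
  nonempty sum, and splitting off the first term gives
  \<open>F N \<omega> \<le> g \<omega> + F N (\<theta> \<omega>)\<close>. Integration cancels
  \<open>F N\<close> by invariance, and the region of positivity exhausts the space as
  \<open>N\<close> grows.\<close>

lemma maximal_ergodic:
  assumes g: "integrable M g" and pos: "AE \<omega> in M. \<exists>n. birk g n \<omega> > 0"
  shows "0 \<le> (\<integral>\<omega>. g \<omega> \<partial>M)"
proof -
  have [measurable]: "g \<in> borel_measurable M" using g by auto
  define F where "F N \<omega> = Max ((\<lambda>n. birk g n \<omega>) ` {..N})" for N \<omega>
  have F_int: "integrable M (F N)" for N
  proof (induction N)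
    case 0
    then show ?case unfolding F_def by (simp add: birk_def)
  next
    case (Suc N)
    have "F (Suc N) = (\<lambda>\<omega>. max (birk g (Suc N) \<omega>) (F N \<omega>))"
      unfolding F_def by (simp add: atMost_Suc)
    then show ?case using Suc integrable_birk[OF g] by auto
  qed
  have [measurable]: "F N \<in> borel_measurable M" for N using F_int by auto
  have F_ge: "birk g n \<omega> \<le> F N \<omega>" if "n \<le> N" for n N \<omega>
    unfolding F_def using that by (intro Max_ge) auto
  have F_nonneg: "0 \<le> F N \<omega>" for N \<omega> using F_ge[of 0 N \<omega>] by (simp add: birk_def)
  have key: "F N \<omega> \<le> g \<omega> + F N (\<theta> \<omega>)" if pos: "F N \<omega> > 0" for N \<omega>
  proof -
    have "F N \<omega> \<in> (\<lambda>n. birk g n \<omega>) ` {..N}" unfolding F_def by (intro Max_in) auto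
    then obtain n where n: "n \<le> N" "F N \<omega> = birk g n \<omega>" by auto
    have "n \<noteq> 0" using pos n(2) by (metis birk_0 less_irrefl)
    then obtain k where k: "n = Suc k" by (cases n) auto
    then show ?thesis using n F_ge[of k N "\<theta> \<omega>"] birk_Suc[of g k \<omega>] by simp
  qed
  have step: "0 \<le> (\<integral>\<omega>. (if F N \<omega> > 0 then g \<omega> else 0) \<partial>M)" for N
  proof -
    have i: "integrable M (\<lambda>\<omega>. if F N \<omega> > 0 then g \<omega> else 0)"
      by (rule Bochner_Integration.integrable_bound[OF g]) auto
    have i2: "integrable M (\<lambda>\<omega>. F N (\<theta> \<omega>))" using integrable_theta_funpow[OF F_int, of N 1] by simp
    \<comment> \<open>The empty sum in the maximum makes \<open>F N\<close> nonnegative, so outside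
      the region of positivity the inequality reads
      \<open>0 \<le> F N (\<theta> \<omega>)\<close>.\<close>
    have "(\<integral>\<omega>. F N \<omega> \<partial>M) \<le> (\<integral>\<omega>. (if F N \<omega> > 0 then g \<omega> else 0) + F N (\<theta> \<omega>) \<partial>M)"
      using key F_nonneg i i2 F_int by (intro integral_mono) (auto simp: not_less intro: order_trans)
    also have "\<dots> = (\<integral>\<omega>. (if F N \<omega> > 0 then g \<omega> else 0) \<partial>M) + (\<integral>\<omega>. F N \<omega> \<partial>M)"
      using i i2 integral_theta_funpow[of "F N" 1] by (simp add: Bochner_Integration.integral_add)
    finally show ?thesis by simp
  qed
  have "(\<lambda>N. \<integral>\<omega>. (if F N \<omega> > 0 then g \<omega> else 0) \<partial>M) \<longlonglongrightarrow> (\<integral>\<omega>. g \<omega> \<partial>M)"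
  proof (rule integral_dominated_convergence[where w="\<lambda>\<omega>. \<bar>g \<omega>\<bar>"])
    show "AE \<omega> in M. (\<lambda>N. if F N \<omega> > 0 then g \<omega> else 0) \<longlonglongrightarrow> g \<omega>"
      using pos
    proof eventually_elim
      case (elim \<omega>)
      then obtain n where n: "birk g n \<omega> > 0" by auto
      have "eventually (\<lambda>N. (if F N \<omega> > 0 then g \<omega> else 0) = g \<omega>) sequentially"
        using eventually_ge_at_top[of n] by eventually_elim (use n F_ge[of n] in \<open>auto dest: less_le_trans\<close>)
      then show ?case by (rule tendsto_eventually)
    qed
  qed (use g in auto)
  then show ?thesis using step by (auto intro: LIMSEQ_le_const)
qed

text \<open>Unboundedness is forward invariant, as dropping the first term shifts all sums by a
  fixed amount, so it has probability 0 or 1, and probability 1 contradicts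
  \<open>maximal_ergodic\<close>. This takes the place of the pointwise ergodic theorem: the almost
  sure growth bounds below come from suitable \<open>g\<close> of negative mean.\<close>

lemma birk_bounded_above:
  assumes g: "integrable M g" and neg: "(\<integral>\<omega>. g \<omega> \<partial>M) < 0"
  shows "AE \<omega> in M. \<exists>K. \<forall>n. birk g n \<omega> \<le> K"
proof -
  have [measurable]: "g \<in> borel_measurable M" using g by auto
  define A where "A = {\<omega> \<in> space M. \<forall>K::nat. \<exists>n. birk g n \<omega> > real K}"
  have A [measurable]: "A \<in> sets M" unfolding A_def by measurable
  have "AE \<omega> in M. \<omega> \<in> A \<longrightarrow> \<theta> \<omega> \<in> A"
  proof (intro AE_I2 impI)
    fix \<omega> assume w: "\<omega> \<in> space M" "\<omega> \<in> A"
    have "\<exists>n. birk g n (\<theta> \<omega>) > real K" for K :: nat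
    proof -
      define K' where "K' = nat \<lceil>real K + \<bar>g \<omega>\<bar>\<rceil>"
      obtain n where n: "birk g n \<omega> > real K'" using w unfolding A_def by auto
      have K': "real K' \<ge> real K + \<bar>g \<omega>\<bar>" unfolding K'_def by linarith
      have "n \<noteq> 0" using n by (metis birk_0 not_less of_nat_0_le_iff)
      then obtain k where "n = Suc k" by (cases n) auto
      then have "birk g k (\<theta> \<omega>) > real K" using n K' birk_Suc[of g k \<omega>] by simp
      then show ?thesis by blast
    qed
    then show "\<theta> \<omega> \<in> A" using w unfolding A_def by auto
  qed
  then have "prob A = 0 \<or> prob A = 1" by (rule invariant_prob_0_1[OF A])
  moreover have "prob A \<noteq> 1"
  proof
    assume "prob A = 1"
    then have "AE \<omega> in M. \<omega> \<in> A" using prob_eq_1[OF A] by simp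
    then have "AE \<omega> in M. \<exists>n. birk g n \<omega> > 0"
      by eventually_elim (auto simp: A_def elim!: allE[of _ 0])
    then show False using maximal_ergodic[OF g] neg by linarith
  qed
  ultimately have "prob A = 0" by simp
  then have "AE \<omega> in M. \<omega> \<notin> A" using prob_eq_0[OF A] by simp
  then show ?thesis using AE_space
    by eventually_elim (auto simp: A_def not_less)
qed

text \<open>The factor 1/2 leaves room for a negative mean: \<open>prob A / 2 - indicator A\<close>
  integrates to \<open>- prob A / 2\<close>.\<close>

lemma visits_linear:
  assumes [measurable]: "A \<in> sets M" and pos: "prob A > 0"
  shows "AE \<omega> in M. \<exists>K. \<forall>n. prob A / 2 * real n - K \<le> birk (indicator A) n \<omega>"
proof -
  define g where "g \<omega> = prob A / 2 - indicator A \<omega>" for \<omega>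
  have g: "integrable M g" unfolding g_def by (auto intro: integrable_real_indicator simp: less_top[symmetric])
  have "(\<integral>\<omega>. g \<omega> \<partial>M) = prob A / 2 - prob A"
    unfolding g_def by (subst Bochner_Integration.integral_diff) (auto simp: prob_space less_top[symmetric])
  then have "(\<integral>\<omega>. g \<omega> \<partial>M) < 0" using pos by simp
  from birk_bounded_above[OF g this] show ?thesis
  proof eventually_elim
    case (elim \<omega>)
    have "birk g n \<omega> = prob A / 2 * real n - birk (indicator A) n \<omega>" for n
      unfolding birk_def g_def by (simp add: sum_subtractf)
    then show ?case using elim by (metis diff_le_eq add.commute)
  qed
qed

lemma recurrent:
  assumes A: "A \<in> sets M" and pos: "prob A > 0"
  shows "AE \<omega> in M. \<forall>m. \<exists>n\<ge>m. (\<theta> ^^ n) \<omega> \<in> A"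
  using visits_linear[OF A pos]
proof eventually_elim
  case (elim \<omega>)
  then obtain K where K: "\<And>n. prob A / 2 * real n - K \<le> birk (indicator A) n \<omega>" by auto
  show ?case
  proof (rule ccontr)
    assume "\<not> (\<forall>m. \<exists>n\<ge>m. (\<theta> ^^ n) \<omega> \<in> A)"
    then obtain m where m: "\<And>n. n \<ge> m \<Longrightarrow> (\<theta> ^^ n) \<omega> \<notin> A" by auto
    have bd: "birk (indicator A) n \<omega> \<le> real m" for n
    proof -
      have "birk (indicator A) n \<omega> \<le> (\<Sum>k<n. if k < m then 1 else 0)"
        unfolding birk_def using m by (intro sum_mono) (auto simp: indicator_def not_less)
      also have "\<dots> = real (card ({..<n} \<inter> {k. k < m}))" by (simp add: sum.If_cases)
      also have "\<dots> \<le> real (card {..<m})" by (intro of_nat_mono card_mono) auto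
      finally show ?thesis by simp
    qed
    obtain n :: nat where "real n > (real m + K) / (prob A / 2)" using reals_Archimedean2 by blast
    then have "real n * (prob A / 2) > real m + K" using pos by (simp add: divide_less_eq)
    then show False using K[of n] bd[of n] by (simp add: algebra_simps)
  qed
qed

section \<open>Sublinear growth along orbits and uniform constants on subsets\<close>

lemma tail_integral_small:
  assumes h: "integrable M h" and "\<epsilon> > (0::real)"
  shows "\<exists>K::nat. (\<integral>\<omega>. max (\<bar>h \<omega>\<bar> - real K) 0 \<partial>M) < \<epsilon>"
proof -
  have [measurable]: "h \<in> borel_measurable M" using h by auto
  have "(\<lambda>K. \<integral>\<omega>. max (\<bar>h \<omega>\<bar> - real K) 0 \<partial>M) \<longlonglongrightarrow> (\<integral>\<omega>. 0 \<partial>M)"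
  proof (rule integral_dominated_convergence[where w="\<lambda>\<omega>. \<bar>h \<omega>\<bar>"])
    show "AE \<omega> in M. (\<lambda>K. max (\<bar>h \<omega>\<bar> - real K) 0) \<longlonglongrightarrow> 0"
    proof (intro AE_I2 tendsto_eventually)
      fix \<omega>
      have "max (\<bar>h \<omega>\<bar> - real K) 0 = 0" if "nat \<lceil>\<bar>h \<omega>\<bar>\<rceil> \<le> K" for K
        using real_nat_ceiling_ge[of "\<bar>h \<omega>\<bar>"] of_nat_mono[OF that, where 'a=real] by linarith
      then show "\<forall>\<^sub>F K in sequentially. max (\<bar>h \<omega>\<bar> - real K) 0 = 0"
        unfolding eventually_sequentially by blast
    qed
  qed (use h in auto)
  then have "\<forall>\<^sub>F K in sequentially. (\<integral>\<omega>. max (\<bar>h \<omega>\<bar> - real K) 0 \<partial>M) < \<epsilon>"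
    using assms(2) order_tendstoD(2) by fastforce
  then show ?thesis by (auto simp: eventually_sequentially)
qed

text \<open>The excess of \<open>\<bar>h\<bar>\<close> over a high level \<open>K\<close> has mean
  below \<open>\<epsilon>\<close>, so its Birkhoff sums grow at most with slope
  \<open>\<epsilon>\<close>. The summands are nonnegative, hence the last one alone obeys the same
  bound.\<close>

lemma theta_small_o:
  assumes h: "integrable M h" and "\<epsilon> > (0::real)"
  shows "AE \<omega> in M. \<exists>C. \<forall>n. \<bar>h ((\<theta> ^^ n) \<omega>)\<bar> \<le> C + \<epsilon> * real n"
proof -
  obtain K :: nat where K: "(\<integral>\<omega>. max (\<bar>h \<omega>\<bar> - real K) 0 \<partial>M) < \<epsilon>"
    using tail_integral_small[OF assms] by blast
  define g where "g \<omega> = max (\<bar>h \<omega>\<bar> - real K) 0 - \<epsilon>" for \<omega>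
  have i: "integrable M (\<lambda>\<omega>. max (\<bar>h \<omega>\<bar> - real K) 0)" using h by auto
  have g: "integrable M g" unfolding g_def using i by auto
  have "(\<integral>\<omega>. g \<omega> \<partial>M) < 0" unfolding g_def using K i by (simp add: prob_space)
  from birk_bounded_above[OF g this] show ?thesis
  proof eventually_elim
    case (elim \<omega>)
    then obtain C where C: "\<And>n. birk g n \<omega> \<le> C" by auto
    have "\<bar>h ((\<theta> ^^ n) \<omega>)\<bar> \<le> (real K + \<epsilon> + C) + \<epsilon> * real n" for n
    proof -
      have "birk g (Suc n) \<omega> = birk (\<lambda>\<omega>. max (\<bar>h \<omega>\<bar> - real K) 0) (Suc n) \<omega> - \<epsilon> * real (Suc n)"
        unfolding birk_def g_def by (simp add: sum_subtractf algebra_simps)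
      moreover have "birk (\<lambda>\<omega>. max (\<bar>h \<omega>\<bar> - real K) 0) (Suc n) \<omega> \<ge> max (\<bar>h ((\<theta> ^^ n) \<omega>)\<bar> - real K) 0"
        unfolding birk_def by (simp add: sum_nonneg)
      ultimately show ?thesis using C[of "Suc n"] by (simp add: algebra_simps)
    qed
    then show ?case by blast
  qed
qed

lemma theta_small_o_all:
  assumes h: "integrable M h"
  shows "AE \<omega> in M. \<forall>\<epsilon>>0. \<exists>C. \<forall>n. \<bar>h ((\<theta> ^^ n) \<omega>)\<bar> \<le> C + \<epsilon> * real n"
proof -
  have "AE \<omega> in M. \<forall>j. \<exists>C. \<forall>n. \<bar>h ((\<theta> ^^ n) \<omega>)\<bar> \<le> C + 1 / real (Suc j) * real n"
    by (subst AE_all_countable, intro allI theta_small_o[OF h]) simp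
  then show ?thesis
  proof (eventually_elim, intro allI impI)
    case (elim \<omega>)
    fix \<epsilon> :: real assume "\<epsilon> > 0"
    then obtain j where j: "1 / real (Suc j) < \<epsilon>" using nat_approx_posE by metis
    obtain C where C: "\<And>n. \<bar>h ((\<theta> ^^ n) \<omega>)\<bar> \<le> C + 1 / real (Suc j) * real n" using elim by blast
    have "1 / real (Suc j) * real n \<le> \<epsilon> * real n" for n using j by (intro mult_right_mono) auto
    then have "\<bar>h ((\<theta> ^^ n) \<omega>)\<bar> \<le> C + \<epsilon> * real n" for n using C[of n] by (meson add_left_mono order_trans)
    then show "\<exists>C. \<forall>n. \<bar>h ((\<theta> ^^ n) \<omega>)\<bar> \<le> C + \<epsilon> * real n" by blast
  qed
qed

text \<open>Makes the recurrence lemma available for the past; the search for big images runs along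
  \<open>\<theta>i\<close>.\<close>

lemma ergodic_mps_theta_inv: "ergodic_mps M \<theta>i"
proof
  have bij: "bij_betw \<theta>i (space M) (space M)"
    unfolding theta_inv_def by (rule bij_betw_the_inv_into[OF bij_theta])
  have inv: "theta_inv M \<theta>i \<omega> = \<theta> \<omega>" if "\<omega> \<in> space M" for \<omega>
    unfolding theta_inv_def[of M "\<theta>i"] using that bij
    by (intro the_inv_into_f_eq) (auto simp: bij_betw_def)
  have m: "theta_inv M \<theta>i \<in> M \<rightarrow>\<^sub>M M"
    by (rule measurable_cong[THEN iffD2, OF _ measurable_theta]) (rule inv)
  have e: "emeasure M (\<theta>i -` A \<inter> space M) = emeasure M A" if "A \<in> sets M" for A
    using emeasure_distr[OF measurable_theta_inv that] by (simp add: distr_theta_inv)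
  have "prob A = 0 \<or> prob A = 1" if A: "A \<in> sets M" "\<theta>i -` A \<inter> space M = A" for A
  proof -
    have "\<theta> -` A \<inter> space M = A"
    proof (intro set_eqI iffI)
      fix \<omega> assume "\<omega> \<in> \<theta> -` A \<inter> space M"
      then have "\<theta> \<omega> \<in> \<theta>i -` A \<inter> space M" "\<omega> \<in> space M" using A(2) by auto
      then show "\<omega> \<in> A" by simp
    next
      fix \<omega> assume w: "\<omega> \<in> A"
      then have s: "\<omega> \<in> space M" using A sets.sets_into_space by blast
      then have "\<theta> \<omega> \<in> \<theta>i -` A \<inter> space M" using w by simp
      then show "\<omega> \<in> \<theta> -` A \<inter> space M" using A(2) s by auto
    qed
    then show ?thesis using mps A(1) unfolding invertible_ergodic_mps_def by auto
  qed
  then show "invertible_ergodic_mps M \<theta>i"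
    unfolding invertible_ergodic_mps_def using prob_space_M bij m e by auto
qed

lemma sets_restrict_Collect: "A \<in> sets M \<Longrightarrow> {\<omega> \<in> space M. P \<omega>} \<in> sets M \<Longrightarrow> {\<omega> \<in> A. P \<omega>} \<in> sets M"
proof -
  assume A: "A \<in> sets M" and P: "{\<omega> \<in> space M. P \<omega>} \<in> sets M"
  have "{\<omega> \<in> A. P \<omega>} = A \<inter> {\<omega> \<in> space M. P \<omega>}" using sets.sets_into_space[OF A] by auto
  then show ?thesis using A P by simp
qed

text \<open>Countable additivity: a bound that exists almost surely on \<open>A\<close> can be fixed
  on a subset of positive measure. This is how pointwise constants become uniform.\<close>

lemma positive_prob_Ex:
  assumes sets: "\<And>k::nat. {\<omega> \<in> A. P k \<omega>} \<in> sets M"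
    and AE: "AE \<omega> in M. \<omega> \<in> A \<longrightarrow> (\<exists>k. P k \<omega>)"
    and A: "A \<in> sets M" "prob A > 0"
  shows "\<exists>k. prob {\<omega> \<in> A. P k \<omega>} > 0"
proof (rule ccontr)
  assume "\<nexists>k. prob {\<omega> \<in> A. P k \<omega>} > 0"
  then have "prob {\<omega> \<in> A. P k \<omega>} = 0" for k
    by (meson measure_nonneg not_less order_antisym)
  then have "AE \<omega> in M. \<omega> \<notin> {\<omega> \<in> A. P k \<omega>}" for k
    using prob_eq_0[OF sets[of k]] by simp
  then have "AE \<omega> in M. \<forall>k. \<omega> \<notin> {\<omega> \<in> A. P k \<omega>}" by (subst AE_all_countable) blast
  with AE have "AE \<omega> in M. \<omega> \<notin> A" by eventually_elim auto
  then show False using prob_eq_0[OF A(1)] A(2) by simp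
qed

text \<open>Cutting \<open>n\<close> into blocks of length \<open>m\<close> and averaging over the \<open>m\<close> possible starting offsets
  reduces the bound to Birkhoff sums of \<open>u m\<close> under \<open>\<theta>\<close> itself; \<open>\<theta> ^^ m\<close> need not be ergodic.\<close>

lemma subadditive_growth:
  assumes u: "\<And>n. integrable M (u n)"
    and sub: "AE \<omega> in M. \<forall>n k. u (n + k) \<omega> \<le> u n \<omega> + u k ((\<theta> ^^ n) \<omega>)"
    and m: "m > 0" and c: "(\<integral>\<omega>. u m \<omega> \<partial>M) < real m * c" and e: "\<epsilon> > (0::real)"
  shows "AE \<omega> in M. \<exists>C. \<forall>n. u n \<omega> \<le> C + (c + \<epsilon>) * real n"
proof -
  \<comment> \<open>\<open>H\<close> has to dominate both incomplete pieces, the initial one of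
    length \<open>i < m\<close> and the final one of length \<open>s - i < 2 * m\<close>.\<close>
  define H where "H \<omega> = (\<Sum>r<2*m. \<bar>u r \<omega>\<bar>)" for \<omega>
  have H: "integrable M H" unfolding H_def using u by auto
  have uH: "u r \<omega> \<le> H \<omega>" if "r < 2 * m" for r \<omega>
    unfolding H_def using member_le_sum[of r "{..<2*m}" "\<lambda>r. \<bar>u r \<omega>\<bar>"] that by force
  define g where "g \<omega> = u m \<omega> / real m - c" for \<omega>
  have g: "integrable M g" unfolding g_def using u by auto
  have "(\<integral>\<omega>. g \<omega> \<partial>M) = (\<integral>\<omega>. u m \<omega> \<partial>M) / real m - c"
    unfolding g_def using u by (simp add: prob_space)
  also have "\<dots> < 0" using c m by (simp add: divide_less_eq mult.commute)
  finally have gneg: "(\<integral>\<omega>. g \<omega> \<partial>M) < 0" .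
  show ?thesis
    using theta_small_o[OF H e] birk_bounded_above[OF g gneg] AE_orbit[OF sub]
  proof eventually_elim
    case (elim \<omega>)
    from elim(1) obtain C where "\<And>n. \<bar>H ((\<theta> ^^ n) \<omega>)\<bar> \<le> C + \<epsilon> * real n" by auto
    then have C: "H ((\<theta> ^^ n) \<omega>) \<le> C + \<epsilon> * real n" for n by (meson abs_le_D1)
    from elim(2) obtain K where K: "\<And>n. birk g n \<omega> \<le> K" by auto
    have sub': "u (n + k) ((\<theta> ^^ t) \<omega>) \<le> u n ((\<theta> ^^ t) \<omega>) + u k ((\<theta> ^^ (t + n)) \<omega>)" for n k t
      using elim(3)[rule_format, of t, THEN conjunct1, rule_format, of n k]
      by (simp only: add.commute[of t n] funpow_add comp_apply)
    have blocks: "u (q * m + r) ((\<theta> ^^ t) \<omega>)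
        \<le> (\<Sum>j<q. u m ((\<theta> ^^ (t + j * m)) \<omega>)) + u r ((\<theta> ^^ (t + q * m)) \<omega>)" for q r t
    proof (induction q arbitrary: r)
      case (Suc q)
      have "u (Suc q * m + r) ((\<theta> ^^ t) \<omega>) = u (q * m + (m + r)) ((\<theta> ^^ t) \<omega>)" by (simp add: algebra_simps)
      also have "\<dots> \<le> (\<Sum>j<q. u m ((\<theta> ^^ (t + j * m)) \<omega>)) + u (m + r) ((\<theta> ^^ (t + q * m)) \<omega>)"
        by (rule Suc)
      also have "u (m + r) ((\<theta> ^^ (t + q * m)) \<omega>)
          \<le> u m ((\<theta> ^^ (t + q * m)) \<omega>) + u r ((\<theta> ^^ (t + q * m + m)) \<omega>)" by (rule sub')
      finally show ?case by (simp add: algebra_simps)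
    qed simp
    have long: "u n \<omega> \<le> (2 * C + K + 2 * real m * \<bar>c\<bar>) + (c + \<epsilon>) * real n" (is "_ \<le> ?C1 + _") if n: "n \<ge> m" for n
    proof -
      \<comment> \<open>One complete block is given up, so that the remainder \<open>s\<close> is at
        least \<open>m\<close> and \<open>s - i\<close> is a genuine length for every offset
        \<open>i < m\<close>.\<close>
      define q where "q = n div m - 1"
      define s where "s = n - q * m"
      have "n div m \<ge> 1" using n m by (simp add: Suc_leI div_greater_zero_iff)
      then have "n = (q + 1) * m + n mod m" unfolding q_def by simp
      then have ns: "n = q * m + s" "s < 2 * m" "m \<le> s"
        using mod_less_divisor[OF m, of n] unfolding s_def by (auto simp: algebra_simps)
      have each: "u n \<omega> \<le> H \<omega> + (\<Sum>j<q. u m ((\<theta> ^^ (i + j * m)) \<omega>)) + (C + \<epsilon> * real n)" if i: "i < m" for i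
      proof -
        have "u n \<omega> = u (i + (q * m + (s - i))) \<omega>" using ns i by (simp add: algebra_simps)
        also have "\<dots> \<le> u i \<omega> + u (q * m + (s - i)) ((\<theta> ^^ i) \<omega>)" using sub'[of i _ 0] by simp
        also have "u (q * m + (s - i)) ((\<theta> ^^ i) \<omega>)
            \<le> (\<Sum>j<q. u m ((\<theta> ^^ (i + j * m)) \<omega>)) + u (s - i) ((\<theta> ^^ (i + q * m)) \<omega>)" by (rule blocks)
        also have "u (s - i) ((\<theta> ^^ (i + q * m)) \<omega>) \<le> C + \<epsilon> * real (i + q * m)"
          using uH[of "s - i"] ns C order_trans by (meson less_imp_diff_less)
        also have "\<epsilon> * real (i + q * m) \<le> \<epsilon> * real n"
          using e ns i by (intro mult_left_mono of_nat_mono) auto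
        also have "u i \<omega> \<le> H \<omega>" using uH i by simp
        finally show ?thesis by simp
      qed
      \<comment> \<open>Summing over the offsets meets each time below \<open>q * m\<close> exactly
        once, which turns the block sums into one Birkhoff sum of \<open>u m\<close> under
        \<open>\<theta>\<close>.\<close>
      have "real m * u n \<omega> = (\<Sum>i<m. u n \<omega>)" by simp
      also have "\<dots> \<le> (\<Sum>i<m. H \<omega> + (\<Sum>j<q. u m ((\<theta> ^^ (i + j * m)) \<omega>)) + (C + \<epsilon> * real n))"
        by (rule sum_mono) (use each in auto)
      also have "\<dots> = real m * (H \<omega> + C + \<epsilon> * real n) + (\<Sum>i<m. \<Sum>j<q. u m ((\<theta> ^^ (i + j * m)) \<omega>))"
        by (simp add: sum.distrib algebra_simps)
      also have "(\<Sum>i<m. \<Sum>j<q. u m ((\<theta> ^^ (i + j * m)) \<omega>)) = (\<Sum>j<q. \<Sum>i<m. u m ((\<theta> ^^ (i + j * m)) \<omega>))"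
        by (rule sum.swap)
      also have "\<dots> = (\<Sum>j<q. sum (\<lambda>k. u m ((\<theta> ^^ k) \<omega>)) {j * m..<j * m + m})"
      proof (rule sum.cong[OF refl])
        fix j
        show "(\<Sum>i<m. u m ((\<theta> ^^ (i + j * m)) \<omega>)) = sum (\<lambda>k. u m ((\<theta> ^^ k) \<omega>)) {j * m..<j * m + m}"
          using sum.shift_bounds_nat_ivl[of "\<lambda>k. u m ((\<theta> ^^ k) \<omega>)" 0 "j * m" m]
          by (simp add: atLeast0LessThan add.commute)
      qed
      also have "\<dots> = (\<Sum>k<q * m. u m ((\<theta> ^^ k) \<omega>))" by (rule sum.nat_group)
      also have "\<dots> = real m * (birk g (q * m) \<omega> + c * real (q * m))"
        unfolding birk_def g_def using m by (simp add: sum_subtractf sum_divide_distrib[symmetric] field_simps)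
      also have "\<dots> \<le> real m * (K + c * real (q * m))"
        using K[of "q * m"] m by simp
      finally have "real m * u n \<omega> \<le> real m * (H \<omega> + C + \<epsilon> * real n + K + c * real (q * m))"
        by (simp add: algebra_simps)
      then have "u n \<omega> \<le> H \<omega> + C + \<epsilon> * real n + K + c * real (q * m)" using m by simp
      moreover have "H \<omega> \<le> C" using C[of 0] by simp
      \<comment> \<open>Since \<open>c\<close> may be negative, replacing \<open>q * m\<close> by
        \<open>n\<close> can cost \<open>\<bar>c\<bar>\<close> for each of the fewer than
        \<open>2 * m\<close> missing times.\<close>
      moreover have "c * real (q * m) \<le> c * real n + 2 * real m * \<bar>c\<bar>"
      proof -
        have "c * real (q * m) = c * real n - c * real s" using ns by (simp add: algebra_simps)
        moreover have "- (c * real s) \<le> \<bar>c\<bar> * real s" by (metis abs_ge_minus_self abs_mult abs_of_nat)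
        moreover have "\<bar>c\<bar> * real s \<le> \<bar>c\<bar> * (2 * real m)" using ns by (intro mult_left_mono) auto
        ultimately show ?thesis by (simp add: mult_ac)
      qed
      ultimately show ?thesis by (simp add: algebra_simps)
    qed
    have short: "u n \<omega> \<le> (C + \<bar>c\<bar> * real m) + (c + \<epsilon>) * real n" if "n < m" for n
    proof -
      have "u n \<omega> \<le> C" using uH[of n \<omega>] C[of 0] that by simp
      moreover have "- (c * real n) \<le> \<bar>c\<bar> * real n" by (metis abs_ge_minus_self abs_mult abs_of_nat)
      moreover have "\<bar>c\<bar> * real n \<le> \<bar>c\<bar> * real m" using that by (intro mult_left_mono) auto
      moreover have "\<epsilon> * real n \<ge> 0" using e by simp
      ultimately show ?thesis unfolding distrib_right by linarith
    qed
    have "u n \<omega> \<le> max ?C1 (C + \<bar>c\<bar> * real m) + (c + \<epsilon>) * real n" for n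
      using long[of n] short[of n] by linarith
    then show ?case by blast
  qed
qed

end

section \<open>Subadditive sequences with bounded gap\<close>

locale subadditive_pair = ergodic_mps M \<theta> for M :: "'w measure" and \<theta> +
  fixes u v :: "nat \<Rightarrow> 'w \<Rightarrow> real"
  assumes int_u: "\<And>n. integrable M (u n)" and int_v: "\<And>n. integrable M (v n)"
    and sub_u: "AE \<omega> in M. \<forall>n k. u (n + k) \<omega> \<le> u n \<omega> + u k ((\<theta> ^^ n) \<omega>)"
    and sub_v: "AE \<omega> in M. \<forall>n k. v (n + k) \<omega> \<le> v n \<omega> + v k ((\<theta> ^^ n) \<omega>)"
    and nonneg: "AE \<omega> in M. \<forall>n. 0 \<le> u n \<omega> + v n \<omega>"
    and bounded_back: "AE \<omega> in M. \<exists>C. \<forall>n. u n ((\<theta>i ^^ n) \<omega>) + v n ((\<theta>i ^^ n) \<omega>) \<le> C"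
begin

lemma borel_uv [measurable]: "u n \<in> borel_measurable M" "v n \<in> borel_measurable M"
  using int_u int_v by auto

text \<open>Boundedness holds pointwise \<open>n\<close> steps back, but no single integrable
  function is at hand that dominates all \<open>w n / n\<close>. Truncation at \<open>K\<close>
  makes dominated convergence applicable, and the excess lies below a Birkhoff average of
  \<open>g\<close>, whose mean is below \<open>\<epsilon> / 2\<close> for every
  \<open>n\<close>.\<close>

lemma gap_sublinear_mean:
  assumes e: "\<epsilon> > 0"
  shows "\<exists>n>0. (\<integral>\<omega>. u n \<omega> \<partial>M) + (\<integral>\<omega>. v n \<omega> \<partial>M) < \<epsilon> * real n"
proof -
  define w where "w n \<omega> = u n \<omega> + v n \<omega>" for n \<omega>
  have w: "integrable M (w n)" for n unfolding w_def using int_u int_v by auto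
  have [measurable]: "w n \<in> borel_measurable M" for n using w by auto
  obtain K :: nat where K: "(\<integral>\<omega>. max (\<bar>w 1 \<omega>\<bar> - real K) 0 \<partial>M) < \<epsilon> / 2"
    using tail_integral_small[OF w, of "\<epsilon> / 2" 1] e by auto
  define g where "g \<omega> = max (\<bar>w 1 \<omega>\<bar> - real K) 0" for \<omega>
  have g: "integrable M g" unfolding g_def using w by auto
  have [measurable]: "g \<in> borel_measurable M" using g by auto
  have birk_w: "AE \<omega> in M. \<forall>n. w (Suc n) \<omega> \<le> birk (w 1) (Suc n) \<omega>"
    using AE_orbit[OF sub_u] AE_orbit[OF sub_v]
  proof eventually_elim
    case (elim \<omega>)
    have "w (Suc n) ((\<theta> ^^ t) \<omega>) \<le> birk (w 1) (Suc n) ((\<theta> ^^ t) \<omega>)" for n t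
    proof (induction n arbitrary: t)
      case 0
      then show ?case by (simp add: birk_def)
    next
      case (Suc n)
      have "w (1 + Suc n) ((\<theta> ^^ t) \<omega>) \<le> w 1 ((\<theta> ^^ t) \<omega>) + w (Suc n) (\<theta> ((\<theta> ^^ t) \<omega>))"
        using elim(1)[rule_format, of t, THEN conjunct1, rule_format, of 1 "Suc n"]
          elim(2)[rule_format, of t, THEN conjunct1, rule_format, of 1 "Suc n"]
        unfolding w_def by (simp del: add_Suc add_Suc_right plus_1_eq_Suc)
      also have "w (Suc n) (\<theta> ((\<theta> ^^ t) \<omega>)) \<le> birk (w 1) (Suc n) (\<theta> ((\<theta> ^^ t) \<omega>))"
        using Suc[of "Suc t"] by simp
      finally show ?case by (simp add: birk_Suc[of _ "Suc n"])
    qed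
    from this[of _ 0] show ?case by simp
  qed
  define x where "x n \<omega> = min (w (Suc n) \<omega> / real (Suc n)) (real K)" for n \<omega>
  have [measurable]: "x n \<in> borel_measurable M" for n unfolding x_def by measurable
  have x_int: "integrable M (x n)" for n unfolding x_def using w by auto
  have le: "(\<integral>\<omega>. w (Suc n) \<omega> \<partial>M) / real (Suc n) \<le> (\<integral>\<omega>. x n \<omega> \<partial>M) + (\<integral>\<omega>. g \<omega> \<partial>M)" for n
  proof -
    have "(\<integral>\<omega>. w (Suc n) \<omega> / real (Suc n) \<partial>M) \<le> (\<integral>\<omega>. x n \<omega> + birk g (Suc n) \<omega> / real (Suc n) \<partial>M)"
    proof (rule integral_mono_AE)
      show "AE \<omega> in M. w (Suc n) \<omega> / real (Suc n) \<le> x n \<omega> + birk g (Suc n) \<omega> / real (Suc n)"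
        using birk_w
      proof eventually_elim
        case (elim \<omega>)
        have "birk (w 1) (Suc n) \<omega> \<le> birk (\<lambda>\<omega>. real K + g \<omega>) (Suc n) \<omega>"
          unfolding birk_def g_def by (intro sum_mono) linarith
        also have "\<dots> = real (Suc n) * real K + birk g (Suc n) \<omega>" by (simp add: birk_def sum.distrib)
        finally have "w (Suc n) \<omega> \<le> real (Suc n) * real K + birk g (Suc n) \<omega>" using elim order_trans by blast
        then have "w (Suc n) \<omega> / real (Suc n) \<le> real K + birk g (Suc n) \<omega> / real (Suc n)"
          by (simp add: divide_simps mult.commute)
        moreover have "birk g (Suc n) \<omega> / real (Suc n) \<ge> 0"
          unfolding birk_def g_def by (intro divide_nonneg_nonneg sum_nonneg) auto
        ultimately show ?case unfolding x_def by linarith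
      qed
    qed (use w x_int integrable_birk[OF g] in auto)
    also have "\<dots> = (\<integral>\<omega>. x n \<omega> \<partial>M) + (\<integral>\<omega>. birk g (Suc n) \<omega> \<partial>M) / real (Suc n)"
      using x_int integrable_birk[OF g] by (subst Bochner_Integration.integral_add) auto
    also have "(\<integral>\<omega>. birk g (Suc n) \<omega> \<partial>M) = real (Suc n) * (\<integral>\<omega>. g \<omega> \<partial>M)"
      unfolding birk_def using integrable_theta_funpow[OF g] integral_theta_funpow[of g]
      by (subst Bochner_Integration.integral_sum) auto
    finally show ?thesis by simp
  qed
  \<comment> \<open>By invariance the mean of \<open>x n\<close> may be taken \<open>Suc n\<close>
    steps back, where \<open>w (Suc n)\<close> stays bounded and division by \<open>Suc n\<close>
    sends \<open>x n\<close> to 0.\<close>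
  have "(\<lambda>n. \<integral>\<omega>. x n ((\<theta>i ^^ Suc n) \<omega>) \<partial>M) \<longlonglongrightarrow> (\<integral>\<omega>. 0 \<partial>M)"
  proof (rule integral_dominated_convergence[where w="\<lambda>\<omega>. real K"])
    show "AE \<omega> in M. (\<lambda>n. x n ((\<theta>i ^^ Suc n) \<omega>)) \<longlonglongrightarrow> 0"
      using bounded_back AE_orbit[OF nonneg]
    proof eventually_elim
      case (elim \<omega>)
      from elim(1) obtain C where C: "\<And>n. w n ((\<theta>i ^^ n) \<omega>) \<le> C" unfolding w_def by auto
      have nn: "0 \<le> w n ((\<theta>i ^^ n) \<omega>)" for n using elim(2) unfolding w_def by auto
      have "(\<lambda>n. C / real (Suc n)) \<longlonglongrightarrow> 0" by real_asymp
      then show ?case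
      proof (rule tendsto_sandwich[rotated -1])
        show "\<forall>\<^sub>F n in sequentially. 0 \<le> x n ((\<theta>i ^^ Suc n) \<omega>)"
          using nn[of "Suc _"] unfolding x_def by (intro always_eventually allI) (simp del: funpow.simps)
        show "\<forall>\<^sub>F n in sequentially. x n ((\<theta>i ^^ Suc n) \<omega>) \<le> C / real (Suc n)"
          using C[of "Suc _"] unfolding x_def
          by (intro always_eventually allI min.coboundedI1 divide_right_mono) (auto simp del: funpow.simps)
      qed simp
    qed
    show "AE \<omega> in M. norm (x n ((\<theta>i ^^ Suc n) \<omega>)) \<le> real K" for n
      using AE_orbit[OF nonneg]
    proof eventually_elim
      case (elim \<omega>)
      then have "0 \<le> w (Suc n) ((\<theta>i ^^ Suc n) \<omega>)" unfolding w_def by blast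
      then show ?case unfolding x_def by (simp del: funpow.simps add: min_def)
    qed
  qed (auto simp del: funpow.simps intro: measurable_compose[OF measurable_theta_inv_funpow])
  then have "(\<lambda>n. \<integral>\<omega>. x n \<omega> \<partial>M) \<longlonglongrightarrow> 0"
    by (simp add: integral_theta_inv_funpow del: funpow.simps)
  then have "\<forall>\<^sub>F n in sequentially. (\<integral>\<omega>. x n \<omega> \<partial>M) < \<epsilon> / 2"
    using e by (intro order_tendstoD(2)[where y=0]) auto
  then obtain n where "(\<integral>\<omega>. x n \<omega> \<partial>M) < \<epsilon> / 2" by (auto simp: eventually_sequentially)
  with le[of n] K have "(\<integral>\<omega>. w (Suc n) \<omega> \<partial>M) / real (Suc n) < \<epsilon>" unfolding g_def by linarith
  then have "(\<integral>\<omega>. w (Suc n) \<omega> \<partial>M) < \<epsilon> * real (Suc n)" by (simp add: divide_less_eq del: of_nat_Suc)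
  then show ?thesis unfolding w_def using int_u int_v by (intro exI[of _ "Suc n"]) simp
qed

lemma growth_u:
  assumes "m > 0" "(\<integral>\<omega>. u m \<omega> \<partial>M) < real m * c" "\<epsilon> > 0"
  shows "AE \<omega> in M. \<exists>C. \<forall>n. u n \<omega> \<le> C + (c + \<epsilon>) * real n"
  using subadditive_growth[OF int_u sub_u assms] .

lemma growth_v:
  assumes "m > 0" "(\<integral>\<omega>. v m \<omega> \<partial>M) < real m * c" "\<epsilon> > 0"
  shows "AE \<omega> in M. \<exists>C. \<forall>n. v n \<omega> \<le> C + (c + \<epsilon>) * real n"
  using subadditive_growth[OF int_v sub_v assms] .

text \<open>Two upper bounds suffice: together with \<open>nonneg\<close> they imply the lower ones,
  so \<open>u n / n\<close> tends to \<open>p\<close> and \<open>v n / n\<close> to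
  \<open>- p\<close> almost surely.\<close>

definition has_growth_rate :: "real \<Rightarrow> bool" where
  "has_growth_rate p \<longleftrightarrow> (AE \<omega> in M. \<forall>\<epsilon>>0. \<exists>C. \<forall>n.
     u n \<omega> \<le> C + (p + \<epsilon>) * real n \<and> v n \<omega> \<le> C + (\<epsilon> - p) * real n)"

text \<open>\<open>U n / n\<close> bounds the slope of \<open>u\<close> from above, and
  \<open>V m / m\<close> that of \<open>v\<close>. As \<open>u + v\<close> is nonnegative, these
  cannot add up to a negative number, so the infimum \<open>p\<close> of \<open>U n / n\<close> is
  finite. The sublinear gap then forces some \<open>V n / n\<close> below
  \<open>- p + \<epsilon>\<close>.\<close>

lemma growth_rate: "\<exists>p. has_growth_rate p"
proof -
  define U where "U n = (\<integral>\<omega>. u n \<omega> \<partial>M)" for n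
  define V where "V n = (\<integral>\<omega>. v n \<omega> \<partial>M)" for n
  have duality: "0 \<le> U n / real n + V m / real m" if "n > 0" "m > 0" for n m
  proof (rule ccontr)
    assume neg: "\<not> ?thesis"
    \<comment> \<open>Each slope is exceeded by two \<open>\<epsilon>\<close>, one for a strict
      inequality of means and one lost in the growth lemma. With a fifth of the deficit the two
      slopes still add up to \<open>- \<epsilon>\<close>.\<close>
    define \<epsilon> where "\<epsilon> = - (U n / real n + V m / real m) / 5"
    have e: "\<epsilon> > 0" using neg unfolding \<epsilon>_def by simp
    have "AE \<omega> in M. \<exists>C. \<forall>k. u k \<omega> \<le> C + (U n / real n + \<epsilon> + \<epsilon>) * real k"
      by (rule growth_u[OF that(1) _ e]) (use that e in \<open>simp add: U_def distrib_left\<close>)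
    moreover have "AE \<omega> in M. \<exists>C. \<forall>k. v k \<omega> \<le> C + (V m / real m + \<epsilon> + \<epsilon>) * real k"
      by (rule growth_v[OF that(2) _ e]) (use that e in \<open>simp add: V_def distrib_left\<close>)
    ultimately have "AE \<omega> in M. False"
      using nonneg
    proof eventually_elim
      case (elim \<omega>)
      then obtain C D where CD: "\<And>k. u k \<omega> \<le> C + (U n / real n + \<epsilon> + \<epsilon>) * real k"
        "\<And>k. v k \<omega> \<le> D + (V m / real m + \<epsilon> + \<epsilon>) * real k" by auto
      have "0 \<le> C + D + (U n / real n + V m / real m + 4 * \<epsilon>) * real k" for k
        using elim(3)[rule_format, of k] CD(1)[of k] CD(2)[of k] by (simp add: algebra_simps)
      moreover have "U n / real n + V m / real m + 4 * \<epsilon> = - \<epsilon>" unfolding \<epsilon>_def by argo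
      ultimately have "\<epsilon> * real k \<le> C + D" for k by simp
      moreover obtain k :: nat where "real k > (C + D) / \<epsilon>" using reals_Archimedean2 by blast
      ultimately show False using e by (metis divide_less_eq mult.commute not_less)
    qed
    then show False by simp
  qed
  define p where "p = (INF n\<in>{0<..}. U n / real n)"
  have bdd: "bdd_below ((\<lambda>n. U n / real n) ` {0<..})"
    using duality[of _ 1] by (intro bdd_belowI2[where m="- V 1"]) (simp add: algebra_simps, smt (verit))
  have p_le: "p \<le> U n / real n" if "n > 0" for n
    unfolding p_def using that by (intro cINF_lower bdd) auto
  have up: "\<exists>m>0. U m < real m * (p + \<epsilon>)" if "\<epsilon> > 0" for \<epsilon>
  proof -
    have "p < p + \<epsilon>" using that by simp
    then obtain m where "m > 0" "U m / real m < p + \<epsilon>"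
      using cINF_less_iff[of "{0<..}", OF _ bdd, of "p + \<epsilon>"] unfolding p_def by auto
    then show ?thesis by (auto simp: divide_less_eq mult.commute)
  qed
  have vp: "\<exists>m>0. V m < real m * (- p + \<epsilon>)" if e: "\<epsilon> > 0" for \<epsilon>
  proof -
    obtain n where n: "n > 0" "U n + V n < \<epsilon> * real n"
      using gap_sublinear_mean[OF e] unfolding U_def V_def by auto
    have "p * real n \<le> U n" using p_le[OF n(1)] n(1) by (simp add: le_divide_eq)
    then have "V n < real n * (- p + \<epsilon>)" using n(2) by (simp add: algebra_simps)
    then show ?thesis using n(1) by blast
  qed
  \<comment> \<open>Only the countably many errors \<open>1 / Suc j\<close> are treated, so that one
    null set serves every \<open>\<epsilon>\<close>.\<close>
  have "AE \<omega> in M. \<forall>j::nat. \<exists>C. \<forall>n. u n \<omega> \<le> C + (p + 1 / real (Suc j)) * real n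
      \<and> v n \<omega> \<le> C + (1 / real (Suc j) - p) * real n"
  proof (subst AE_all_countable, intro allI)
    fix j :: nat
    define \<epsilon> where "\<epsilon> = 1 / real (Suc j) / 2"
    have e: "\<epsilon> > 0" "\<epsilon> + \<epsilon> = 1 / real (Suc j)" unfolding \<epsilon>_def by (simp, rule field_sum_of_halves)
    obtain m m' where m: "m > 0" "U m < real m * (p + \<epsilon>)" "m' > 0" "V m' < real m' * (- p + \<epsilon>)"
      using up[OF e(1)] vp[OF e(1)] by auto
    show "AE \<omega> in M. \<exists>C. \<forall>n. u n \<omega> \<le> C + (p + 1 / real (Suc j)) * real n
      \<and> v n \<omega> \<le> C + (1 / real (Suc j) - p) * real n"
      using growth_u[OF m(1,2)[unfolded U_def] e(1)] growth_v[OF m(3,4)[unfolded V_def] e(1)]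
    proof eventually_elim
      case (elim \<omega>)
      then obtain C D where CD: "\<And>n. u n \<omega> \<le> C + (p + \<epsilon> + \<epsilon>) * real n"
        "\<And>n. v n \<omega> \<le> D + (- p + \<epsilon> + \<epsilon>) * real n" by auto
      have *: "p + \<epsilon> + \<epsilon> = p + 1 / real (Suc j)" "- p + \<epsilon> + \<epsilon> = 1 / real (Suc j) - p" using e by auto
      show ?case
        using CD unfolding * by (intro exI[of _ "max C D"] allI conjI) (smt (verit))+
    qed
  qed
  then show ?thesis
    unfolding has_growth_rate_def
  proof (intro exI[of _ p], eventually_elim)
    case (elim \<omega>)
    show ?case
    proof (intro allI impI)
      fix \<epsilon> :: real assume "\<epsilon> > 0"
      then obtain j where j: "1 / real (Suc j) < \<epsilon>" using nat_approx_posE by metis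
      obtain C where C: "\<And>n. u n \<omega> \<le> C + (p + 1 / real (Suc j)) * real n"
        "\<And>n. v n \<omega> \<le> C + (1 / real (Suc j) - p) * real n" using elim by blast
      have j': "1 / real (Suc j) * real n \<le> \<epsilon> * real n" for n using j by (intro mult_right_mono) auto
      have "u n \<omega> \<le> C + (p + \<epsilon>) * real n" for n
        using C(1)[of n] j'[of n] unfolding distrib_right by linarith
      moreover have "v n \<omega> \<le> C + (\<epsilon> - p) * real n" for n
        using C(2)[of n] j'[of n] unfolding left_diff_distrib by linarith
      ultimately show "\<exists>C. \<forall>n. u n \<omega> \<le> C + (p + \<epsilon>) * real n \<and> v n \<omega> \<le> C + (\<epsilon> - p) * real n"
        by blast
    qed
  qed
qed

text \<open>The backward bound in forward form: if the orbit of \<open>\<omega>\<close> is in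
  \<open>E\<close> at time \<open>n\<close>, then \<open>\<omega>\<close> is the point
  \<open>n\<close> steps before an element of \<open>E\<close>, and the constant is common to all of
  \<open>E\<close>.\<close>

lemma gap_bounded_on_subset:
  assumes [measurable]: "A \<in> sets M" and pos: "prob A > 0"
  shows "\<exists>E\<in>sets M. \<exists>C. E \<subseteq> A \<and> prob E > 0 \<and> (\<forall>\<omega>\<in>space M. \<forall>n. (\<theta> ^^ n) \<omega> \<in> E \<longrightarrow> u n \<omega> + v n \<omega> \<le> C)"
proof -
  define P where "P = (\<lambda>(k::nat) \<eta>. \<forall>n. u n ((\<theta>i ^^ n) \<eta>) + v n ((\<theta>i ^^ n) \<eta>) \<le> real k)"
  have [measurable]: "(\<lambda>\<eta>. u n ((\<theta>i ^^ n) \<eta>)) \<in> borel_measurable M" "(\<lambda>\<eta>. v n ((\<theta>i ^^ n) \<eta>)) \<in> borel_measurable M" for n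
    by (rule measurable_compose[OF measurable_theta_inv_funpow borel_uv(1)]
        measurable_compose[OF measurable_theta_inv_funpow borel_uv(2)])+
  have sets: "{\<eta> \<in> A. P k \<eta>} \<in> sets M" for k
  proof -
    have "{\<eta> \<in> A. P k \<eta>} = A \<inter> {\<eta> \<in> space M. P k \<eta>}" using sets.sets_into_space[OF assms(1)] by auto
    also have "\<dots> \<in> sets M" unfolding P_def by measurable
    finally show ?thesis .
  qed
  have "AE \<eta> in M. \<eta> \<in> A \<longrightarrow> (\<exists>k. P k \<eta>)"
    using bounded_back
  proof eventually_elim
    case (elim \<eta>)
    then obtain C where C: "\<And>n. u n ((\<theta>i ^^ n) \<eta>) + v n ((\<theta>i ^^ n) \<eta>) \<le> C" by auto
    obtain k :: nat where "C \<le> real k" using real_arch_simple by blast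
    then show ?case using C unfolding P_def by (meson order_trans)
  qed
  from positive_prob_Ex[OF sets this assms] obtain k where k: "prob {\<eta> \<in> A. P k \<eta>} > 0" by blast
  show ?thesis
  proof (intro bexI[OF _ sets[of k]] exI[of _ "real k"] conjI ballI allI impI)
    fix \<omega> n assume "\<omega> \<in> space M" "(\<theta> ^^ n) \<omega> \<in> {\<eta> \<in> A. P k \<eta>}"
    then show "u n \<omega> + v n \<omega> \<le> real k" unfolding P_def by (auto dest: spec[of _ n])
  qed (use k in auto)
qed

text \<open>A subadditive sequence that drops by at least 1 between any two sufficiently distant visits to a
  set of positive measure has strictly negative drift.\<close>

lemma not_uniformly_below_rate:
  assumes p: "has_growth_rate p" and A: "A \<in> sets M" "prob A > 0" and N: "N > 0"
    and drop: "\<And>\<omega> n. \<omega> \<in> A \<Longrightarrow> n \<ge> N \<Longrightarrow> (\<theta> ^^ n) \<omega> \<in> A \<Longrightarrow> u n \<omega> - p * real n \<le> -1"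
  shows False
proof -
  define \<delta> where "\<delta> = prob A / 2"
  have d: "\<delta> > 0" using A by (simp add: \<delta>_def)
  define V where "V = birk (indicator A :: 'w \<Rightarrow> real)"
  have V_nonneg: "0 \<le> V n \<omega>" and V_le: "V n \<omega> \<le> real n" for n \<omega>
  proof -
    show "0 \<le> V n \<omega>" unfolding V_def birk_def by (intro sum_nonneg) auto
    have "V n \<omega> \<le> (\<Sum>k<n. 1)" unfolding V_def birk_def by (intro sum_mono) (auto simp: indicator_def)
    then show "V n \<omega> \<le> real n" by simp
  qed
  have V_add: "V (n + k) \<omega> = V n \<omega> + V k ((\<theta> ^^ n) \<omega>)" for n k \<omega>
  proof (induction n arbitrary: \<omega>)
    case (Suc n)
    then show ?case unfolding V_def by (simp add: birk_Suc funpow_swap1)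
  qed (simp add: V_def birk_def)
  have "AE \<omega> in M. \<omega> \<notin> A"
    using p[unfolded has_growth_rate_def] AE_orbit[OF sub_u] nonneg visits_linear[OF A] recurrent[OF A]
  proof eventually_elim
    case (elim \<omega>)
    show ?case
    proof
      assume "\<omega> \<in> A"
      have sub: "u (n + k) ((\<theta> ^^ t) \<omega>) \<le> u n ((\<theta> ^^ t) \<omega>) + u k ((\<theta> ^^ (t + n)) \<omega>)" for n k t
        using elim(2)[rule_format, of t, THEN conjunct1, rule_format, of n k]
        by (simp only: add.commute[of t n] funpow_add comp_apply)
      have drift: "u n ((\<theta> ^^ t) \<omega>) - p * real n \<le> - (V n ((\<theta> ^^ t) \<omega>) / (2 * real N))"
        if "n \<ge> N" "(\<theta> ^^ t) \<omega> \<in> A" "(\<theta> ^^ (t + n)) \<omega> \<in> A" for n t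
        using that
      proof (induction n arbitrary: t rule: less_induct)
        case (less n)
        \<comment> \<open>The first return at distance at least \<open>N\<close> splits off an
          initial stretch. No visit falls between \<open>N\<close> and \<open>s\<close>, so this
          stretch contains at most \<open>N\<close> visits and still guarantees a drop of 1.\<close>
        define s where "s = (LEAST s. s \<ge> N \<and> (\<theta> ^^ (t + s)) \<omega> \<in> A)"
        have s: "s \<ge> N" "(\<theta> ^^ (t + s)) \<omega> \<in> A"
          using LeastI[of "\<lambda>s. s \<ge> N \<and> (\<theta> ^^ (t + s)) \<omega> \<in> A" n] less.prems unfolding s_def by auto
        have s_le: "s \<le> n"
          unfolding s_def using less.prems by (intro Least_le) auto
        have s_least: "(\<theta> ^^ (t + k)) \<omega> \<notin> A" if "N \<le> k" "k < s" for k
          using not_less_Least[of k "\<lambda>s. s \<ge> N \<and> (\<theta> ^^ (t + s)) \<omega> \<in> A"] that unfolding s_def by auto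
        have "V s ((\<theta> ^^ t) \<omega>) = V N ((\<theta> ^^ t) \<omega>) + V (s - N) ((\<theta> ^^ N) ((\<theta> ^^ t) \<omega>))"
          using V_add[of N "s - N"] s by simp
        also have "V (s - N) ((\<theta> ^^ N) ((\<theta> ^^ t) \<omega>)) = 0"
          unfolding V_def birk_def
        proof (rule sum.neutral, intro ballI)
          fix k assume "k \<in> {..<s - N}"
          then have "(\<theta> ^^ (t + (k + N))) \<omega> \<notin> A" by (intro s_least) auto
          then show "(indicator A ((\<theta> ^^ k) ((\<theta> ^^ N) ((\<theta> ^^ t) \<omega>))) :: real) = 0"
            by (simp add: funpow_add add.commute[of t])
        qed
        finally have Vs: "V s ((\<theta> ^^ t) \<omega>) \<le> real N" using V_le[of N "(\<theta> ^^ t) \<omega>"] by simp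
        have "(\<theta> ^^ s) ((\<theta> ^^ t) \<omega>) = (\<theta> ^^ (t + s)) \<omega>" by (simp only: add.commute[of t] funpow_add comp_apply)
        then have Vn: "V n ((\<theta> ^^ t) \<omega>) = V s ((\<theta> ^^ t) \<omega>) + V (n - s) ((\<theta> ^^ (t + s)) \<omega>)"
          using V_add[of s "n - s" "(\<theta> ^^ t) \<omega>"] s_le by simp
        have "(\<theta> ^^ n) ((\<theta> ^^ t) \<omega>) = (\<theta> ^^ (t + n)) \<omega>" by (simp only: add.commute[of t] funpow_add comp_apply)
        then have drop_n: "u n ((\<theta> ^^ t) \<omega>) - p * real n \<le> -1"
          using drop less.prems by simp
        have "(\<theta> ^^ s) ((\<theta> ^^ t) \<omega>) = (\<theta> ^^ (t + s)) \<omega>" by (simp only: add.commute[of t] funpow_add comp_apply)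
        then have drop_s: "u s ((\<theta> ^^ t) \<omega>) - p * real s \<le> -1"
          using drop less.prems s by simp
        show ?case
        proof (cases "n - s < N")
          \<comment> \<open>The rest is too short for a drop of its own. At most
            \<open>2 * N\<close> visits occur altogether, and the drop over the whole stretch pays
            for them; this is the origin of the factor 2.\<close>
          case True
          then have "V n ((\<theta> ^^ t) \<omega>) \<le> 2 * real N"
            using Vn Vs V_le[of "n - s" "(\<theta> ^^ (t + s)) \<omega>"] by simp
          then have "V n ((\<theta> ^^ t) \<omega>) / (2 * real N) \<le> 1" using N by (simp add: divide_le_eq)
          then show ?thesis using drop_n by linarith
        next
          case False
          have "u (n - s) ((\<theta> ^^ (t + s)) \<omega>) - p * real (n - s) \<le> - (V (n - s) ((\<theta> ^^ (t + s)) \<omega>) / (2 * real N))"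
            by (rule less.IH) (use False s N s_le less.prems in auto)
          moreover have "u n ((\<theta> ^^ t) \<omega>) \<le> u s ((\<theta> ^^ t) \<omega>) + u (n - s) ((\<theta> ^^ (t + s)) \<omega>)"
            using sub[of s "n - s" t] s_le by simp
          moreover have "p * real n = p * real s + p * real (n - s)"
            using s_le by (simp add: of_nat_diff algebra_simps)
          moreover have "V n ((\<theta> ^^ t) \<omega>) / (2 * real N) \<le> 1 + V (n - s) ((\<theta> ^^ (t + s)) \<omega>) / (2 * real N)"
            using Vn Vs N by (simp add: field_simps)
          ultimately show ?thesis using drop_s by linarith
        qed
      qed
      \<comment> \<open>With visits of density at least \<open>\<delta>\<close>, the drops lower
        \<open>u n - p * n\<close> with slope \<open>2 * \<epsilon>\<close>, whereas
        \<open>u n \<ge> - v n\<close> permits only slope \<open>\<epsilon>\<close>.\<close>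
      define \<epsilon> where "\<epsilon> = \<delta> / (4 * real N)"
      have e: "\<epsilon> > 0" using d N by (simp add: \<epsilon>_def)
      then obtain C where C: "\<And>n. v n \<omega> \<le> C + (\<epsilon> - p) * real n" using elim(1) by blast
      obtain K where K: "\<And>n. \<delta> * real n - K \<le> V n \<omega>" using elim(4) unfolding \<delta>_def V_def by auto
      obtain n0 :: nat where n0: "real n0 > (C + K / (2 * real N)) / \<epsilon>" using reals_Archimedean2 by blast
      obtain n where n: "n \<ge> max N n0" "(\<theta> ^^ n) \<omega> \<in> A" using elim(5) by blast
      have "u n \<omega> - p * real n \<le> - (V n \<omega> / (2 * real N))"
        using drift[of n 0] n \<open>\<omega> \<in> A\<close> by simp
      also have "\<dots> \<le> - ((\<delta> * real n - K) / (2 * real N))"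
        using K[of n] N by (simp add: divide_right_mono)
      also have "\<dots> = K / (2 * real N) - 2 * \<epsilon> * real n"
        using N by (simp add: \<epsilon>_def field_simps)
      finally have "u n \<omega> - p * real n \<le> K / (2 * real N) - 2 * \<epsilon> * real n" .
      moreover have "- v n \<omega> \<le> u n \<omega>" using elim(3)[rule_format, of n] by simp
      moreover have "- C - \<epsilon> * real n \<le> - v n \<omega> - p * real n" using C[of n] by (simp add: algebra_simps)
      ultimately have "\<epsilon> * real n \<le> C + K / (2 * real N)" by simp
      moreover have "C + K / (2 * real N) < \<epsilon> * real n0" using n0 e by (simp add: divide_less_eq mult.commute)
      moreover have "\<epsilon> * real n0 \<le> \<epsilon> * real n" using n e by simp
      ultimately show False by linarith
    qed
  qed
  then show False using prob_eq_0[OF A(1)] A(2) by simp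
qed

text \<open>Supplies infinitely many series terms bounded below at the critical parameter. On the
  failure set \<open>F\<close> the values \<open>u n - p * n\<close> tend to minus infinity along
  visits to \<open>E\<close>. \<open>F\<close> is forward invariant, and if it had full measure, a
  threshold uniform on part of \<open>E\<close> would contradict
  \<open>not_uniformly_below_rate\<close>. On \<open>E\<close> the gap is bounded, so
  \<open>u\<close> and \<open>- v\<close> can be exchanged at visits.\<close>

lemma infinitely_often_near_rate:
  assumes p: "has_growth_rate p" and A: "A \<in> sets M" "prob A > 0"
  shows "AE \<omega> in M. \<exists>K. \<forall>m. \<exists>n\<ge>m. (\<theta> ^^ n) \<omega> \<in> A \<and> p * real n - K \<le> - v n \<omega>"
proof -
  from gap_bounded_on_subset[OF A] obtain E C where E [measurable]: "E \<in> sets M"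
    and EA: "E \<subseteq> A" and Epos: "prob E > 0"
    and C: "\<And>\<omega> n. \<omega> \<in> space M \<Longrightarrow> (\<theta> ^^ n) \<omega> \<in> E \<Longrightarrow> u n \<omega> + v n \<omega> \<le> C" by blast
  define F where "F = {\<omega> \<in> space M. \<forall>K::nat. \<exists>m. \<forall>n\<ge>m. (\<theta> ^^ n) \<omega> \<in> E \<longrightarrow> u n \<omega> - p * real n < - real K}"
  have F [measurable]: "F \<in> sets M" unfolding F_def by measurable
  have "AE \<omega> in M. \<omega> \<in> F \<longrightarrow> \<theta> \<omega> \<in> F"
    using sub_v nonneg
  proof (eventually_elim, intro impI)
    case (elim \<omega>)
    assume "\<omega> \<in> F"
    then have w: "\<omega> \<in> space M"
      "\<And>K::nat. \<exists>m. \<forall>n\<ge>m. (\<theta> ^^ n) \<omega> \<in> E \<longrightarrow> u n \<omega> - p * real n < - real K" unfolding F_def by auto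
    have "\<exists>m. \<forall>n\<ge>m. (\<theta> ^^ n) (\<theta> \<omega>) \<in> E \<longrightarrow> u n (\<theta> \<omega>) - p * real n < - real K" for K :: nat
    proof -
      define K' where "K' = nat \<lceil>real K + C + v 1 \<omega> + p\<rceil>"
      have K': "real K + C + v 1 \<omega> + p \<le> real K'" unfolding K'_def by linarith
      from w(2)[of K'] obtain m where
        m: "\<And>n. n \<ge> m \<Longrightarrow> (\<theta> ^^ n) \<omega> \<in> E \<Longrightarrow> u n \<omega> - p * real n < - real K'" by blast
      \<comment> \<open>Subadditivity of \<open>u\<close> points the wrong way here. The bound comes
        from \<open>v\<close> and the gap at the visit: \<open>u n (\<theta> \<omega>) \<le> C - v n
        (\<theta> \<omega>) \<le> C + v 1 \<omega> + u (Suc n) \<omega>\<close>. The summand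
        \<open>p\<close> in \<open>K'\<close> accounts for the additional time step.\<close>
      have "u n (\<theta> \<omega>) - p * real n < - real K" if n: "n \<ge> m" "(\<theta> ^^ n) (\<theta> \<omega>) \<in> E" for n
      proof -
        have "(\<theta> ^^ Suc n) \<omega> \<in> E" using n(2) by (simp add: funpow_swap1)
        then have "u (Suc n) \<omega> - p * real (Suc n) < - real K'" using m[of "Suc n"] n by simp
        moreover have "u n (\<theta> \<omega>) + v n (\<theta> \<omega>) \<le> C" using C n w by simp
        moreover have "v (Suc n) \<omega> \<le> v 1 \<omega> + v n (\<theta> \<omega>)" using elim(1)[rule_format, of 1 n] by simp
        moreover have "- v (Suc n) \<omega> \<le> u (Suc n) \<omega>" using elim(2)[rule_format, of "Suc n"] by simp
        ultimately show ?thesis using K' by (simp add: distrib_left)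
      qed
      then show ?thesis by blast
    qed
    then show "\<theta> \<omega> \<in> F" using w(1) unfolding F_def by auto
  qed
  then have "prob F = 0 \<or> prob F = 1" by (rule invariant_prob_0_1[OF F])
  moreover have "prob F \<noteq> 1"
  proof
    assume "prob F = 1"
    then have "AE \<omega> in M. \<omega> \<in> F" using prob_eq_1[OF F] by simp
    \<comment> \<open>\<open>Suc m\<close> keeps the threshold positive, as the drop lemma
      requires.\<close>
    define P where "P = (\<lambda>(m::nat) \<omega>. \<forall>n\<ge>Suc m. (\<theta> ^^ n) \<omega> \<in> E \<longrightarrow> u n \<omega> - p * real n \<le> -1)"
    have sets: "{\<omega> \<in> E. P m \<omega>} \<in> sets M" for m
    proof -
      have "{\<eta> \<in> E. P m \<eta>} = E \<inter> {\<eta> \<in> space M. P m \<eta>}" using sets.sets_into_space[OF E] by auto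
      also have "\<dots> \<in> sets M" unfolding P_def by measurable
      finally show ?thesis .
    qed
    have "AE \<omega> in M. \<omega> \<in> E \<longrightarrow> (\<exists>m. P m \<omega>)"
      using \<open>AE \<omega> in M. \<omega> \<in> F\<close>
    proof eventually_elim
      case (elim \<omega>)
      then obtain m where "\<And>n. n \<ge> m \<Longrightarrow> (\<theta> ^^ n) \<omega> \<in> E \<Longrightarrow> u n \<omega> - p * real n < - real 1"
        unfolding F_def by blast
      then have "P m \<omega>" unfolding P_def by (auto simp: less_imp_le)
      then show ?case by blast
    qed
    from positive_prob_Ex[OF sets this E Epos] obtain m where m: "prob {\<omega> \<in> E. P m \<omega>} > 0" by blast
    show False
    proof (rule not_uniformly_below_rate[OF p sets m])
      show "Suc m > 0" by simp
      show "u n \<omega> - p * real n \<le> -1"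
        if "\<omega> \<in> {\<omega> \<in> E. P m \<omega>}" "n \<ge> Suc m" "(\<theta> ^^ n) \<omega> \<in> {\<omega> \<in> E. P m \<omega>}" for \<omega> n
        using that unfolding P_def by blast
    qed
  qed
  ultimately have "AE \<omega> in M. \<omega> \<notin> F" using prob_eq_0[OF F] by simp
  then show ?thesis using AE_space
  proof eventually_elim
    case (elim \<omega>)
    then obtain K :: nat where K: "\<And>m. \<exists>n\<ge>m. (\<theta> ^^ n) \<omega> \<in> E \<and> - real K \<le> u n \<omega> - p * real n"
      unfolding F_def by (auto simp: not_less)
    have "\<exists>n\<ge>m. (\<theta> ^^ n) \<omega> \<in> A \<and> p * real n - (real K + C) \<le> - v n \<omega>" for m
    proof -
      from K[of m] obtain n where n: "n \<ge> m" "(\<theta> ^^ n) \<omega> \<in> E" "- real K \<le> u n \<omega> - p * real n" by blast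
      then have "p * real n - (real K + C) \<le> - v n \<omega>" using C[OF elim(2) n(2)] by simp
      then show ?thesis using n EA by blast
    qed
    then show ?case by blast
  qed
qed

end

section \<open>Ruelle operators on fibers\<close>

locale fibered_shift =
  fixes \<theta> :: "'w \<Rightarrow> 'w" and l :: "'w \<Rightarrow> enat" and \<alpha> :: "'w \<Rightarrow> nat \<Rightarrow> nat \<Rightarrow> bool"
    and \<phi> :: "'w \<Rightarrow> (nat \<Rightarrow> nat) \<Rightarrow> real"
begin

abbreviation X :: "'w \<Rightarrow> (nat \<Rightarrow> nat) set" where "X \<equiv> fiber \<theta> l \<alpha>"
abbreviation L :: "'w \<Rightarrow> nat \<Rightarrow> ((nat \<Rightarrow> nat) \<Rightarrow> ennreal) \<Rightarrow> (nat \<Rightarrow> nat) \<Rightarrow> ennreal" where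
  "L \<equiv> ruelle_iter \<theta> l \<alpha> \<phi>"
abbreviation S :: "'w \<Rightarrow> nat \<Rightarrow> (nat \<Rightarrow> nat) \<Rightarrow> real" where "S \<equiv> birkhoff \<theta> \<phi>"

definition splice_at :: "nat \<Rightarrow> (nat \<Rightarrow> nat) \<Rightarrow> (nat \<Rightarrow> nat) \<Rightarrow> nat \<Rightarrow> nat" where
  "splice_at k z x = (\<lambda>i. if i < k then z i else x (i - k))"

lemma splice_at_less [simp]: "i < k \<Longrightarrow> splice_at k z x i = z i"
  and shift_splice_at [simp]: "(\<lambda>i. splice_at k z x (i + k)) = x"
  by (auto simp: splice_at_def)

lemma scons_0 [simp]: "scons a x 0 = a"
  and scons_Suc [simp]: "scons a x (Suc i) = x i"
  by (auto simp: scons_def)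

lemma theta_funpow_funpow: "(\<theta> ^^ i) ((\<theta> ^^ k) \<omega>) = (\<theta> ^^ (k + i)) \<omega>"
  by (simp only: add.commute[of k] funpow_add comp_apply)

lemma scons_in_fiber: "scons a x \<in> X \<omega> \<longleftrightarrow> enat a < l \<omega> \<and> \<alpha> \<omega> a (x 0) \<and> x \<in> X (\<theta> \<omega>)"
  unfolding fiber_def
proof (intro iffI; clarsimp)
  assume *: "\<forall>i. enat (scons a x i) < l ((\<theta> ^^ i) \<omega>) \<and> \<alpha> ((\<theta> ^^ i) \<omega>) (scons a x i) (x i)"
  then show "enat a < l \<omega> \<and> \<alpha> \<omega> a (x 0) \<and>
      (\<forall>i. enat (x i) < l ((\<theta> ^^ i) (\<theta> \<omega>)) \<and> \<alpha> ((\<theta> ^^ i) (\<theta> \<omega>)) (x i) (x (Suc i)))"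
    using *[rule_format, of 0] *[rule_format, of "Suc _"] by (simp add: funpow_swap1)
next
  fix i
  assume "enat a < l \<omega>" "\<alpha> \<omega> a (x 0)"
    "\<forall>i. enat (x i) < l ((\<theta> ^^ i) (\<theta> \<omega>)) \<and> \<alpha> ((\<theta> ^^ i) (\<theta> \<omega>)) (x i) (x (Suc i))"
  then show "enat (scons a x i) < l ((\<theta> ^^ i) \<omega>) \<and> \<alpha> ((\<theta> ^^ i) \<omega>) (scons a x i) (x i)"
    by (cases i) (auto simp: funpow_swap1)
qed

lemma fiber_shift: "x \<in> X \<omega> \<Longrightarrow> (\<lambda>i. x (i + k)) \<in> X ((\<theta> ^^ k) \<omega>)"
  unfolding fiber_def by (simp add: theta_funpow_funpow add.commute)

text \<open>Only the transition from position \<open>k - 1\<close> to \<open>k\<close> is new.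
  Phrasing \<open>join\<close> with \<open>k = Suc i\<close> imposes nothing if the initial piece is
  empty.\<close>

lemma splice_at_in_fiber:
  assumes z: "\<And>i. i < k \<Longrightarrow> enat (z i) < l ((\<theta> ^^ i) \<omega>)"
    "\<And>i. Suc i < k \<Longrightarrow> \<alpha> ((\<theta> ^^ i) \<omega>) (z i) (z (Suc i))"
    and x: "x \<in> X ((\<theta> ^^ k) \<omega>)"
    and join: "\<And>i. k = Suc i \<Longrightarrow> \<alpha> ((\<theta> ^^ i) \<omega>) (z i) (x 0)"
  shows "splice_at k z x \<in> X \<omega>"
  unfolding fiber_def
proof (intro CollectI allI)
  fix i
  consider "Suc i < k" | "k = Suc i" | "k \<le> i" by linarith
  then show "enat (splice_at k z x i) < l ((\<theta> ^^ i) \<omega>) \<and> \<alpha> ((\<theta> ^^ i) \<omega>) (splice_at k z x i) (splice_at k z x (Suc i))"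
  proof cases
    case 3
    then have "(\<theta> ^^ (i - k)) ((\<theta> ^^ k) \<omega>) = (\<theta> ^^ i) \<omega>" by (simp add: theta_funpow_funpow)
    then show ?thesis using x 3 unfolding fiber_def
      by (auto simp: splice_at_def Suc_diff_le dest!: spec[of _ "i - k"])
  qed (use z join in \<open>auto simp: splice_at_def\<close>)
qed

lemma birkhoff_Suc: "S \<omega> (Suc n) x = S \<omega> n x + \<phi> ((\<theta> ^^ n) \<omega>) (\<lambda>i. x (i + n))"
  by (simp add: birkhoff_def)

lemma ruelle_mono:
  assumes "\<And>y. y \<in> X \<omega> \<Longrightarrow> f y \<le> g y"
  shows "ruelle \<theta> l \<alpha> \<phi> \<omega> f x \<le> ruelle \<theta> l \<alpha> \<phi> \<omega> g x"
  unfolding ruelle_def using assms by (intro suminf_le) (auto intro: mult_left_mono)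

lemma ruelle_cmult: "ruelle \<theta> l \<alpha> \<phi> \<omega> (\<lambda>x. c * f x) x = c * ruelle \<theta> l \<alpha> \<phi> \<omega> f x"
  unfolding ruelle_def by (auto intro!: suminf_cong simp: mult_ac simp flip: ennreal_suminf_cmult)

lemma L_mono:
  assumes "\<And>y. y \<in> X \<omega> \<Longrightarrow> f y \<le> g y" "x \<in> X ((\<theta> ^^ n) \<omega>)"
  shows "L \<omega> n f x \<le> L \<omega> n g x"
  using assms(2) by (induction n arbitrary: x) (auto intro!: ruelle_mono assms(1))

lemma L_cmult: "L \<omega> n (\<lambda>x. c * f x) x = c * L \<omega> n f x"
proof (induction n arbitrary: x)
  case (Suc n)
  then have "L \<omega> n (\<lambda>x. c * f x) = (\<lambda>x. c * L \<omega> n f x)" by auto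
  then show ?case by (simp add: ruelle_cmult)
qed simp

lemma L_add: "L \<omega> (n + m) f = L ((\<theta> ^^ n) \<omega>) m (L \<omega> n f)"
  by (induction m) (auto simp: theta_funpow_funpow)

lemma L_le_const_mult:
  assumes "\<And>y. y \<in> X ((\<theta> ^^ n) \<omega>) \<Longrightarrow> L \<omega> n f y \<le> c" "x \<in> X ((\<theta> ^^ (n + m)) \<omega>)"
  shows "L \<omega> (n + m) f x \<le> c * L ((\<theta> ^^ n) \<omega>) m (\<lambda>_. 1) x"
proof -
  have "L \<omega> (n + m) f x \<le> L ((\<theta> ^^ n) \<omega>) m (\<lambda>_. c * 1) x"
    unfolding L_add using assms by (intro L_mono) (auto simp: theta_funpow_funpow)
  then show ?thesis by (simp only: L_cmult)
qed

lemma L_ge_const_mult: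
  assumes "\<And>y. y \<in> X ((\<theta> ^^ n) \<omega>) \<Longrightarrow> c \<le> L \<omega> n f y" "x \<in> X ((\<theta> ^^ (n + m)) \<omega>)"
  shows "c * L ((\<theta> ^^ n) \<omega>) m (\<lambda>_. 1) x \<le> L \<omega> (n + m) f x"
proof -
  have "L ((\<theta> ^^ n) \<omega>) m (\<lambda>_. c * 1) x \<le> L \<omega> (n + m) f x"
    unfolding L_add using assms by (intro L_mono) (auto simp: theta_funpow_funpow)
  then show ?thesis by (simp only: L_cmult)
qed

lemma scons_shift: "scons (y n) (\<lambda>i. y (i + Suc n)) = (\<lambda>i. y (i + n))"
proof
  fix i show "scons (y n) (\<lambda>i. y (i + Suc n)) i = y (i + n)" by (cases i) auto
qed

text \<open>\<open>y\<close> is one of the \<open>n\<close>-step preimages of its shift, and the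
  other terms of the sum are nonnegative.\<close>

lemma L_ge_branch:
  assumes "y \<in> X \<omega>"
  shows "ennreal (exp (S \<omega> n y)) * f y \<le> L \<omega> n f (\<lambda>i. y (i + n))"
proof (induction n)
  case 0
  then show ?case by (simp add: birkhoff_def)
next
  case (Suc n)
  let ?x = "\<lambda>i. y (i + Suc n)" and ?y = "\<lambda>i. y (i + n)"
  have sc: "scons (y n) ?x = ?y" by (rule scons_shift)
  let ?g = "\<lambda>a. if scons a ?x \<in> X ((\<theta> ^^ n) \<omega>) then ennreal (exp (\<phi> ((\<theta> ^^ n) \<omega>) (scons a ?x))) * L \<omega> n f (scons a ?x) else 0"
  have "ennreal (exp (S \<omega> (Suc n) y)) * f y
      = ennreal (exp (\<phi> ((\<theta> ^^ n) \<omega>) ?y)) * (ennreal (exp (S \<omega> n y)) * f y)"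
    by (simp add: birkhoff_Suc exp_add ennreal_mult mult_ac)
  also have "\<dots> \<le> ennreal (exp (\<phi> ((\<theta> ^^ n) \<omega>) ?y)) * L \<omega> n f ?y"
    using Suc by (intro mult_left_mono) auto
  also have "\<dots> = ?g (y n)"
    using fiber_shift[OF assms, of n] sc by simp
  also have "\<dots> = sum ?g {y n}" by simp
  also have "\<dots> \<le> (\<Sum>a. ?g a)" by (rule sum_le_suminf) auto
  also have "\<dots> = L \<omega> (Suc n) f ?x" by (simp only: ruelle_iter.simps ruelle_def)
  finally show ?case .
qed

text \<open>Prepending the same letter to both points raises the agreement from \<open>j\<close> to
  \<open>Suc j\<close>, hence the exponent \<open>n - k + j\<close> at time \<open>k\<close>. With
  one common letter at the start, every evaluation of \<open>\<phi>\<close> sees at least two, which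
  is where the Hoelder bound begins.\<close>

lemma L_distortion:
  assumes hoelder: "\<And>k x y j. k < n \<Longrightarrow> x \<in> X ((\<theta> ^^ k) \<omega>) \<Longrightarrow> y \<in> X ((\<theta> ^^ k) \<omega>) \<Longrightarrow> 2 \<le> j \<Longrightarrow>
      (\<And>i. i < j \<Longrightarrow> x i = y i) \<Longrightarrow> \<phi> ((\<theta> ^^ k) \<omega>) x - \<phi> ((\<theta> ^^ k) \<omega>) y \<le> K k * r ^ j"
    and "x \<in> X ((\<theta> ^^ n) \<omega>)" "y \<in> X ((\<theta> ^^ n) \<omega>)" "1 \<le> j" "\<And>i. i < j \<Longrightarrow> x i = y i"
  shows "L \<omega> n (\<lambda>_. 1) x \<le> ennreal (exp (\<Sum>k<n. K k * r ^ (n - k + j))) * L \<omega> n (\<lambda>_. 1) y"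
  using assms
proof (induction n arbitrary: x y j)
  case (Suc n)
  let ?c = "ennreal (exp (\<Sum>k<Suc n. K k * r ^ (Suc n - k + j)))"
  let ?g = "\<lambda>x a. if scons a x \<in> X ((\<theta> ^^ n) \<omega>) then ennreal (exp (\<phi> ((\<theta> ^^ n) \<omega>) (scons a x))) * L \<omega> n (\<lambda>_. 1) (scons a x) else 0"
  have "?g x a \<le> ?c * ?g y a" for a
  proof (cases "scons a x \<in> X ((\<theta> ^^ n) \<omega>)")
    case True
    have y: "scons a y \<in> X ((\<theta> ^^ n) \<omega>)"
      using True Suc.prems by (auto simp: scons_in_fiber)
    have agree: "scons a x i = scons a y i" if "i < Suc j" for i
      using Suc.prems(5) that by (cases i) auto
    have "\<phi> ((\<theta> ^^ n) \<omega>) (scons a x) - \<phi> ((\<theta> ^^ n) \<omega>) (scons a y) \<le> K n * r ^ Suc j"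
      using Suc.prems(1)[OF lessI True y, of "Suc j"] agree Suc.prems(4) by simp
    then have 1: "exp (\<phi> ((\<theta> ^^ n) \<omega>) (scons a x)) \<le> exp (K n * r ^ Suc j) * exp (\<phi> ((\<theta> ^^ n) \<omega>) (scons a y))"
      by (simp add: exp_add[symmetric] del: power_Suc)
    have 2: "L \<omega> n (\<lambda>_. 1) (scons a x) \<le> ennreal (exp (\<Sum>k<n. K k * r ^ (n - k + Suc j))) * L \<omega> n (\<lambda>_. 1) (scons a y)"
      by (rule Suc.IH[OF Suc.prems(1) True y _ agree]) auto
    have "ennreal (exp (\<phi> ((\<theta> ^^ n) \<omega>) (scons a x))) * L \<omega> n (\<lambda>_. 1) (scons a x)
        \<le> ennreal (exp (K n * r ^ Suc j) * exp (\<phi> ((\<theta> ^^ n) \<omega>) (scons a y))) *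
          (ennreal (exp (\<Sum>k<n. K k * r ^ (n - k + Suc j))) * L \<omega> n (\<lambda>_. 1) (scons a y))"
      by (intro mult_mono ennreal_leI 1 2) auto
    also have "\<dots> = ennreal (exp (K n * r ^ Suc j + (\<Sum>k<n. K k * r ^ (n - k + Suc j)))) *
        (ennreal (exp (\<phi> ((\<theta> ^^ n) \<omega>) (scons a y))) * L \<omega> n (\<lambda>_. 1) (scons a y))"
      by (simp only: exp_add ennreal_mult'' exp_ge_zero mult_ac)
    also have "K n * r ^ Suc j + (\<Sum>k<n. K k * r ^ (n - k + Suc j)) = (\<Sum>k<Suc n. K k * r ^ (Suc n - k + j))"
      by (simp add: Suc_diff_le)
    finally show ?thesis using True y by simp
  qed simp
  then have "(\<Sum>a. ?g x a) \<le> (\<Sum>a. ?c * ?g y a)" by (intro suminf_le) auto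
  then show ?case unfolding ruelle_iter.simps ruelle_def by simp
qed simp

text \<open>Agreement up to index \<open>n\<close> inclusive leaves \<open>n - k + 1 \<ge> 2\<close>
  common letters after \<open>k < n\<close> shifts.\<close>

lemma birkhoff_distortion:
  assumes hoelder: "\<And>k x y j. k < n \<Longrightarrow> x \<in> X ((\<theta> ^^ k) \<omega>) \<Longrightarrow> y \<in> X ((\<theta> ^^ k) \<omega>) \<Longrightarrow> 2 \<le> j \<Longrightarrow>
      (\<And>i. i < j \<Longrightarrow> x i = y i) \<Longrightarrow> \<phi> ((\<theta> ^^ k) \<omega>) x - \<phi> ((\<theta> ^^ k) \<omega>) y \<le> K k * r ^ j"
    and x: "x \<in> X \<omega>" and y: "y \<in> X \<omega>" and agree: "\<And>i. i \<le> n \<Longrightarrow> x i = y i"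
  shows "S \<omega> n x \<le> S \<omega> n y + (\<Sum>k<n. K k * r ^ (n - k + 1))"
proof -
  have "S \<omega> n x - S \<omega> n y = (\<Sum>k<n. \<phi> ((\<theta> ^^ k) \<omega>) (\<lambda>i. x (i + k)) - \<phi> ((\<theta> ^^ k) \<omega>) (\<lambda>i. y (i + k)))"
    unfolding birkhoff_def by (simp add: sum_subtractf)
  also have "\<dots> \<le> (\<Sum>k<n. K k * r ^ (n - k + 1))"
    using fiber_shift[OF x] fiber_shift[OF y] agree by (intro sum_mono hoelder) auto
  finally show ?thesis by simp
qed

section \<open>Expansion of the iterated operator over words\<close>

definition prepend :: "nat list \<Rightarrow> (nat \<Rightarrow> nat) \<Rightarrow> nat \<Rightarrow> nat" where
  "prepend w x = splice_at (length w) ((!) w) x"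

lemma prepend_snoc: "prepend (w @ [a]) x = prepend w (scons a x)"
  unfolding prepend_def splice_at_def
  by (auto simp: fun_eq_iff nth_append scons_def split: nat.split) (metis Suc_diff_Suc Suc_inject not_less_eq linorder_neqE_nat)

lemma prepend_Nil [simp]: "prepend [] x = x"
  by (auto simp: prepend_def splice_at_def)

text \<open>The loop partition function sums over words, the operator iterates sums over letters;
  this identity links them. Words that do not lead into the fiber contribute 0, so the index set
  depends on the length alone.\<close>

lemma L_eq_sum_words:
  assumes "x \<in> X ((\<theta> ^^ n) \<omega>)"
  shows "L \<omega> n f x = (\<integral>\<^sup>+w. (if prepend w x \<in> X \<omega>
    then ennreal (exp (S \<omega> n (prepend w x))) * f (prepend w x) else 0) \<partial>count_space {w. length w = n})"
  using assms
proof (induction n arbitrary: x)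
  case 0
  then show ?case by (simp add: nn_integral_count_space_finite birkhoff_def)
next
  case (Suc n)
  let ?G = "\<lambda>n x w. if prepend w x \<in> X \<omega> then ennreal (exp (S \<omega> n (prepend w x))) * f (prepend w x) else 0"
  have shift_w: "(\<lambda>i. prepend w y (i + length w)) = y" for w y
    unfolding prepend_def by simp
  \<comment> \<open>The operator applied last chooses the letter at position \<open>n\<close>, so
    words grow at their right end.\<close>
  have "L \<omega> (Suc n) f x = (\<Sum>a. \<integral>\<^sup>+w. ?G (Suc n) x (w @ [a]) \<partial>count_space {w. length w = n})"
    unfolding ruelle_iter.simps ruelle_def
  proof (rule suminf_cong)
    fix a
    let ?y = "scons a x"
    show "(if ?y \<in> X ((\<theta> ^^ n) \<omega>) then ennreal (exp (\<phi> ((\<theta> ^^ n) \<omega>) ?y)) * L \<omega> n f ?y else 0) =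
      (\<integral>\<^sup>+w. ?G (Suc n) x (w @ [a]) \<partial>count_space {w. length w = n})"
    proof (cases "?y \<in> X ((\<theta> ^^ n) \<omega>)")
      case True
      have "ennreal (exp (\<phi> ((\<theta> ^^ n) \<omega>) ?y)) * ?G n ?y w = ?G (Suc n) x (w @ [a])" if "length w = n" for w
        using shift_w[of w ?y] that
        by (simp add: prepend_snoc birkhoff_Suc exp_add ennreal_mult mult_ac)
      then have "(\<integral>\<^sup>+w. ?G (Suc n) x (w @ [a]) \<partial>count_space {w. length w = n})
        = (\<integral>\<^sup>+w. ennreal (exp (\<phi> ((\<theta> ^^ n) \<omega>) ?y)) * ?G n ?y w \<partial>count_space {w. length w = n})"
        by (intro nn_integral_cong) auto
      also have "\<dots> = ennreal (exp (\<phi> ((\<theta> ^^ n) \<omega>) ?y)) * (\<integral>\<^sup>+w. ?G n ?y w \<partial>count_space {w. length w = n})"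
        by (rule nn_integral_cmult) auto
      finally show ?thesis using Suc.IH[OF True] True by simp
    next
      case False
      have "prepend (w @ [a]) x \<notin> X \<omega>" if "length w = n" for w
      proof
        assume "prepend (w @ [a]) x \<in> X \<omega>"
        from fiber_shift[OF this, of n] show False
          using False shift_w[of w ?y] that by (simp add: prepend_snoc)
      qed
      then have "(\<integral>\<^sup>+w. ?G (Suc n) x (w @ [a]) \<partial>count_space {w. length w = n}) = 0"
        by (simp add: nn_integral_0_iff_AE AE_count_space)
      then show ?thesis using False by simp
    qed
  qed
  also have "\<dots> = (\<integral>\<^sup>+a. \<integral>\<^sup>+w. ?G (Suc n) x (w @ [a]) \<partial>count_space {w. length w = n} \<partial>count_space UNIV)"
    by (rule nn_integral_count_space_nat[symmetric])
  also have "\<dots> = (\<integral>\<^sup>+a. \<integral>\<^sup>+w. ?G (Suc n) x (w @ [a]) * indicator {w. length w = n} w \<partial>count_space UNIV \<partial>count_space UNIV)"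
    by (simp add: nn_integral_count_space_indicator)
  also have "\<dots> = (\<integral>\<^sup>+(a, w). ?G (Suc n) x (w @ [a]) * indicator {w. length w = n} w \<partial>count_space UNIV)"
    by (subst nn_integral_fst_count_space[symmetric]) simp
  also have "\<dots> = (\<integral>\<^sup>+(a, w). ?G (Suc n) x (w @ [a]) \<partial>count_space (UNIV \<times> {w. length w = n}))"
    by (subst (2) nn_integral_count_space_indicator) (auto intro!: nn_integral_cong simp: indicator_def)
  also have "\<dots> = (\<integral>\<^sup>+w. ?G (Suc n) x w \<partial>count_space {w. length w = Suc n})"
  proof -
    have "bij_betw (\<lambda>(a, w). w @ [a]) (UNIV \<times> {w. length w = n}) {w. length w = Suc n}"
      by (rule bij_betwI[where g="\<lambda>w. (last w, butlast w)"]) (auto intro: append_butlast_last_id)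
    from nn_integral_bij_count_space[OF this, of "?G (Suc n) x"] show ?thesis
      unfolding case_prod_unfold .
  qed
  finally show ?case .
qed

end

section \<open>Growth of the iterated Ruelle operator\<close>

locale random_potential = ergodic_mps M \<theta> + fibered_shift \<theta> l \<alpha> \<phi>
  for M :: "'w measure" and \<theta> l \<alpha> \<phi> +
  fixes r :: real and \<kappa> :: "'w \<Rightarrow> real"
  assumes shift: "random_shift M \<theta> l \<alpha>"
    and pot: "potential M \<theta> l \<alpha> \<phi>"
    and hoelder: "holder_with M \<theta> l \<alpha> \<phi> 2 r \<kappa>"
    and B_int: "(\<integral>\<^sup>+\<omega>. (\<Sum>j. ennreal (\<kappa> ((theta_inv M \<theta> ^^ Suc j) \<omega>) * r ^ Suc j)) \<partial>M) < \<infinity>"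
    and S1: "S1 M \<theta> l \<alpha> \<phi>"
    and S2: "S2 M \<theta> l \<alpha> \<phi>"
begin

lemma r: "0 < r" "r < 1"
  and kappa_meas [measurable]: "\<kappa> \<in> borel_measurable M"
  and kappa_ge_1: "\<omega> \<in> space M \<Longrightarrow> 1 \<le> \<kappa> \<omega>"
  using hoelder unfolding holder_with_def by auto

lemma l_meas [measurable]: "l \<in> M \<rightarrow>\<^sub>M count_space UNIV"
  and alpha_meas [measurable]: "(\<lambda>\<omega>. \<alpha> \<omega> i j) \<in> M \<rightarrow>\<^sub>M count_space UNIV"
  using shift unfolding random_shift_def by auto

lemma l_theta_meas [measurable]: "(\<lambda>\<omega>. l ((\<theta> ^^ n) \<omega>)) \<in> M \<rightarrow>\<^sub>M count_space UNIV"
  and alpha_theta_meas [measurable]: "(\<lambda>\<omega>. \<alpha> ((\<theta> ^^ n) \<omega>) i j) \<in> M \<rightarrow>\<^sub>M count_space UNIV"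
  by (rule measurable_compose[OF measurable_theta_funpow l_meas]
      measurable_compose[OF measurable_theta_funpow alpha_meas])+

section \<open>The distortion series and regular base points\<close>

definition logB_series :: "'w \<Rightarrow> ennreal" where
  "logB_series \<omega> = (\<Sum>j. ennreal (\<kappa> ((\<theta>i ^^ Suc j) \<omega>) * r ^ Suc j))"

definition logB :: "'w \<Rightarrow> real" where
  "logB \<omega> = enn2real (logB_series \<omega>)"

lemma logB_series_meas [measurable]: "logB_series \<in> borel_measurable M"
proof -
  have "(\<lambda>\<omega>. \<kappa> ((\<theta>i ^^ Suc j) \<omega>)) \<in> borel_measurable M" for j
    by (rule measurable_compose[OF measurable_theta_inv_funpow kappa_meas])
  then show ?thesis unfolding logB_series_def by measurable
qed

lemma logB_meas [measurable]: "logB \<in> borel_measurable M"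
  unfolding logB_def by measurable

lemma logB_nonneg: "0 \<le> logB \<omega>"
  by (simp add: logB_def)

lemma logB_integrable: "integrable M logB"
proof (rule integrableI_bounded)
  have "(\<integral>\<^sup>+\<omega>. ennreal (norm (logB \<omega>)) \<partial>M) \<le> (\<integral>\<^sup>+\<omega>. logB_series \<omega> \<partial>M)"
    unfolding logB_def by (intro nn_integral_mono) (simp add: ennreal_enn2real_if)
  also have "\<dots> < \<infinity>" using B_int unfolding logB_series_def .
  finally show "(\<integral>\<^sup>+\<omega>. ennreal (norm (logB \<omega>)) \<partial>M) < \<infinity>" .
qed simp

definition logM :: "'w \<Rightarrow> real" where "logM \<omega> = ln (enn2real (Msup \<theta> l \<alpha> \<phi> \<omega>))"
definition logm :: "'w \<Rightarrow> real" where "logm \<omega> = ln (enn2real (minf \<theta> l \<alpha> \<phi> \<omega>))"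

text \<open>Collects the almost sure facts at one base point, so that later arguments run pointwise
  along an orbit. The letters present are required to lie in \<open>W1\<close> because mixing speaks
  only of those.\<close>

definition nice :: "'w \<Rightarrow> bool" where
  "nice \<omega> \<longleftrightarrow> \<omega> \<in> space M \<and>
     (\<forall>i. enat i < l \<omega> \<longrightarrow> (\<exists>j. enat j < l (\<theta> \<omega>) \<and> \<alpha> \<omega> i j)) \<and>
     (\<forall>x\<in>X \<omega>. \<forall>y\<in>X \<omega>. \<forall>j\<ge>2. (\<forall>i<j. x i = y i) \<longrightarrow> \<phi> \<omega> x - \<phi> \<omega> y \<le> \<kappa> \<omega> * r ^ j) \<and>
     logB_series \<omega> < \<top> \<and> (\<forall>b. enat b < l \<omega> \<longrightarrow> b \<in> W1 M l) \<and>
     Msup \<theta> l \<alpha> \<phi> \<omega> < \<top> \<and> 0 < minf \<theta> l \<alpha> \<phi> \<omega>"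

definition regular :: "'w \<Rightarrow> bool" where
  "regular \<omega> \<longleftrightarrow> (\<forall>n. nice ((\<theta> ^^ n) \<omega>) \<and> nice ((\<theta>i ^^ n) \<omega>))"

lemma AE_nice: "AE \<omega> in M. nice \<omega>"
proof -
  have row: "AE \<omega> in M. \<forall>i. enat i < l \<omega> \<longrightarrow> (\<exists>j. enat j < l (\<theta> \<omega>) \<and> \<alpha> \<omega> i j)"
    using shift unfolding random_shift_def by auto
  have var: "AE \<omega> in M. \<forall>j\<ge>2. variation \<theta> l \<alpha> \<phi> \<omega> j \<le> ereal (\<kappa> \<omega> * r ^ j)"
    using hoelder unfolding holder_with_def by auto
  have B: "AE \<omega> in M. logB_series \<omega> \<noteq> \<infinity>"
    by (rule nn_integral_PInf_AE) (use B_int in \<open>auto simp: logB_series_def\<close>)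
  have [measurable]: "Msup \<theta> l \<alpha> \<phi> \<in> borel_measurable M" "minf \<theta> l \<alpha> \<phi> \<in> borel_measurable M"
    using S1 S2 unfolding S1_def S2_def by auto
  have [measurable]: "eln \<in> borel_measurable borel" unfolding eln_def by measurable
  \<comment> \<open>An infinite \<open>Msup\<close>, or a \<open>minf\<close> equal to 0, would make
    the extended logarithm in (S1) or (S2) infinite; finite integrals therefore exclude both almost
    everywhere.\<close>
  have "AE \<omega> in M. e2ennreal (eln (Msup \<theta> l \<alpha> \<phi> \<omega>)) \<noteq> \<infinity>"
    by (rule nn_integral_PInf_AE) (use S1 in \<open>auto simp: S1_def\<close>)
  then have Mf: "AE \<omega> in M. Msup \<theta> l \<alpha> \<phi> \<omega> \<noteq> \<top>" by (simp add: e2ennreal_eln_top)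
  have "AE \<omega> in M. e2ennreal (- eln (minf \<theta> l \<alpha> \<phi> \<omega>)) \<noteq> \<infinity>"
    by (rule nn_integral_PInf_AE) (use S2 in \<open>auto simp: S2_def\<close>)
  then have mf: "AE \<omega> in M. minf \<theta> l \<alpha> \<phi> \<omega> \<noteq> 0"
    by eventually_elim (auto simp: eln_def)
  have "AE \<omega> in M. \<forall>b. enat b < l \<omega> \<longrightarrow> b \<in> W1 M l"
  proof (subst AE_all_countable, intro allI)
    fix b
    have [measurable]: "Omega_letter M l b \<in> sets M" unfolding Omega_letter_def by measurable
    show "AE \<omega> in M. enat b < l \<omega> \<longrightarrow> b \<in> W1 M l"
    proof (cases "b \<in> W1 M l")
      case False
      then have "prob (Omega_letter M l b) = 0" unfolding W1_def by (simp add: zero_less_measure_iff)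
      then have "AE \<omega> in M. \<omega> \<notin> Omega_letter M l b" by (subst (asm) prob_eq_0) auto
      then show ?thesis using AE_space by eventually_elim (auto simp: Omega_letter_def)
    qed simp
  qed
  then show ?thesis
    using row var B Mf mf AE_space
  proof eventually_elim
    case (elim \<omega>)
    have "\<phi> \<omega> x - \<phi> \<omega> y \<le> \<kappa> \<omega> * r ^ j"
      if "x \<in> X \<omega>" "y \<in> X \<omega>" "j \<ge> 2" "\<forall>i<j. x i = y i" for x y j
    proof -
      have "ereal \<bar>\<phi> \<omega> x - \<phi> \<omega> y\<bar> \<le> variation \<theta> l \<alpha> \<phi> \<omega> j"
        unfolding variation_def by (rule SUP_upper2[of "(x, y)"]) (use that in auto)
      also have "\<dots> \<le> ereal (\<kappa> \<omega> * r ^ j)" using elim(3) that by blast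
      finally show ?thesis by simp
    qed
    then show ?case unfolding nice_def using elim by (auto simp: less_top zero_less_iff_neq_zero)
  qed
qed

lemma AE_regular: "AE \<omega> in M. regular \<omega>"
  unfolding regular_def by (rule AE_orbit[OF AE_nice])

lemma regular_nice: "regular \<omega> \<Longrightarrow> nice \<omega>"
  unfolding regular_def by (metis funpow_0)

lemma regular_space: "regular \<omega> \<Longrightarrow> \<omega> \<in> space M"
  using regular_nice nice_def by blast

lemma regular_theta1: assumes "regular \<omega>" shows "regular (\<theta> \<omega>)"
  unfolding regular_def
proof
  fix n
  have "nice ((\<theta> ^^ Suc n) \<omega>)" "nice ((\<theta> ^^ 1) \<omega>)" using assms unfolding regular_def by blast+
  moreover have "nice ((\<theta>i ^^ n) (\<theta> \<omega>))"
  proof (cases n)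
    case (Suc m)
    have "(\<theta>i ^^ n) (\<theta> \<omega>) = (\<theta>i ^^ m) \<omega>"
      using regular_space[OF assms] unfolding Suc funpow_Suc_right by simp
    then show ?thesis using assms unfolding regular_def by simp
  qed (use \<open>nice ((\<theta> ^^ 1) \<omega>)\<close> in simp)
  ultimately show "nice ((\<theta> ^^ n) (\<theta> \<omega>)) \<and> nice ((\<theta>i ^^ n) (\<theta> \<omega>))" by (simp add: funpow_swap1)
qed

lemma regular_theta_inv1: assumes "regular \<omega>" shows "regular (\<theta>i \<omega>)"
  unfolding regular_def
proof
  fix n
  have "nice ((\<theta>i ^^ Suc n) \<omega>)" "nice ((\<theta>i ^^ 1) \<omega>)" using assms unfolding regular_def by blast+
  moreover have "nice ((\<theta> ^^ n) (\<theta>i \<omega>))"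
  proof (cases n)
    case (Suc m)
    have "(\<theta> ^^ n) (\<theta>i \<omega>) = (\<theta> ^^ m) \<omega>"
      using regular_space[OF assms] unfolding Suc funpow_Suc_right by simp
    then show ?thesis using assms unfolding regular_def by simp
  qed (use \<open>nice ((\<theta>i ^^ 1) \<omega>)\<close> in simp)
  ultimately show "nice ((\<theta> ^^ n) (\<theta>i \<omega>)) \<and> nice ((\<theta>i ^^ n) (\<theta>i \<omega>))" by (simp add: funpow_swap1)
qed

lemma regular_theta: "regular \<omega> \<Longrightarrow> regular ((\<theta> ^^ n) \<omega>)"
  and regular_theta_inv: "regular \<omega> \<Longrightarrow> regular ((\<theta>i ^^ n) \<omega>)"
  by (induction n) (auto intro: regular_theta1 regular_theta_inv1)

lemma nice_hoelder:
  assumes "regular \<omega>" "x \<in> X ((\<theta> ^^ k) \<omega>)" "y \<in> X ((\<theta> ^^ k) \<omega>)" "2 \<le> j" "\<And>i. i < j \<Longrightarrow> x i = y i"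
  shows "\<phi> ((\<theta> ^^ k) \<omega>) x - \<phi> ((\<theta> ^^ k) \<omega>) y \<le> \<kappa> ((\<theta> ^^ k) \<omega>) * r ^ j"
  using assms unfolding regular_def nice_def by blast

text \<open>A measurable choice of a point with first letter \<open>b\<close>. A supremum over the uncountable fiber need not be
  measurable; by distortion it may be replaced by a supremum over these countably many points.\<close>

fun follow :: "'w \<Rightarrow> nat \<Rightarrow> nat \<Rightarrow> nat" where
  "follow \<omega> b 0 = b"
| "follow \<omega> b (Suc k) =
    (LEAST j. enat j < l ((\<theta> ^^ Suc k) \<omega>) \<and> \<alpha> ((\<theta> ^^ k) \<omega>) (follow \<omega> b k) j)"

lemma follow_meas: "(\<lambda>\<omega>. follow \<omega> b k) \<in> M \<rightarrow>\<^sub>M count_space UNIV"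
proof (induction k)
  case (Suc k)
  note [measurable] = Suc
  have [measurable]: "(\<lambda>\<omega>. \<alpha> ((\<theta> ^^ k) \<omega>) (follow \<omega> b k) j) \<in> M \<rightarrow>\<^sub>M count_space UNIV" for j
    by (rule measurable_compose_countable[where f="\<lambda>i \<omega>. \<alpha> ((\<theta> ^^ k) \<omega>) i j"]) measurable
  show ?case unfolding follow.simps by measurable
qed simp

lemma follow_meas_PiM: "(\<lambda>\<omega>. follow \<omega> b) \<in> M \<rightarrow>\<^sub>M PiM UNIV (\<lambda>_. count_space UNIV)"
  by (rule measurable_PiM_single') (auto simp: follow_meas)

lemma follow_in_fiber:
  assumes "regular \<omega>" "enat b < l \<omega>"
  shows "follow \<omega> b \<in> X \<omega>"
proof -
  have step: "enat (follow \<omega> b (Suc k)) < l ((\<theta> ^^ Suc k) \<omega>) \<and> \<alpha> ((\<theta> ^^ k) \<omega>) (follow \<omega> b k) (follow \<omega> b (Suc k))"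
    if k: "enat (follow \<omega> b k) < l ((\<theta> ^^ k) \<omega>)" for k
  proof -
    have "nice ((\<theta> ^^ k) \<omega>)" using assms(1) unfolding regular_def by blast
    then have "\<exists>j. enat j < l ((\<theta> ^^ Suc k) \<omega>) \<and> \<alpha> ((\<theta> ^^ k) \<omega>) (follow \<omega> b k) j"
      using k unfolding nice_def by simp
    from LeastI_ex[OF this] show ?thesis by simp
  qed
  have "enat (follow \<omega> b k) < l ((\<theta> ^^ k) \<omega>)" for k
    by (induction k) (use assms step in auto)
  then show ?thesis using step unfolding fiber_def by blast
qed

lemma zero_letter: "\<omega> \<in> space M \<Longrightarrow> enat 0 < l \<omega>"
  using shift unfolding random_shift_def by (metis enat_0 gr_zeroI not_less_zero)

lemma fiber_nonempty: "regular \<omega> \<Longrightarrow> X \<omega> \<noteq> {}"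
  using follow_in_fiber[of \<omega> 0] zero_letter[of \<omega>] regular_space by auto

text \<open>Counted back from the endpoint, with \<open>Suc i = n - k\<close>, the sum is dominated
  by a partial sum of the series for \<open>logB\<close> there. The distortion bound thus depends on
  the endpoint and not on the number of steps.\<close>

lemma logB_partial_sum:
  assumes "regular \<omega>" and "1 \<le> j"
  shows "(\<Sum>k<n. \<kappa> ((\<theta> ^^ k) \<omega>) * r ^ (n - k + j)) \<le> logB ((\<theta> ^^ n) \<omega>)"
proof -
  let ?\<eta> = "(\<theta> ^^ n) \<omega>"
  have sp: "\<omega> \<in> space M" using assms(1) by (rule regular_space)
  have "regular ?\<eta>" using assms(1) by (rule regular_theta)
  then have fin: "logB_series ?\<eta> < \<top>" using regular_nice nice_def by blast
  have nonneg: "0 \<le> \<kappa> ((\<theta>i ^^ i) ?\<eta>)" for i using kappa_ge_1[of "(\<theta>i ^^ i) ?\<eta>"] sp by simp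
  have "(\<Sum>k<n. \<kappa> ((\<theta> ^^ k) \<omega>) * r ^ (n - k + j)) \<le> (\<Sum>k<n. \<kappa> ((\<theta> ^^ k) \<omega>) * r ^ (n - k))"
  proof (intro sum_mono mult_left_mono)
    fix k
    show "r ^ (n - k + j) \<le> r ^ (n - k)" using r by (intro power_decreasing) auto
    show "0 \<le> \<kappa> ((\<theta> ^^ k) \<omega>)" using kappa_ge_1[of "(\<theta> ^^ k) \<omega>"] sp by simp
  qed
  also have "\<dots> = (\<Sum>i<n. \<kappa> ((\<theta>i ^^ Suc i) ?\<eta>) * r ^ Suc i)"
  proof (subst sum.nat_diff_reindex[symmetric], rule sum.cong[OF refl])
    fix i assume "i \<in> {..<n}"
    then have i: "Suc i \<le> n" by simp
    then have "(\<theta>i ^^ Suc i) ?\<eta> = (\<theta> ^^ (n - Suc i)) \<omega>" using theta_funpow_le[OF sp i] by simp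
    then show "\<kappa> ((\<theta> ^^ (n - Suc i)) \<omega>) * r ^ (n - (n - Suc i)) = \<kappa> ((\<theta>i ^^ Suc i) ?\<eta>) * r ^ Suc i"
      using i by (simp only: diff_diff_cancel)
  qed
  finally have le: "(\<Sum>k<n. \<kappa> ((\<theta> ^^ k) \<omega>) * r ^ (n - k + j)) \<le> (\<Sum>i<n. \<kappa> ((\<theta>i ^^ Suc i) ?\<eta>) * r ^ Suc i)" .
  have "ennreal (\<Sum>i<n. \<kappa> ((\<theta>i ^^ Suc i) ?\<eta>) * r ^ Suc i) = (\<Sum>i<n. ennreal (\<kappa> ((\<theta>i ^^ Suc i) ?\<eta>) * r ^ Suc i))"
    by (rule sum_ennreal[symmetric]) (use nonneg r in \<open>auto simp del: funpow.simps power_Suc\<close>)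
  also have "\<dots> \<le> logB_series ?\<eta>" unfolding logB_series_def by (rule sum_le_suminf) auto
  also have "\<dots> = ennreal (logB ?\<eta>)" unfolding logB_def using fin by simp
  finally have "(\<Sum>i<n. \<kappa> ((\<theta>i ^^ Suc i) ?\<eta>) * r ^ Suc i) \<le> logB ?\<eta>"
    using logB_nonneg by (simp add: ennreal_le_iff)
  then show ?thesis using le by linarith
qed

lemma L_one_distortion:
  assumes "regular \<omega>" "x \<in> X ((\<theta> ^^ n) \<omega>)" "y \<in> X ((\<theta> ^^ n) \<omega>)" "x 0 = y 0"
  shows "L \<omega> n (\<lambda>_. 1) x \<le> ennreal (exp (logB ((\<theta> ^^ n) \<omega>))) * L \<omega> n (\<lambda>_. 1) y"
proof -
  have "L \<omega> n (\<lambda>_. 1) x \<le> ennreal (exp (\<Sum>k<n. \<kappa> ((\<theta> ^^ k) \<omega>) * r ^ (n - k + 1))) * L \<omega> n (\<lambda>_. 1) y"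
    by (rule L_distortion) (use assms nice_hoelder in auto)
  also have "\<dots> \<le> ennreal (exp (logB ((\<theta> ^^ n) \<omega>))) * L \<omega> n (\<lambda>_. 1) y"
    using logB_partial_sum[OF assms(1), of 1 n] by (intro mult_right_mono ennreal_leI) auto
  finally show ?thesis .
qed

lemma birkhoff_cylinder_distortion:
  assumes "regular \<omega>" "x \<in> X \<omega>" "y \<in> X \<omega>" "\<And>i. i \<le> n \<Longrightarrow> x i = y i"
  shows "S \<omega> n x \<le> S \<omega> n y + logB ((\<theta> ^^ n) \<omega>)"
proof -
  have "S \<omega> n x \<le> S \<omega> n y + (\<Sum>k<n. \<kappa> ((\<theta> ^^ k) \<omega>) * r ^ (n - k + 1))"
    by (rule birkhoff_distortion) (use assms nice_hoelder in auto)
  then show ?thesis using logB_partial_sum[OF assms(1), of 1 n] by linarith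
qed

lemma minf_le_Msup: "regular \<omega> \<Longrightarrow> minf \<theta> l \<alpha> \<phi> \<omega> \<le> Msup \<theta> l \<alpha> \<phi> \<omega>"
  unfolding minf_def Msup_def using fiber_nonempty[OF regular_theta1] by (rule INF_le_SUP)

lemma Msup_eq: "regular \<omega> \<Longrightarrow> Msup \<theta> l \<alpha> \<phi> \<omega> = ennreal (exp (logM \<omega>))"
  and minf_eq: "regular \<omega> \<Longrightarrow> minf \<theta> l \<alpha> \<phi> \<omega> = ennreal (exp (logm \<omega>))"
proof -
  assume reg: "regular \<omega>"
  then have "nice \<omega>" by (rule regular_nice)
  then have "0 < minf \<theta> l \<alpha> \<phi> \<omega>" "Msup \<theta> l \<alpha> \<phi> \<omega> < \<top>" by (auto simp: nice_def)
  with minf_le_Msup[OF reg] have "0 < minf \<theta> l \<alpha> \<phi> \<omega>" "Msup \<theta> l \<alpha> \<phi> \<omega> < \<top>"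
    "minf \<theta> l \<alpha> \<phi> \<omega> < \<top>" "0 < Msup \<theta> l \<alpha> \<phi> \<omega>" by auto
  then show "Msup \<theta> l \<alpha> \<phi> \<omega> = ennreal (exp (logM \<omega>))" "minf \<theta> l \<alpha> \<phi> \<omega> = ennreal (exp (logm \<omega>))"
    unfolding logM_def logm_def by (simp_all add: enn2real_positive_iff)
qed

lemma logm_le_logM: "regular \<omega> \<Longrightarrow> logm \<omega> \<le> logM \<omega>"
  using minf_le_Msup Msup_eq minf_eq by (simp add: ennreal_le_iff)

lemma logM_meas [measurable]: "logM \<in> borel_measurable M"
  and logm_meas [measurable]: "logm \<in> borel_measurable M"
  unfolding logM_def logm_def using S1 S2 by (auto simp: S1_def S2_def)

text \<open>(S1) controls the positive part of \<open>logM\<close> and (S2) the negative part of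
  \<open>logm\<close>. Since \<open>logm \<le> logM\<close>, the sum of these two parts dominates
  both absolute values.\<close>

lemma integrable_logM: "integrable M logM" and integrable_logm: "integrable M logm"
proof -
  have "(\<integral>\<^sup>+\<omega>. ennreal (logM \<omega>) \<partial>M) = (\<integral>\<^sup>+\<omega>. e2ennreal (eln (Msup \<theta> l \<alpha> \<phi> \<omega>)) \<partial>M)"
    using AE_regular by (intro nn_integral_cong_AE) (auto simp: Msup_eq e2ennreal_ereal elim!: eventually_mono)
  then have p: "(\<integral>\<^sup>+\<omega>. ennreal (logM \<omega>) \<partial>M) < \<infinity>" using S1 unfolding S1_def by simp
  have "(\<integral>\<^sup>+\<omega>. ennreal (- logm \<omega>) \<partial>M) = (\<integral>\<^sup>+\<omega>. e2ennreal (- eln (minf \<theta> l \<alpha> \<phi> \<omega>)) \<partial>M)"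
    using AE_regular by (intro nn_integral_cong_AE) (auto simp: minf_eq e2ennreal_ereal elim!: eventually_mono)
  then have m: "(\<integral>\<^sup>+\<omega>. ennreal (- logm \<omega>) \<partial>M) < \<infinity>" using S2 unfolding S2_def by simp
  have "integrable M (\<lambda>\<omega>. max (logM \<omega>) 0 + max (- logm \<omega>) 0)"
  proof (rule Bochner_Integration.integrable_add; rule integrableI_bounded)
    have "ennreal (norm (max x 0)) = ennreal x" for x :: real by (auto simp: max_def ennreal_neg)
    then show "(\<integral>\<^sup>+\<omega>. ennreal (norm (max (logM \<omega>) 0)) \<partial>M) < \<infinity>"
      "(\<integral>\<^sup>+\<omega>. ennreal (norm (max (- logm \<omega>) 0)) \<partial>M) < \<infinity>" using p m by simp_all
  qed auto
  then show "integrable M logM" "integrable M logm"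
    by (rule Bochner_Integration.integrable_bound;
        use AE_regular in \<open>auto elim!: eventually_mono dest!: logm_le_logM\<close>)+
qed

lemma L_one_bounds:
  assumes "regular \<omega>" "x \<in> X ((\<theta> ^^ n) \<omega>)"
  shows "ennreal (exp (birk logm n \<omega>)) \<le> L \<omega> n (\<lambda>_. 1) x"
    and "L \<omega> n (\<lambda>_. 1) x \<le> ennreal (exp (birk logM n \<omega>))"
proof -
  have step: "ennreal (exp (logm ((\<theta> ^^ n) \<omega>))) \<le> ruelle \<theta> l \<alpha> \<phi> ((\<theta> ^^ n) \<omega>) (\<lambda>_. 1) x"
    "ruelle \<theta> l \<alpha> \<phi> ((\<theta> ^^ n) \<omega>) (\<lambda>_. 1) x \<le> ennreal (exp (logM ((\<theta> ^^ n) \<omega>)))"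
    if "x \<in> X ((\<theta> ^^ Suc n) \<omega>)" for n x
    unfolding minf_eq[OF regular_theta[OF assms(1)], symmetric] Msup_eq[OF regular_theta[OF assms(1)], symmetric]
      minf_def Msup_def using that by (auto intro: INF_lower SUP_upper)
  have "ennreal (exp (birk logm n \<omega>)) \<le> L \<omega> n (\<lambda>_. 1) x \<and> L \<omega> n (\<lambda>_. 1) x \<le> ennreal (exp (birk logM n \<omega>))"
    using assms(2)
  proof (induction n arbitrary: x)
    case 0
    then show ?case by (simp add: birk_def)
  next
    case (Suc n)
    have L1: "L ((\<theta> ^^ n) \<omega>) 1 (\<lambda>_. 1) x = ruelle \<theta> l \<alpha> \<phi> ((\<theta> ^^ n) \<omega>) (\<lambda>_. 1) x" by simp
    have x: "x \<in> X ((\<theta> ^^ (n + 1)) \<omega>)" using Suc.prems by simp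
    have "L \<omega> (n + 1) (\<lambda>_. 1) x \<le> ennreal (exp (birk logM n \<omega>)) * L ((\<theta> ^^ n) \<omega>) 1 (\<lambda>_. 1) x"
      by (rule L_le_const_mult) (use Suc x in auto)
    also have "\<dots> \<le> ennreal (exp (birk logM n \<omega>)) * ennreal (exp (logM ((\<theta> ^^ n) \<omega>)))"
      unfolding L1 by (intro mult_left_mono step Suc.prems) auto
    finally have 1: "L \<omega> (Suc n) (\<lambda>_. 1) x \<le> ennreal (exp (birk logM (Suc n) \<omega>))"
      by (simp add: birk_def exp_add ennreal_mult)
    have "ennreal (exp (birk logm n \<omega>)) * ennreal (exp (logm ((\<theta> ^^ n) \<omega>)))
        \<le> ennreal (exp (birk logm n \<omega>)) * L ((\<theta> ^^ n) \<omega>) 1 (\<lambda>_. 1) x"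
      unfolding L1 by (intro mult_left_mono step Suc.prems) auto
    also have "\<dots> \<le> L \<omega> (n + 1) (\<lambda>_. 1) x"
      by (rule L_ge_const_mult) (use Suc x in auto)
    finally have 2: "ennreal (exp (birk logm (Suc n) \<omega>)) \<le> L \<omega> (Suc n) (\<lambda>_. 1) x"
      by (simp add: birk_def exp_add ennreal_mult)
    from 1 2 show ?case by blast
  qed
  then show "ennreal (exp (birk logm n \<omega>)) \<le> L \<omega> n (\<lambda>_. 1) x"
    "L \<omega> n (\<lambda>_. 1) x \<le> ennreal (exp (birk logM n \<omega>))" by auto
qed

section \<open>Measurability of the iterated operator at a measurable point\<close>

lemma in_fiber_meas:
  assumes [measurable]: "x \<in> M \<rightarrow>\<^sub>M PiM UNIV (\<lambda>_. count_space UNIV)"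
  shows "{\<omega> \<in> space M. x \<omega> \<in> X ((\<theta> ^^ n) \<omega>)} \<in> sets M"
proof -
  have x: "(\<lambda>\<omega>. x \<omega> i) \<in> M \<rightarrow>\<^sub>M count_space UNIV" for i
    by (rule measurable_compose[OF assms measurable_component_singleton]) simp
  have 1: "{\<omega> \<in> space M. enat (x \<omega> i) < l ((\<theta> ^^ k) \<omega>)} \<in> sets M" for i k
  proof -
    have "(\<lambda>\<omega>. enat c < l ((\<theta> ^^ k) \<omega>)) \<in> M \<rightarrow>\<^sub>M count_space UNIV" for c
      by (rule measurable_compose[OF l_theta_meas]) simp
    from measurable_compose_countable[OF this x] show ?thesis unfolding pred_def .
  qed
  have 2: "{\<omega> \<in> space M. \<alpha> ((\<theta> ^^ k) \<omega>) (x \<omega> i) (x \<omega> j)} \<in> sets M" for i j k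
  proof -
    have "(\<lambda>\<omega>. \<alpha> ((\<theta> ^^ k) \<omega>) c (x \<omega> j)) \<in> M \<rightarrow>\<^sub>M count_space UNIV" for c
      by (rule measurable_compose_countable[OF alpha_theta_meas x])
    from measurable_compose_countable[OF this x] show ?thesis unfolding pred_def .
  qed
  show ?thesis unfolding fiber_def mem_Collect_eq theta_funpow_funpow
    by (intro sets.sets_Collect_countable_All sets.sets_Collect_conj 1 2)
qed

text \<open>The potential is measurable only on the restriction to \<open>Xset\<close>; the value 0
  outside the fiber is the one the operator uses as well.\<close>

lemma exp_phi_meas:
  assumes x: "x \<in> M \<rightarrow>\<^sub>M PiM UNIV (\<lambda>_. count_space UNIV)"
  shows "(\<lambda>\<omega>. if x \<omega> \<in> X ((\<theta> ^^ n) \<omega>) then ennreal (exp (\<phi> ((\<theta> ^^ n) \<omega>) (x \<omega>))) else 0) \<in> borel_measurable M"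
proof -
  define A where "A = {\<omega> \<in> space M. x \<omega> \<in> X ((\<theta> ^^ n) \<omega>)}"
  have A: "A \<in> sets M" unfolding A_def by (rule in_fiber_meas[OF x])
  have "(\<lambda>\<omega>. ((\<theta> ^^ n) \<omega>, x \<omega>)) \<in> M \<rightarrow>\<^sub>M M \<Otimes>\<^sub>M PiM UNIV (\<lambda>_. count_space UNIV)"
    using x by measurable
  then have "(\<lambda>\<omega>. ((\<theta> ^^ n) \<omega>, x \<omega>)) \<in> restrict_space M A \<rightarrow>\<^sub>M
      restrict_space (M \<Otimes>\<^sub>M PiM UNIV (\<lambda>_. count_space UNIV)) (Xset M \<theta> l \<alpha>)"
    by (intro measurable_restrict_space2 measurable_restrict_space1)
      (auto simp: space_restrict_space A_def Xset_def)
  from measurable_compose[OF this pot[unfolded potential_def]]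
  have [measurable]: "(\<lambda>\<omega>. \<phi> ((\<theta> ^^ n) \<omega>) (x \<omega>)) \<in> borel_measurable (restrict_space M A)" by simp
  have "(\<lambda>\<omega>. ennreal (exp (\<phi> ((\<theta> ^^ n) \<omega>) (x \<omega>)))) \<in> borel_measurable (restrict_space M A)"
    by measurable
  then have "(\<lambda>\<omega>. if \<omega> \<in> A then ennreal (exp (\<phi> ((\<theta> ^^ n) \<omega>) (x \<omega>))) else 0) \<in> borel_measurable M"
    using A by (subst (asm) measurable_restrict_space_iff) auto
  then show ?thesis by (rule measurable_cong[THEN iffD1, rotated]) (auto simp: A_def)
qed

lemma L_meas:
  assumes "x \<in> M \<rightarrow>\<^sub>M PiM UNIV (\<lambda>_. count_space UNIV)"
  shows "(\<lambda>\<omega>. L \<omega> n (\<lambda>_. 1) (x \<omega>)) \<in> borel_measurable M"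
  using assms
proof (induction n arbitrary: x)
  case (Suc n)
  have comp: "(\<lambda>\<omega>. x \<omega> i) \<in> M \<rightarrow>\<^sub>M count_space UNIV" for i
    by (rule measurable_compose[OF Suc.prems measurable_component_singleton]) simp
  have sc: "(\<lambda>\<omega>. scons a (x \<omega>)) \<in> M \<rightarrow>\<^sub>M PiM UNIV (\<lambda>_. count_space UNIV)" for a
  proof (rule measurable_PiM_single')
    fix i show "(\<lambda>\<omega>. scons a (x \<omega>) i) \<in> M \<rightarrow>\<^sub>M count_space UNIV"
      by (cases i) (auto simp: comp)
  qed simp
  have eq: "(if P then c * d else 0) = (if P then c else 0) * d" for P and c d :: ennreal by simp
  show ?case
    unfolding ruelle_iter.simps ruelle_def eq
    by (intro borel_measurable_suminf_order borel_measurable_times_ennreal exp_phi_meas sc Suc.IH)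
qed simp

section \<open>Countable extrema and the two subadditive sequences\<close>

definition Rsup :: "nat \<Rightarrow> 'w \<Rightarrow> ennreal" where
  "Rsup n \<omega> = (SUP b. if enat b < l ((\<theta> ^^ n) \<omega>) then L \<omega> n (\<lambda>_. 1) (follow ((\<theta> ^^ n) \<omega>) b) else 0)"

definition Rinf :: "nat \<Rightarrow> 'w \<Rightarrow> ennreal" where
  "Rinf n \<omega> = (INF b. if enat b < l ((\<theta> ^^ n) \<omega>) then L \<omega> n (\<lambda>_. 1) (follow ((\<theta> ^^ n) \<omega>) b) else \<top>)"

definition logsup :: "nat \<Rightarrow> 'w \<Rightarrow> real" where "logsup n \<omega> = ln (enn2real (Rsup n \<omega>))"
definition loginf :: "nat \<Rightarrow> 'w \<Rightarrow> real" where "loginf n \<omega> = ln (enn2real (Rinf n \<omega>))"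

text \<open>\<open>Rsup\<close> and \<open>Rinf\<close> see only the points \<open>follow\<close>,
  with 0 and \<open>\<top>\<close> as neutral values for absent letters. The term
  \<open>logB\<close> at the endpoint makes \<open>exp (u n \<omega>)\<close> and
  \<open>exp (- v n \<omega>)\<close> bounds on the whole fiber, which is what composition of
  operators requires.\<close>

definition u :: "nat \<Rightarrow> 'w \<Rightarrow> real" where "u n \<omega> = logB ((\<theta> ^^ n) \<omega>) + logsup n \<omega>"
definition v :: "nat \<Rightarrow> 'w \<Rightarrow> real" where "v n \<omega> = logB ((\<theta> ^^ n) \<omega>) - loginf n \<omega>"

lemma L_follow_meas [measurable]: "(\<lambda>\<omega>. L \<omega> n (\<lambda>_. 1) (follow ((\<theta> ^^ n) \<omega>) b)) \<in> borel_measurable M"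
  by (rule L_meas measurable_compose[OF measurable_theta_funpow follow_meas_PiM])+

lemma uv_meas [measurable]: "u n \<in> borel_measurable M" "v n \<in> borel_measurable M"
proof -
  have [measurable]: "(\<lambda>\<omega>. logB ((\<theta> ^^ n) \<omega>)) \<in> borel_measurable M"
    by (rule measurable_compose[OF measurable_theta_funpow logB_meas])
  show "u n \<in> borel_measurable M" "v n \<in> borel_measurable M"
    unfolding u_def v_def logsup_def loginf_def Rsup_def Rinf_def by measurable
qed

lemma L_follow_le_Rsup: "enat b < l ((\<theta> ^^ n) \<omega>) \<Longrightarrow> L \<omega> n (\<lambda>_. 1) (follow ((\<theta> ^^ n) \<omega>) b) \<le> Rsup n \<omega>"
  unfolding Rsup_def by (rule SUP_upper2[of b]) auto

lemma Rinf_le_L_follow: "enat b < l ((\<theta> ^^ n) \<omega>) \<Longrightarrow> Rinf n \<omega> \<le> L \<omega> n (\<lambda>_. 1) (follow ((\<theta> ^^ n) \<omega>) b)"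
  unfolding Rinf_def by (rule INF_lower2[of b]) auto

lemma follow_theta_in_fiber: "regular \<omega> \<Longrightarrow> enat b < l ((\<theta> ^^ n) \<omega>) \<Longrightarrow> follow ((\<theta> ^^ n) \<omega>) b \<in> X ((\<theta> ^^ n) \<omega>)"
  by (intro follow_in_fiber regular_theta)

lemma Rsup_least:
  assumes "regular \<omega>" "\<And>b. enat b < l ((\<theta> ^^ n) \<omega>) \<Longrightarrow> L \<omega> n (\<lambda>_. 1) (follow ((\<theta> ^^ n) \<omega>) b) \<le> c"
  shows "Rsup n \<omega> \<le> c"
  unfolding Rsup_def using assms by (intro SUP_least) auto

lemma Rinf_greatest:
  assumes "regular \<omega>" "\<And>b. enat b < l ((\<theta> ^^ n) \<omega>) \<Longrightarrow> c \<le> L \<omega> n (\<lambda>_. 1) (follow ((\<theta> ^^ n) \<omega>) b)"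
  shows "c \<le> Rinf n \<omega>"
  unfolding Rinf_def using assms by (intro INF_greatest) auto

lemma Rinf_le_Rsup:
  assumes "regular \<omega>" shows "Rinf n \<omega> \<le> Rsup n \<omega>"
proof -
  have "enat 0 < l ((\<theta> ^^ n) \<omega>)" using zero_letter regular_space[OF assms] by simp
  then show ?thesis using Rinf_le_L_follow L_follow_le_Rsup order_trans by blast
qed

lemma Rsup_bound: "regular \<omega> \<Longrightarrow> Rsup n \<omega> \<le> ennreal (exp (birk logM n \<omega>))"
  and Rinf_bound: "regular \<omega> \<Longrightarrow> ennreal (exp (birk logm n \<omega>)) \<le> Rinf n \<omega>"
  by (intro Rsup_least Rinf_greatest L_one_bounds follow_theta_in_fiber; assumption)+

lemma Rsup_eq: "regular \<omega> \<Longrightarrow> Rsup n \<omega> = ennreal (exp (logsup n \<omega>))"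
  and Rinf_eq: "regular \<omega> \<Longrightarrow> Rinf n \<omega> = ennreal (exp (loginf n \<omega>))"
proof -
  assume reg: "regular \<omega>"
  have pos: "0 < Rinf n \<omega>" by (rule less_le_trans[OF _ Rinf_bound[OF reg]]) simp
  have fin: "Rsup n \<omega> < \<top>" by (rule le_less_trans[OF Rsup_bound[OF reg]]) simp
  from Rinf_le_Rsup[OF reg, of n] pos fin have "0 < Rsup n \<omega>" "Rinf n \<omega> < \<top>" by auto
  then show "Rsup n \<omega> = ennreal (exp (logsup n \<omega>))" "Rinf n \<omega> = ennreal (exp (loginf n \<omega>))"
    unfolding logsup_def loginf_def using pos fin by (simp_all add: enn2real_positive_iff)
qed

lemma logsup_bounds:
  assumes "regular \<omega>"
  shows "birk logm n \<omega> \<le> loginf n \<omega>" "loginf n \<omega> \<le> logsup n \<omega>" "logsup n \<omega> \<le> birk logM n \<omega>"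
  using Rsup_bound[OF assms, of n] Rinf_bound[OF assms, of n] Rinf_le_Rsup[OF assms, of n]
  by (simp_all add: Rsup_eq[OF assms] Rinf_eq[OF assms] ennreal_le_iff)

lemma uv_nonneg: "regular \<omega> \<Longrightarrow> 0 \<le> u n \<omega> + v n \<omega>"
  using logsup_bounds(2)[of \<omega> n] logB_nonneg unfolding u_def v_def by (simp add: add_nonneg_nonneg)

lemma integrable_uv: "integrable M (u n)" "integrable M (v n)"
proof -
  let ?g = "\<lambda>\<omega>. logB ((\<theta> ^^ n) \<omega>) + \<bar>birk logM n \<omega>\<bar> + \<bar>birk logm n \<omega>\<bar>"
  have g: "integrable M ?g"
    using integrable_theta_funpow[OF logB_integrable] integrable_birk[OF integrable_logM] integrable_birk[OF integrable_logm]
    by auto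
  show "integrable M (u n)"
    using AE_regular logsup_bounds[of _ n] logB_nonneg[of "(\<theta> ^^ n) _"] unfolding u_def
    by (intro Bochner_Integration.integrable_bound[OF g] uv_meas[unfolded u_def]) (auto elim!: eventually_mono, smt (verit))
  show "integrable M (v n)"
    using AE_regular logsup_bounds[of _ n] logB_nonneg[of "(\<theta> ^^ n) _"] unfolding v_def
    by (intro Bochner_Integration.integrable_bound[OF g] uv_meas[unfolded v_def]) (auto elim!: eventually_mono, smt (verit))
qed

lemma first_letter: "x \<in> X \<omega> \<Longrightarrow> enat (x 0) < l \<omega>"
  unfolding fiber_def by (auto dest: spec[of _ 0])

lemma L_le_exp_u:
  assumes "regular \<omega>" "x \<in> X ((\<theta> ^^ n) \<omega>)"
  shows "L \<omega> n (\<lambda>_. 1) x \<le> ennreal (exp (u n \<omega>))"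
proof -
  have x0: "enat (x 0) < l ((\<theta> ^^ n) \<omega>)" by (rule first_letter[OF assms(2)])
  have "L \<omega> n (\<lambda>_. 1) x \<le> ennreal (exp (logB ((\<theta> ^^ n) \<omega>))) * L \<omega> n (\<lambda>_. 1) (follow ((\<theta> ^^ n) \<omega>) (x 0))"
    by (rule L_one_distortion) (use assms x0 follow_theta_in_fiber in auto)
  also have "\<dots> \<le> ennreal (exp (logB ((\<theta> ^^ n) \<omega>))) * Rsup n \<omega>"
    by (intro mult_left_mono L_follow_le_Rsup x0) auto
  finally show ?thesis by (simp add: u_def Rsup_eq[OF assms(1)] exp_add ennreal_mult)
qed

lemma exp_v_le_L:
  assumes "regular \<omega>" "x \<in> X ((\<theta> ^^ n) \<omega>)"
  shows "ennreal (exp (- v n \<omega>)) \<le> L \<omega> n (\<lambda>_. 1) x"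
proof -
  have x0: "enat (x 0) < l ((\<theta> ^^ n) \<omega>)" by (rule first_letter[OF assms(2)])
  have "ennreal (exp (logB ((\<theta> ^^ n) \<omega>))) * ennreal (exp (- v n \<omega>)) = Rinf n \<omega>"
    by (simp add: v_def Rinf_eq[OF assms(1)] ennreal_mult[symmetric] exp_add[symmetric])
  also have "\<dots> \<le> L \<omega> n (\<lambda>_. 1) (follow ((\<theta> ^^ n) \<omega>) (x 0))" by (rule Rinf_le_L_follow[OF x0])
  also have "\<dots> \<le> ennreal (exp (logB ((\<theta> ^^ n) \<omega>))) * L \<omega> n (\<lambda>_. 1) x"
    by (rule L_one_distortion) (use assms x0 follow_theta_in_fiber in auto)
  finally show ?thesis
    by (subst (asm) ennreal_mult_le_mult_iff) auto
qed

text \<open>\<open>exp (u n \<omega>)\<close> bounds the first \<open>n\<close> steps on the whole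
  intermediate fiber, so the distortion there is already paid for. The term \<open>logB\<close> at
  the final endpoint occurs on both sides.\<close>

lemma sub_u: assumes "regular \<omega>" shows "u (n + k) \<omega> \<le> u n \<omega> + u k ((\<theta> ^^ n) \<omega>)"
proof -
  let ?\<eta> = "(\<theta> ^^ n) \<omega>"
  have reg: "regular ?\<eta>" using assms by (rule regular_theta)
  have eq: "(\<theta> ^^ (n + k)) \<omega> = (\<theta> ^^ k) ?\<eta>" by (simp add: theta_funpow_funpow)
  have "Rsup (n + k) \<omega> \<le> ennreal (exp (u n \<omega>)) * Rsup k ?\<eta>"
  proof (rule Rsup_least[OF assms])
    fix b assume b: "enat b < l ((\<theta> ^^ (n + k)) \<omega>)"
    have "L \<omega> (n + k) (\<lambda>_. 1) (follow ((\<theta> ^^ (n + k)) \<omega>) b)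
        \<le> ennreal (exp (u n \<omega>)) * L ?\<eta> k (\<lambda>_. 1) (follow ((\<theta> ^^ (n + k)) \<omega>) b)"
      by (rule L_le_const_mult) (use assms b L_le_exp_u follow_theta_in_fiber in auto)
    also have "\<dots> \<le> ennreal (exp (u n \<omega>)) * Rsup k ?\<eta>"
      using b unfolding eq by (intro mult_left_mono L_follow_le_Rsup) auto
    finally show "L \<omega> (n + k) (\<lambda>_. 1) (follow ((\<theta> ^^ (n + k)) \<omega>) b) \<le> ennreal (exp (u n \<omega>)) * Rsup k ?\<eta>" .
  qed
  then have "logsup (n + k) \<omega> \<le> u n \<omega> + logsup k ?\<eta>"
    by (simp add: Rsup_eq[OF assms] Rsup_eq[OF reg] ennreal_mult[symmetric] exp_add[symmetric])
  then show ?thesis unfolding u_def[of "n + k"] u_def[of k] eq by linarith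
qed

lemma sub_v: assumes "regular \<omega>" shows "v (n + k) \<omega> \<le> v n \<omega> + v k ((\<theta> ^^ n) \<omega>)"
proof -
  let ?\<eta> = "(\<theta> ^^ n) \<omega>"
  have reg: "regular ?\<eta>" using assms by (rule regular_theta)
  have eq: "(\<theta> ^^ (n + k)) \<omega> = (\<theta> ^^ k) ?\<eta>" by (simp add: theta_funpow_funpow)
  have "ennreal (exp (- v n \<omega>)) * Rinf k ?\<eta> \<le> Rinf (n + k) \<omega>"
  proof (rule Rinf_greatest[OF assms])
    fix b assume b: "enat b < l ((\<theta> ^^ (n + k)) \<omega>)"
    have "ennreal (exp (- v n \<omega>)) * Rinf k ?\<eta>
        \<le> ennreal (exp (- v n \<omega>)) * L ?\<eta> k (\<lambda>_. 1) (follow ((\<theta> ^^ (n + k)) \<omega>) b)"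
      using b unfolding eq by (intro mult_left_mono Rinf_le_L_follow) auto
    also have "\<dots> \<le> L \<omega> (n + k) (\<lambda>_. 1) (follow ((\<theta> ^^ (n + k)) \<omega>) b)"
      by (rule L_ge_const_mult) (use assms b exp_v_le_L follow_theta_in_fiber in auto)
    finally show "ennreal (exp (- v n \<omega>)) * Rinf k ?\<eta> \<le> L \<omega> (n + k) (\<lambda>_. 1) (follow ((\<theta> ^^ (n + k)) \<omega>) b)" .
  qed
  then have "- v n \<omega> + loginf k ?\<eta> \<le> loginf (n + k) \<omega>"
    by (simp add: Rinf_eq[OF assms] Rinf_eq[OF reg] ennreal_mult[symmetric] exp_add[symmetric])
  then show ?thesis unfolding v_def[of "n + k"] v_def[of k] eq by linarith
qed

text \<open>The two copies of \<open>logB\<close> are the widenings of \<open>u\<close> and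
  \<open>v\<close>; what remains is the logarithm of the ratio of \<open>Rsup\<close> and
  \<open>Rinf\<close>.\<close>

lemma gap_le:
  assumes "regular \<omega>"
    and "\<And>x y. x \<in> X ((\<theta> ^^ n) \<omega>) \<Longrightarrow> y \<in> X ((\<theta> ^^ n) \<omega>) \<Longrightarrow> L \<omega> n (\<lambda>_. 1) x \<le> ennreal (exp t) * L \<omega> n (\<lambda>_. 1) y"
  shows "u n \<omega> + v n \<omega> \<le> t + 2 * logB ((\<theta> ^^ n) \<omega>)"
proof -
  have "Rsup n \<omega> \<le> ennreal (exp t) * Rinf n \<omega>"
  proof (rule Rsup_least[OF assms(1)])
    fix b assume b: "enat b < l ((\<theta> ^^ n) \<omega>)"
    \<comment> \<open>The factor is moved to the left as \<open>exp (- t)\<close>, so that the claim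
      becomes a lower bound for an infimum, checked letter by letter.\<close>
    have "ennreal (exp (- t)) * L \<omega> n (\<lambda>_. 1) (follow ((\<theta> ^^ n) \<omega>) b) \<le> Rinf n \<omega>"
    proof (rule Rinf_greatest[OF assms(1)])
      fix c assume c: "enat c < l ((\<theta> ^^ n) \<omega>)"
      have "ennreal (exp (- t)) * L \<omega> n (\<lambda>_. 1) (follow ((\<theta> ^^ n) \<omega>) b)
          \<le> ennreal (exp (- t)) * (ennreal (exp t) * L \<omega> n (\<lambda>_. 1) (follow ((\<theta> ^^ n) \<omega>) c))"
        by (intro mult_left_mono assms follow_theta_in_fiber b c) auto
      also have "\<dots> = L \<omega> n (\<lambda>_. 1) (follow ((\<theta> ^^ n) \<omega>) c)"
        by (simp add: mult.assoc[symmetric] ennreal_mult[symmetric] exp_add[symmetric])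
      finally show "ennreal (exp (- t)) * L \<omega> n (\<lambda>_. 1) (follow ((\<theta> ^^ n) \<omega>) b) \<le> L \<omega> n (\<lambda>_. 1) (follow ((\<theta> ^^ n) \<omega>) c)" .
    qed
    then have "ennreal (exp t) * (ennreal (exp (- t)) * L \<omega> n (\<lambda>_. 1) (follow ((\<theta> ^^ n) \<omega>) b)) \<le> ennreal (exp t) * Rinf n \<omega>"
      by (intro mult_left_mono) auto
    then show "L \<omega> n (\<lambda>_. 1) (follow ((\<theta> ^^ n) \<omega>) b) \<le> ennreal (exp t) * Rinf n \<omega>"
      by (simp add: mult.assoc[symmetric] ennreal_mult[symmetric] exp_add[symmetric])
  qed
  then have "logsup n \<omega> \<le> t + loginf n \<omega>"
    by (simp add: Rsup_eq[OF assms(1)] Rinf_eq[OF assms(1)] ennreal_mult[symmetric] exp_add[symmetric])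
  then show ?thesis unfolding u_def v_def by linarith
qed

text \<open>Each loop word \<open>w\<close> is matched with the preimage \<open>prepend w x\<close>.
  As \<open>x\<close> starts with \<open>a\<close>, it lies in the cylinder of
  \<open>w @ [a]\<close> and shares \<open>n + 1\<close> letters with every point there, so
  distortion applies. The other words only enlarge the operator sum.\<close>

lemma Zloop_upper:
  assumes reg: "regular \<omega>" and n: "n \<ge> 1" and x: "x \<in> X ((\<theta> ^^ n) \<omega>)" "x 0 = a"
  shows "Zloop \<theta> l \<alpha> \<phi> a n \<omega> \<le> ennreal (exp (logB ((\<theta> ^^ n) \<omega>))) * L \<omega> n (\<lambda>_. 1) x"
proof -
  let ?W = "loop_words \<theta> l \<alpha> \<omega> n a"
  let ?B = "ennreal (exp (logB ((\<theta> ^^ n) \<omega>)))"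
  let ?g = "\<lambda>w. if prepend w x \<in> X \<omega> then ennreal (exp (S \<omega> n (prepend w x))) * 1 else 0"
  have le: "(SUP y\<in>cyl \<theta> l \<alpha> \<omega> (w @ [a]). ennreal (exp (S \<omega> n y))) \<le> ?B * ?g w" if w: "w \<in> ?W" for w
  proof (rule SUP_least)
    fix y assume "y \<in> cyl \<theta> l \<alpha> \<omega> (w @ [a])"
    then have y: "y \<in> X \<omega>" "\<And>i. i < Suc (length w) \<Longrightarrow> y i = (w @ [a]) ! i" unfolding cyl_def by auto
    have w': "length w = n" "admissible \<theta> l \<alpha> \<omega> w" "w ! 0 = a" "\<alpha> ((\<theta> ^^ (n - 1)) \<omega>) (last w) a"
      using w unfolding loop_words_def by auto
    have p: "prepend w x \<in> X \<omega>"
      unfolding prepend_def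
    proof (rule splice_at_in_fiber)
      show "\<alpha> ((\<theta> ^^ i) \<omega>) (w ! i) (x 0)" if "length w = Suc i" for i
        using w' that x last_conv_nth[of w] by (cases w) auto
    qed (use w' x in \<open>auto simp: admissible_def\<close>)
    have "y i = prepend w x i" if "i \<le> n" for i
      using y(2)[of i] that w'(1) x(2) by (cases "i = n") (auto simp: prepend_def splice_at_def nth_append)
    from birkhoff_cylinder_distortion[OF reg y(1) p this]
    have "S \<omega> n y \<le> S \<omega> n (prepend w x) + logB ((\<theta> ^^ n) \<omega>)" by simp
    then have "ennreal (exp (S \<omega> n y)) \<le> ennreal (exp (logB ((\<theta> ^^ n) \<omega>)) * exp (S \<omega> n (prepend w x)))"
      by (simp add: exp_add[symmetric] add.commute)
    then show "ennreal (exp (S \<omega> n y)) \<le> ?B * ?g w" using p by (simp add: ennreal_mult)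
  qed
  have "Zloop \<theta> l \<alpha> \<phi> a n \<omega> \<le> (\<integral>\<^sup>+w. ?B * ?g w \<partial>count_space ?W)"
    unfolding Zloop_def by (intro nn_integral_mono le) simp
  also have "\<dots> = ?B * (\<integral>\<^sup>+w. ?g w \<partial>count_space ?W)" by (rule nn_integral_cmult) simp
  also have "(\<integral>\<^sup>+w. ?g w \<partial>count_space ?W) \<le> (\<integral>\<^sup>+w. ?g w \<partial>count_space {w. length w = n})"
    by (subst (1 2) nn_integral_count_space_indicator)
      (auto intro!: nn_integral_mono simp: indicator_def loop_words_def)
  also have "\<dots> = L \<omega> n (\<lambda>_. 1) x" by (rule L_eq_sum_words[OF x(1), symmetric])
  finally show ?thesis by (simp add: mult_left_mono)
qed

text \<open>A preimage of \<open>x\<close> that starts with \<open>a\<close> comes from a loop word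
  and lies in its cylinder, so its weight is below the supremum and no distortion enters.
  \<open>n \<ge> 1\<close> ensures that the first letter belongs to the word and not to
  \<open>x\<close>.\<close>

lemma Zloop_lower:
  assumes n: "n \<ge> 1" and x: "x \<in> X ((\<theta> ^^ n) \<omega>)" "x 0 = a"
  shows "L \<omega> n (\<lambda>y. if y 0 = a then 1 else 0) x \<le> Zloop \<theta> l \<alpha> \<phi> a n \<omega>"
proof -
  let ?W = "loop_words \<theta> l \<alpha> \<omega> n a"
  let ?g = "\<lambda>w. if prepend w x \<in> X \<omega> then ennreal (exp (S \<omega> n (prepend w x))) * (if prepend w x 0 = a then 1 else 0) else 0"
  have W: "w \<in> ?W" "prepend w x \<in> cyl \<theta> l \<alpha> \<omega> (w @ [a])"
    if w: "length w = n" "prepend w x \<in> X \<omega>" "prepend w x 0 = a" for w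
  proof -
    have i: "prepend w x i = w ! i" if "i < n" for i using that w(1) unfolding prepend_def by simp
    have nx: "prepend w x n = a" using w(1) x unfolding prepend_def splice_at_def by simp
    have f: "enat (prepend w x i) < l ((\<theta> ^^ i) \<omega>)" "\<alpha> ((\<theta> ^^ i) \<omega>) (prepend w x i) (prepend w x (Suc i))" for i
      using w(2) unfolding fiber_def by auto
    have "admissible \<theta> l \<alpha> \<omega> w"
      unfolding admissible_def
    proof (intro conjI allI impI)
      fix j
      show "enat (w ! j) < l ((\<theta> ^^ j) \<omega>)" if "j < length w"
        using f(1)[of j] i[of j] that w(1) by simp
      show "\<alpha> ((\<theta> ^^ j) \<omega>) (w ! j) (w ! Suc j)" if "Suc j < length w"
        using f(2)[of j] i[of j] i[of "Suc j"] that w(1) by simp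
    qed
    moreover have "w ! 0 = a" using i[of 0] n w(3) by simp
    moreover have "\<alpha> ((\<theta> ^^ (n - 1)) \<omega>) (last w) a"
    proof -
      have "w \<noteq> []" using n w(1) by auto
      then have "last w = prepend w x (n - 1)" using i[of "n - 1"] n w(1) by (simp add: last_conv_nth)
      then show ?thesis using f(2)[of "n - 1"] n nx by simp
    qed
    ultimately show "w \<in> ?W" using w(1) unfolding loop_words_def by simp
    show "prepend w x \<in> cyl \<theta> l \<alpha> \<omega> (w @ [a])"
      unfolding cyl_def using w i nx by (auto simp: nth_append less_Suc_eq)
  qed
  have "L \<omega> n (\<lambda>y. if y 0 = a then 1 else 0) x = (\<integral>\<^sup>+w. ?g w \<partial>count_space {w. length w = n})"
    by (rule L_eq_sum_words[OF x(1)])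
  also have "\<dots> \<le> (\<integral>\<^sup>+w. (SUP y\<in>cyl \<theta> l \<alpha> \<omega> (w @ [a]). ennreal (exp (S \<omega> n y))) * indicator ?W w \<partial>count_space {w. length w = n})"
    using W by (intro nn_integral_mono) (auto intro!: SUP_upper)
  also have "\<dots> \<le> Zloop \<theta> l \<alpha> \<phi> a n \<omega>"
    unfolding Zloop_def
    by (subst (1 2) nn_integral_count_space_indicator) (auto intro!: nn_integral_mono simp: indicator_def)
  finally show ?thesis .
qed

end

section \<open>Big images and preimages\<close>

locale bip_shift = random_potential M \<theta> l \<alpha> \<phi> r \<kappa>
  for M :: "'w measure" and \<theta> l \<alpha> \<phi> r \<kappa> +
  fixes Nmix :: "nat \<Rightarrow> nat \<Rightarrow> 'w \<Rightarrow> nat" and \<Omega>bi \<Omega>bp :: "'w set" and Ibi Ibp :: "'w \<Rightarrow> nat set"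
  assumes mixing: "top_mixing M \<theta> l \<alpha> Nmix"
    and bi: "big_image M \<theta> l \<alpha> \<Omega>bi Ibi"
    and bp: "big_preimage M \<theta> l \<alpha> \<Omega>bp Ibp"
    and variation_1: "AE \<omega> in M. \<theta> \<omega> \<in> \<Omega>bi \<union> \<Omega>bp \<longrightarrow> variation \<theta> l \<alpha> \<phi> \<omega> 1 < \<infinity>"
begin

text \<open>Serves at the step into \<open>\<Omega>bi\<close> or \<open>\<Omega>bp\<close>, where
  two points share a single letter and the Hoelder bound does not reach.\<close>

definition V1_finite :: "'w \<Rightarrow> bool" where
  "V1_finite \<omega> \<longleftrightarrow> (\<theta> \<omega> \<in> \<Omega>bi \<union> \<Omega>bp \<longrightarrow> (\<exists>V. \<forall>x\<in>X \<omega>. \<forall>y\<in>X \<omega>. x 0 = y 0 \<longrightarrow> \<phi> \<omega> x - \<phi> \<omega> y \<le> V))"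

lemma AE_V1_finite: "AE \<omega> in M. \<forall>n. V1_finite ((\<theta> ^^ n) \<omega>) \<and> V1_finite ((\<theta>i ^^ n) \<omega>)"
proof (rule AE_orbit, use variation_1 in eventually_elim)
  case (elim \<omega>)
  show ?case unfolding V1_finite_def
  proof
    assume "\<theta> \<omega> \<in> \<Omega>bi \<union> \<Omega>bp"
    with elim have fin: "variation \<theta> l \<alpha> \<phi> \<omega> 1 < \<infinity>" by blast
    have "\<phi> \<omega> x - \<phi> \<omega> y \<le> real_of_ereal (variation \<theta> l \<alpha> \<phi> \<omega> 1)"
      if "x \<in> X \<omega>" "y \<in> X \<omega>" "x 0 = y 0" for x y
    proof -
      have le: "ereal \<bar>\<phi> \<omega> x - \<phi> \<omega> y\<bar> \<le> variation \<theta> l \<alpha> \<phi> \<omega> 1"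
        unfolding variation_def by (rule SUP_upper2[of "(x, y)"]) (use that in auto)
      then show ?thesis using fin by (cases "variation \<theta> l \<alpha> \<phi> \<omega> 1") auto
    qed
    then show "\<exists>V. \<forall>x\<in>X \<omega>. \<forall>y\<in>X \<omega>. x 0 = y 0 \<longrightarrow> \<phi> \<omega> x - \<phi> \<omega> y \<le> V" by blast
  qed
qed

text \<open>The sets \<open>Ibp \<eta>\<close> and \<open>Ibi \<zeta>\<close> need not depend measurably on the base point, so they are replaced by
  initial segments of the alphabet.\<close>

definition preimages_below :: "nat \<Rightarrow> 'w \<Rightarrow> bool" where
  "preimages_below K \<eta> \<longleftrightarrow> (\<forall>c. enat c < l \<eta> \<longrightarrow> (\<exists>d\<le>K. enat d < l (\<theta>i \<eta>) \<and> \<alpha> (\<theta>i \<eta>) d c))"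

definition images_below :: "nat \<Rightarrow> 'w \<Rightarrow> bool" where
  "images_below K \<zeta> \<longleftrightarrow> (\<forall>c. enat c < l (\<theta>i \<zeta>) \<longrightarrow> (\<exists>b\<le>K. enat b < l \<zeta> \<and> \<alpha> (\<theta>i \<zeta>) c b))"

text \<open>Mixing supplies one path from \<open>b\<close> to each of the finitely many
  \<open>d \<le> K\<close> over \<open>\<theta>i \<eta>\<close>. Big preimages let every
  \<open>x\<close> over \<open>\<eta>\<close> be attached to one of these paths, so finitely many
  weights decide the cost.\<close>

lemma connect:
  assumes reg: "regular \<zeta>" and eta: "\<eta> = (\<theta> ^^ Suc k) \<zeta>" "\<eta> \<in> \<Omega>bp" "preimages_below K \<eta>"
    and V1: "V1_finite (\<theta>i \<eta>)" and b: "enat b < l \<zeta>"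
    and N: "\<And>d. d \<le> K \<Longrightarrow> d \<in> W1 M l \<Longrightarrow> Nmix b d \<zeta> \<le> k"
  shows "\<exists>t. \<forall>x\<in>X \<eta>. \<exists>y\<in>X \<zeta>. y 0 = b \<and> (\<lambda>i. y (i + Suc k)) = x \<and> t \<le> S \<zeta> (Suc k) y"
proof -
  have sp: "\<zeta> \<in> space M" using reg by (rule regular_space)
  have inv_eta: "\<theta>i \<eta> = (\<theta> ^^ k) \<zeta>" using sp unfolding eta(1) by simp
  define D where "D = {d. d \<le> K \<and> enat d < l ((\<theta> ^^ k) \<zeta>)}"
  have "finite D" unfolding D_def by simp
  have "\<exists>z\<in>X \<zeta>. z 0 = b \<and> z k = d" if d: "d \<in> D" for d
  proof -
    have bW: "b \<in> W1 M l" using regular_nice[OF reg] b unfolding nice_def by blast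
    have dW: "d \<in> W1 M l"
      using regular_nice[OF regular_theta[OF reg, of k]] d unfolding nice_def D_def by blast
    have "\<zeta> \<in> Omega_letter M l b" "(\<theta> ^^ k) \<zeta> \<in> Omega_letter M l d"
      using sp b d unfolding Omega_letter_def D_def by auto
    moreover have "Nmix b d \<zeta> \<le> k" using N d dW unfolding D_def by blast
    ultimately show ?thesis using mixing bW dW unfolding top_mixing_def by blast
  qed
  then obtain z where z: "\<And>d. d \<in> D \<Longrightarrow> z d \<in> X \<zeta> \<and> z d 0 = b \<and> z d k = d" by metis
  \<comment> \<open>After \<open>i\<close> shifts, path and spliced point share
    \<open>Suc k - i\<close> letters: at least two for \<open>i < k\<close>, but only one for
    \<open>i = k\<close>, where the finite one-letter variation steps in.\<close>
  have "\<exists>E. \<forall>y\<in>X ((\<theta> ^^ i) \<zeta>). \<forall>z\<in>X ((\<theta> ^^ i) \<zeta>). (\<forall>j<Suc k - i. y j = z j) \<longrightarrow>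
      \<phi> ((\<theta> ^^ i) \<zeta>) z - \<phi> ((\<theta> ^^ i) \<zeta>) y \<le> E" if i: "i < Suc k" for i
  proof (cases "i = k")
    case True
    have "\<theta> (\<theta>i \<eta>) \<in> \<Omega>bi \<union> \<Omega>bp" using eta sp by simp
    then obtain V where "\<forall>x\<in>X ((\<theta> ^^ k) \<zeta>). \<forall>y\<in>X ((\<theta> ^^ k) \<zeta>). x 0 = y 0 \<longrightarrow> \<phi> ((\<theta> ^^ k) \<zeta>) x - \<phi> ((\<theta> ^^ k) \<zeta>) y \<le> V"
      using V1 unfolding V1_finite_def inv_eta by blast
    then show ?thesis using True by (intro exI[of _ V]) auto
  next
    case False
    show ?thesis
      by (rule exI[of _ "\<kappa> ((\<theta> ^^ i) \<zeta>) * r ^ (Suc k - i)"]) (use False i nice_hoelder[OF reg] in auto)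
  qed
  then obtain E where E: "\<And>i y z. i < Suc k \<Longrightarrow> y \<in> X ((\<theta> ^^ i) \<zeta>) \<Longrightarrow> z \<in> X ((\<theta> ^^ i) \<zeta>) \<Longrightarrow>
      (\<forall>j<Suc k - i. y j = z j) \<Longrightarrow> \<phi> ((\<theta> ^^ i) \<zeta>) z - \<phi> ((\<theta> ^^ i) \<zeta>) y \<le> E i" by metis
  \<comment> \<open>Absolute values summed over all \<open>d\<close> make one \<open>t\<close> serve
    every choice of path.\<close>
  define t where "t = - (\<Sum>d\<in>D. \<bar>S \<zeta> (Suc k) (z d)\<bar>) - (\<Sum>i<Suc k. E i)"
  show ?thesis
  proof (intro exI[of _ t] ballI)
    fix x assume x: "x \<in> X \<eta>"
    obtain d where d: "d \<in> D" "\<alpha> ((\<theta> ^^ k) \<zeta>) d (x 0)"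
      using eta(3) first_letter[OF x] unfolding preimages_below_def inv_eta D_def by blast
    note zd = z[OF d(1)]
    define y where "y = splice_at (Suc k) (z d) x"
    have y: "y \<in> X \<zeta>"
      unfolding y_def
    proof (rule splice_at_in_fiber)
      show "enat (z d i) < l ((\<theta> ^^ i) \<zeta>)" "\<alpha> ((\<theta> ^^ i) \<zeta>) (z d i) (z d (Suc i))" for i
        using zd unfolding fiber_def by auto
    qed (use x d zd eta in auto)
    have agree: "y i = z d i" if "i < Suc k" for i using that unfolding y_def by simp
    have "S \<zeta> (Suc k) (z d) - S \<zeta> (Suc k) y = (\<Sum>i<Suc k. \<phi> ((\<theta> ^^ i) \<zeta>) (\<lambda>j. z d (j + i)) - \<phi> ((\<theta> ^^ i) \<zeta>) (\<lambda>j. y (j + i)))"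
      unfolding birkhoff_def sum_subtractf ..
    also have "\<dots> \<le> (\<Sum>i<Suc k. E i)"
      using zd y agree by (intro sum_mono E fiber_shift) auto
    finally have "S \<zeta> (Suc k) (z d) - (\<Sum>i<Suc k. E i) \<le> S \<zeta> (Suc k) y" by simp
    moreover have "\<bar>S \<zeta> (Suc k) (z d)\<bar> \<le> (\<Sum>d\<in>D. \<bar>S \<zeta> (Suc k) (z d)\<bar>)"
      using d(1) \<open>finite D\<close> by (intro member_le_sum) auto
    ultimately have "t \<le> S \<zeta> (Suc k) y" unfolding t_def by linarith
    moreover have "y 0 = b" using agree[of 0] zd by simp
    moreover have "(\<lambda>i. y (i + Suc k)) = x" unfolding y_def by (rule shift_splice_at)
    ultimately show "\<exists>y\<in>X \<zeta>. y 0 = b \<and> (\<lambda>i. y (i + Suc k)) = x \<and> t \<le> S \<zeta> (Suc k) y" using y by blast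
  qed
qed

text \<open>A branch with last letter \<open>c\<close> also leads to some \<open>b \<le> K\<close>.
  Replacing \<open>x\<close> by \<open>follow \<zeta> b\<close> keeps \<open>c\<close>, at the price
  \<open>V\<close> for the last step and \<open>logB\<close> for the earlier ones. Since
  \<open>b\<close> depends on \<open>c\<close>, all admissible \<open>b\<close> are summed.\<close>

lemma L_le_sum_images:
  assumes reg: "regular \<omega>" and zeta: "\<zeta> = (\<theta> ^^ Suc j) \<omega>" "images_below K \<zeta>"
    and V: "\<forall>x\<in>X (\<theta>i \<zeta>). \<forall>y\<in>X (\<theta>i \<zeta>). x 0 = y 0 \<longrightarrow> \<phi> (\<theta>i \<zeta>) x - \<phi> (\<theta>i \<zeta>) y \<le> V"
    and x: "x \<in> X \<zeta>"
  shows "L \<omega> (Suc j) (\<lambda>_. 1) x \<le> ennreal (exp (V + logB (\<theta>i \<zeta>))) *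
    (\<Sum>b\<in>{b. b \<le> K \<and> enat b < l \<zeta>}. L \<omega> (Suc j) (\<lambda>_. 1) (follow \<zeta> b))"
proof -
  have sp: "\<omega> \<in> space M" using reg by (rule regular_space)
  have inv: "\<theta>i \<zeta> = (\<theta> ^^ j) \<omega>" using sp unfolding zeta(1) by simp
  have reg_z: "regular \<zeta>" unfolding zeta(1) using reg by (rule regular_theta)
  define D where "D = {b. b \<le> K \<and> enat b < l \<zeta>}"
  have D: "finite D" unfolding D_def by simp
  let ?g = "\<lambda>x c. if scons c x \<in> X ((\<theta> ^^ j) \<omega>) then ennreal (exp (\<phi> ((\<theta> ^^ j) \<omega>) (scons c x))) * L \<omega> j (\<lambda>_. 1) (scons c x) else 0"
  let ?C = "ennreal (exp (V + logB ((\<theta> ^^ j) \<omega>)))"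
  have term_le: "?g x c \<le> ?C * (\<Sum>b\<in>D. ?g (follow \<zeta> b) c)" for c
  proof (cases "scons c x \<in> X ((\<theta> ^^ j) \<omega>)")
    case True
    then have "enat c < l (\<theta>i \<zeta>)" by (simp add: scons_in_fiber inv)
    then obtain b where b: "b \<in> D" "\<alpha> ((\<theta> ^^ j) \<omega>) c b"
      using zeta(2) unfolding images_below_def inv D_def by blast
    have f: "follow \<zeta> b \<in> X \<zeta>" using b reg_z unfolding D_def by (intro follow_in_fiber) auto
    have f': "scons c (follow \<zeta> b) \<in> X ((\<theta> ^^ j) \<omega>)"
      using True f b by (simp add: scons_in_fiber zeta(1))
    have "\<phi> ((\<theta> ^^ j) \<omega>) (scons c x) - \<phi> ((\<theta> ^^ j) \<omega>) (scons c (follow \<zeta> b)) \<le> V"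
      using V True f' by (simp add: inv)
    then have "exp (\<phi> ((\<theta> ^^ j) \<omega>) (scons c x)) \<le> exp V * exp (\<phi> ((\<theta> ^^ j) \<omega>) (scons c (follow \<zeta> b)))"
      by (simp add: exp_add[symmetric])
    moreover have "L \<omega> j (\<lambda>_. 1) (scons c x) \<le> ennreal (exp (logB ((\<theta> ^^ j) \<omega>))) * L \<omega> j (\<lambda>_. 1) (scons c (follow \<zeta> b))"
      by (rule L_one_distortion[OF reg True f']) simp
    ultimately have "?g x c \<le> ennreal (exp V * exp (\<phi> ((\<theta> ^^ j) \<omega>) (scons c (follow \<zeta> b)))) *
        (ennreal (exp (logB ((\<theta> ^^ j) \<omega>))) * L \<omega> j (\<lambda>_. 1) (scons c (follow \<zeta> b)))"
      using True by (auto intro!: mult_mono ennreal_leI)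
    also have "\<dots> = ?C * ?g (follow \<zeta> b) c"
      using f' by (simp add: exp_add ennreal_mult mult_ac)
    also have "\<dots> \<le> ?C * (\<Sum>b\<in>D. ?g (follow \<zeta> b) c)"
      using b(1) D by (intro mult_left_mono member_le_sum) auto
    finally show ?thesis .
  qed simp
  have "L \<omega> (Suc j) (\<lambda>_. 1) x = (\<Sum>c. ?g x c)" by (simp only: ruelle_iter.simps ruelle_def)
  also have "\<dots> \<le> (\<Sum>c. ?C * (\<Sum>b\<in>D. ?g (follow \<zeta> b) c))" by (intro suminf_le term_le) auto
  also have "\<dots> = ?C * (\<Sum>c. \<Sum>b\<in>D. ?g (follow \<zeta> b) c)" by (rule ennreal_suminf_cmult)
  also have "(\<Sum>c. \<Sum>b\<in>D. ?g (follow \<zeta> b) c) = (\<Sum>b\<in>D. \<Sum>c. ?g (follow \<zeta> b) c)"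
    by (rule suminf_sum) simp
  also have "\<dots> = (\<Sum>b\<in>D. L \<omega> (Suc j) (\<lambda>_. 1) (follow \<zeta> b))" by (simp only: ruelle_iter.simps ruelle_def)
  finally show ?thesis unfolding D_def inv .
qed

text \<open>Every word ending before \<open>\<zeta>\<close> can be continued by one of finitely many letters \<open>b \<le> Ki\<close>, and from
  each such \<open>b\<close> every point over \<open>\<eta>\<close> is reached at a cost independent of the length of the word.\<close>

lemma gap_bounded_at:
  assumes reg: "regular \<eta>" and zeta: "\<zeta> = (\<theta>i ^^ Suc k) \<eta>"
    and eta_bp: "\<eta> \<in> \<Omega>bp" "preimages_below Kp \<eta>" and Vp: "V1_finite (\<theta>i \<eta>)"
    and zeta_bi: "\<zeta> \<in> \<Omega>bi" "images_below Ki \<zeta>" and Vi: "V1_finite (\<theta>i \<zeta>)"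
    and N: "\<And>b d. b \<le> Ki \<Longrightarrow> d \<le> Kp \<Longrightarrow> b \<in> W1 M l \<Longrightarrow> d \<in> W1 M l \<Longrightarrow> Nmix b d \<zeta> \<le> k"
  shows "\<exists>C. \<forall>n. u n ((\<theta>i ^^ n) \<eta>) + v n ((\<theta>i ^^ n) \<eta>) \<le> C"
proof -
  have sp: "\<eta> \<in> space M" using reg by (rule regular_space)
  have reg_z: "regular \<zeta>" unfolding zeta using reg by (rule regular_theta_inv)
  have spz: "\<zeta> \<in> space M" using reg_z by (rule regular_space)
  have eta: "\<eta> = (\<theta> ^^ Suc k) \<zeta>"
    unfolding zeta using sp by (rule theta_theta_inv_funpow[symmetric])
  define D where "D = {b. b \<le> Ki \<and> enat b < l \<zeta>}"
  have D: "finite D" unfolding D_def by simp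
  have "\<exists>t. \<forall>x\<in>X \<eta>. \<exists>y\<in>X \<zeta>. y 0 = b \<and> (\<lambda>i. y (i + Suc k)) = x \<and> t \<le> S \<zeta> (Suc k) y" if b: "b \<in> D" for b
  proof (rule connect[OF reg_z eta eta_bp Vp])
    show "enat b < l \<zeta>" using b unfolding D_def by simp
    then have "b \<in> W1 M l" using regular_nice[OF reg_z] unfolding nice_def by blast
    then show "Nmix b d \<zeta> \<le> k" if "d \<le> Kp" "d \<in> W1 M l" for d using N that b unfolding D_def by blast
  qed
  then obtain t where t: "\<And>b x. b \<in> D \<Longrightarrow> x \<in> X \<eta> \<Longrightarrow>
      \<exists>y\<in>X \<zeta>. y 0 = b \<and> (\<lambda>i. y (i + Suc k)) = x \<and> t b \<le> S \<zeta> (Suc k) y" by metis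
  have "\<theta> (\<theta>i \<zeta>) \<in> \<Omega>bi \<union> \<Omega>bp" using zeta_bi spz by simp
  then obtain V where V: "\<forall>x\<in>X (\<theta>i \<zeta>). \<forall>y\<in>X (\<theta>i \<zeta>). x 0 = y 0 \<longrightarrow> \<phi> (\<theta>i \<zeta>) x - \<phi> (\<theta>i \<zeta>) y \<le> V"
    using Vi unfolding V1_finite_def by blast
  \<comment> \<open>\<open>c1\<close> is the cost of reducing to finitely many letters over
    \<open>\<zeta>\<close>, \<open>c2\<close> bounds the operator on the block up to
    \<open>\<eta>\<close>, and \<open>c3\<close> is the cost of leading these letters to an
    arbitrary point over \<open>\<eta>\<close>. The 1 added in \<open>T\<close> keeps it
    nonnegative.\<close>
  define c1 where "c1 = exp (V + logB (\<theta>i \<zeta>))"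
  define c2 where "c2 = exp (birk logM (Suc k) \<zeta>)"
  define c3 where "c3 = (\<Sum>b\<in>D. exp (logB \<zeta> - t b))"
  have c: "0 \<le> c1" "0 \<le> c2" "0 \<le> c3" unfolding c1_def c2_def c3_def by (auto intro: sum_nonneg)
  define T where "T = ln (c1 * c2 * c3 + 1)"
  have expT: "exp T = c1 * c2 * c3 + 1" and T: "0 \<le> T" using c unfolding T_def by (simp_all add: add_nonneg_pos)
  \<comment> \<open>At least one step must precede \<open>\<zeta>\<close>, because big images
    concern the letter over \<open>\<theta>i \<zeta>\<close>.\<close>
  have late: "u n ((\<theta>i ^^ n) \<eta>) + v n ((\<theta>i ^^ n) \<eta>) \<le> T + 2 * logB \<eta>" if n: "n = Suc j + Suc k" for n j
  proof -
    define \<omega> where "\<omega> = (\<theta>i ^^ n) \<eta>"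
    have reg_w: "regular \<omega>" unfolding \<omega>_def using reg by (rule regular_theta_inv)
    have wz: "\<zeta> = (\<theta> ^^ Suc j) \<omega>"
      unfolding \<omega>_def zeta n using theta_theta_inv_funpow2[OF sp, of "Suc j" "Suc k"] by (simp only: add.commute)
    have we: "\<eta> = (\<theta> ^^ n) \<omega>" unfolding \<omega>_def using sp by simp
    define A where "A = (\<Sum>b\<in>D. L \<omega> (Suc j) (\<lambda>_. 1) (follow \<zeta> b))"
    have "L \<omega> n (\<lambda>_. 1) x \<le> ennreal (exp T) * L \<omega> n (\<lambda>_. 1) x'" if x: "x \<in> X \<eta>" "x' \<in> X \<eta>" for x x'
    proof -
      have "L \<omega> n (\<lambda>_. 1) x \<le> (ennreal c1 * A) * L \<zeta> (Suc k) (\<lambda>_. 1) x"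
        unfolding n wz
      proof (rule L_le_const_mult)
        show "L \<omega> (Suc j) (\<lambda>_. 1) y \<le> ennreal c1 * A" if "y \<in> X ((\<theta> ^^ Suc j) \<omega>)" for y
          using L_le_sum_images[OF reg_w wz zeta_bi(2) V, of y] that
          unfolding A_def D_def c1_def wz by simp
      qed (use x we n in simp)
      also have "\<dots> \<le> (ennreal c1 * A) * ennreal c2"
        unfolding c2_def using reg_z x eta by (intro mult_left_mono L_one_bounds) auto
      also have "A \<le> ennreal c3 * L \<omega> n (\<lambda>_. 1) x'"
      proof -
        have "L \<omega> (Suc j) (\<lambda>_. 1) (follow \<zeta> b) \<le> ennreal (exp (logB \<zeta> - t b)) * L \<omega> n (\<lambda>_. 1) x'" if b: "b \<in> D" for b
        proof -
          obtain y where y: "y \<in> X \<zeta>" "y 0 = b" "(\<lambda>i. y (i + Suc k)) = x'" "t b \<le> S \<zeta> (Suc k) y"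
            using t[OF b x(2)] by blast
          have "ennreal (exp (t b)) * L \<omega> (Suc j) (\<lambda>_. 1) y \<le> ennreal (exp (S \<zeta> (Suc k) y)) * L \<omega> (Suc j) (\<lambda>_. 1) y"
            using y(4) by (intro mult_right_mono ennreal_leI) auto
          also have "\<dots> \<le> L \<zeta> (Suc k) (L \<omega> (Suc j) (\<lambda>_. 1)) (\<lambda>i. y (i + Suc k))"
            by (rule L_ge_branch[OF y(1)])
          also have "\<dots> = L \<omega> n (\<lambda>_. 1) x'" unfolding y(3) n L_add wz ..
          finally have yx: "ennreal (exp (t b)) * L \<omega> (Suc j) (\<lambda>_. 1) y \<le> L \<omega> n (\<lambda>_. 1) x'" .
          have "follow \<zeta> b \<in> X \<zeta>" using b reg_z unfolding D_def by (intro follow_in_fiber) auto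
          then have "L \<omega> (Suc j) (\<lambda>_. 1) (follow \<zeta> b) \<le> ennreal (exp (logB \<zeta>)) * L \<omega> (Suc j) (\<lambda>_. 1) y"
            using L_one_distortion[OF reg_w, of "follow \<zeta> b" "Suc j" y] y unfolding wz[symmetric] by simp
          also have "\<dots> = ennreal (exp (logB \<zeta> - t b)) * (ennreal (exp (t b)) * L \<omega> (Suc j) (\<lambda>_. 1) y)"
            by (simp add: mult.assoc[symmetric] ennreal_mult[symmetric] exp_add[symmetric])
          also have "\<dots> \<le> ennreal (exp (logB \<zeta> - t b)) * L \<omega> n (\<lambda>_. 1) x'"
            by (intro mult_left_mono yx) auto
          finally show ?thesis .
        qed
        then have "A \<le> (\<Sum>b\<in>D. ennreal (exp (logB \<zeta> - t b)) * L \<omega> n (\<lambda>_. 1) x')"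
          unfolding A_def by (rule sum_mono)
        also have "\<dots> = ennreal c3 * L \<omega> n (\<lambda>_. 1) x'"
          unfolding c3_def by (simp add: sum_distrib_right[symmetric])
        finally show ?thesis .
      qed
      finally have "L \<omega> n (\<lambda>_. 1) x \<le> ennreal c1 * (ennreal c3 * L \<omega> n (\<lambda>_. 1) x') * ennreal c2"
        by (simp add: mult_left_mono mult_right_mono)
      also have "\<dots> = ennreal (c1 * c2 * c3) * L \<omega> n (\<lambda>_. 1) x'"
        using c by (simp add: ennreal_mult mult_ac)
      also have "\<dots> \<le> ennreal (exp T) * L \<omega> n (\<lambda>_. 1) x'"
        unfolding expT by (intro mult_right_mono ennreal_leI) auto
      finally show ?thesis .
    qed
    then have "u n \<omega> + v n \<omega> \<le> T + 2 * logB ((\<theta> ^^ n) \<omega>)"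
      by (intro gap_le[OF reg_w]) (simp flip: we)
    then show ?thesis unfolding we[symmetric] by (simp add: \<omega>_def)
  qed
  define w where "w n = u n ((\<theta>i ^^ n) \<eta>) + v n ((\<theta>i ^^ n) \<eta>)" for n
  \<comment> \<open>The finitely many shorter times are absorbed by a sum of absolute
    values.\<close>
  have "w n \<le> T + 2 * logB \<eta> + (\<Sum>i<k + 2. \<bar>w i\<bar>)" for n
  proof (cases "n < k + 2")
    case True
    then have "\<bar>w n\<bar> \<le> (\<Sum>i<k + 2. \<bar>w i\<bar>)" by (intro member_le_sum) auto
    then show ?thesis using T logB_nonneg[of \<eta>] by linarith
  next
    case False
    then have "n = Suc (n - (k + 2)) + Suc k" by simp
    from late[OF this] show ?thesis unfolding w_def[of n] by (simp add: sum_nonneg add_increasing2)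
  qed
  then show ?thesis unfolding w_def by blast
qed

section \<open>Uniform constants and the bounded gap almost everywhere\<close>

lemma l_theta_inv_meas [measurable]: "(\<lambda>\<omega>. l (\<theta>i \<omega>)) \<in> M \<rightarrow>\<^sub>M count_space UNIV"
  and alpha_theta_inv_meas [measurable]: "(\<lambda>\<omega>. \<alpha> (\<theta>i \<omega>) i j) \<in> M \<rightarrow>\<^sub>M count_space UNIV"
  by (rule measurable_compose[OF measurable_theta_inv l_meas]
      measurable_compose[OF measurable_theta_inv alpha_meas])+

text \<open>At each point the maximum of the finite set \<open>Ibp \<eta>\<close> is a valid
  \<open>K\<close>; measurability is required only for the sets with \<open>K\<close> fixed.\<close>

lemma uniform_big_preimage:
  "\<exists>K. {\<eta> \<in> \<Omega>bp. preimages_below K \<eta>} \<in> sets M \<and> prob {\<eta> \<in> \<Omega>bp. preimages_below K \<eta>} > 0"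
proof -
  have A: "\<Omega>bp \<in> sets M" "prob \<Omega>bp > 0" using bp unfolding big_preimage_def by auto
  have sets: "{\<eta> \<in> \<Omega>bp. preimages_below K \<eta>} \<in> sets M" for K
    by (rule sets_restrict_Collect[OF A(1)]) (unfold preimages_below_def, measurable)
  have "\<exists>K. preimages_below K \<eta>" if eta: "\<eta> \<in> \<Omega>bp" for \<eta>
  proof -
    have fin: "finite (Ibp \<eta>)" and *: "Ibp \<eta> \<subseteq> {b. enat b < l (\<theta>i \<eta>)}"
      "\<And>c. enat c < l \<eta> \<Longrightarrow> \<exists>b\<in>Ibp \<eta>. \<alpha> (\<theta>i \<eta>) b c"
      using bp eta unfolding big_preimage_def by auto
    have "preimages_below (Max (Ibp \<eta>)) \<eta>"
      unfolding preimages_below_def using * Max_ge[OF fin] by blast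
    then show ?thesis by blast
  qed
  then have "AE \<eta> in M. \<eta> \<in> \<Omega>bp \<longrightarrow> (\<exists>K. preimages_below K \<eta>)" by simp
  from positive_prob_Ex[OF sets this A] show ?thesis using sets by blast
qed

definition mixed_within :: "nat \<Rightarrow> nat \<Rightarrow> nat \<Rightarrow> 'w \<Rightarrow> bool" where
  "mixed_within K K' N \<zeta> \<longleftrightarrow>
    (\<forall>b d. b \<le> K \<and> d \<le> K' \<and> b \<in> W1 M l \<and> d \<in> W1 M l \<longrightarrow> Nmix b d \<zeta> \<le> N)"

text \<open>With \<open>K'\<close> fixed beforehand by the preimage side, only finitely many pairs
  of letters occur, so their mixing times at \<open>\<zeta>\<close> have a common bound, which is
  then made uniform on a smaller set.\<close>

lemma uniform_big_image:
  "\<exists>K N. {\<zeta> \<in> \<Omega>bi. images_below K \<zeta> \<and> mixed_within K K' N \<zeta>} \<in> sets M \<and>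
    prob {\<zeta> \<in> \<Omega>bi. images_below K \<zeta> \<and> mixed_within K K' N \<zeta>} > 0"
proof -
  have A: "\<Omega>bi \<in> sets M" "prob \<Omega>bi > 0" using bi unfolding big_image_def by auto
  have sets: "{\<eta> \<in> \<Omega>bi. images_below K \<eta>} \<in> sets M" for K
    by (rule sets_restrict_Collect[OF A(1)]) (unfold images_below_def, measurable)
  have "\<exists>K. images_below K \<eta>" if eta: "\<eta> \<in> \<Omega>bi" for \<eta>
  proof -
    have fin: "finite (Ibi \<eta>)" and *: "Ibi \<eta> \<subseteq> {b. enat b < l \<eta>}"
      "\<And>c. enat c < l (\<theta>i \<eta>) \<Longrightarrow> \<exists>b\<in>Ibi \<eta>. \<alpha> (\<theta>i \<eta>) c b"
      using bi eta unfolding big_image_def by auto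
    have "images_below (Max (Ibi \<eta>)) \<eta>"
      unfolding images_below_def using * Max_ge[OF fin] by blast
    then show ?thesis by blast
  qed
  then have "AE \<eta> in M. \<eta> \<in> \<Omega>bi \<longrightarrow> (\<exists>K. images_below K \<eta>)" by simp
  from positive_prob_Ex[OF sets this A] obtain K where K: "prob {\<eta> \<in> \<Omega>bi. images_below K \<eta>} > 0" by blast
  have mixed_sets: "{\<zeta> \<in> {\<eta> \<in> \<Omega>bi. images_below K \<eta>}. mixed_within K K' N \<zeta>} \<in> sets M" for N
  proof (rule sets_restrict_Collect[OF sets])
    have "{\<zeta> \<in> space M. b \<le> K \<and> d \<le> K' \<and> b \<in> W1 M l \<and> d \<in> W1 M l \<longrightarrow> Nmix b d \<zeta> \<le> N} \<in> sets M" for b d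
    proof (cases "b \<le> K \<and> d \<le> K' \<and> b \<in> W1 M l \<and> d \<in> W1 M l")
      case True
      then have [measurable]: "Nmix b d \<in> M \<rightarrow>\<^sub>M count_space UNIV" using mixing unfolding top_mixing_def by blast
      have "{\<zeta> \<in> space M. Nmix b d \<zeta> \<le> N} \<in> sets M" by measurable
      then show ?thesis using True by simp
    next
      case False
      then show ?thesis by (simp only: simp_thms) auto
    qed
    then show "{\<zeta> \<in> space M. mixed_within K K' N \<zeta>} \<in> sets M"
      unfolding mixed_within_def by (intro sets.sets_Collect_countable_All)
  qed
  have "\<exists>N. mixed_within K K' N \<zeta>" for \<zeta>
  proof -
    have "Nmix b d \<zeta> \<le> (\<Sum>b\<le>K. \<Sum>d\<le>K'. Nmix b d \<zeta>)" if "b \<le> K" "d \<le> K'" for b d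
    proof -
      have "Nmix b d \<zeta> \<le> (\<Sum>d\<le>K'. Nmix b d \<zeta>)" using that by (intro member_le_sum) auto
      also have "\<dots> \<le> (\<Sum>b\<le>K. \<Sum>d\<le>K'. Nmix b d \<zeta>)"
        using that by (intro member_le_sum[where f="\<lambda>b. \<Sum>d\<le>K'. Nmix b d \<zeta>"]) auto
      finally show ?thesis .
    qed
    then show ?thesis unfolding mixed_within_def by blast
  qed
  then have "AE \<zeta> in M. \<zeta> \<in> {\<eta> \<in> \<Omega>bi. images_below K \<eta>} \<longrightarrow> (\<exists>N. mixed_within K K' N \<zeta>)" by simp
  from positive_prob_Ex[OF mixed_sets this sets K]
  obtain N where "prob {\<zeta> \<in> {\<eta> \<in> \<Omega>bi. images_below K \<eta>}. mixed_within K K' N \<zeta>} > 0" by blast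
  moreover have "{\<zeta> \<in> {\<eta> \<in> \<Omega>bi. images_below K \<eta>}. mixed_within K K' N \<zeta>} = {\<zeta> \<in> \<Omega>bi. images_below K \<zeta> \<and> mixed_within K K' N \<zeta>}" by auto
  ultimately show ?thesis using mixed_sets[of N] by (intro exI[of _ K] exI[of _ N]) auto
qed

text \<open>From almost every point of \<open>Bp\<close> the past reaches the good image set more
  than \<open>N\<close> steps back, which leaves time for mixing, and \<open>gap_bounded_at\<close>
  applies. Boundedness then spreads to almost every point by ergodicity, since one further step adds
  at most \<open>u 1 \<eta> + v 1 \<eta>\<close>.\<close>

lemma gap_bounded_back: "AE \<eta> in M. \<exists>C. \<forall>n. u n ((\<theta>i ^^ n) \<eta>) + v n ((\<theta>i ^^ n) \<eta>) \<le> C"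
proof -
  interpret inv: ergodic_mps M \<theta>i by (rule ergodic_mps_theta_inv)
  obtain Kp where Kp: "{\<eta> \<in> \<Omega>bp. preimages_below Kp \<eta>} \<in> sets M" "prob {\<eta> \<in> \<Omega>bp. preimages_below Kp \<eta>} > 0"
    using uniform_big_preimage by blast
  define Bp where "Bp = {\<eta> \<in> \<Omega>bp. preimages_below Kp \<eta>}"
  obtain Ki N where "{\<zeta> \<in> \<Omega>bi. images_below Ki \<zeta> \<and> mixed_within Ki Kp N \<zeta>} \<in> sets M \<and>
    prob {\<zeta> \<in> \<Omega>bi. images_below Ki \<zeta> \<and> mixed_within Ki Kp N \<zeta>} > 0" (is "?B \<in> _ \<and> _")
    using uniform_big_image[of Kp] by blast
  then have Bi: "?B \<in> sets M" "prob ?B > 0" by auto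
  define H where "H = {\<eta> \<in> space M. \<exists>C::nat. \<forall>n. u n ((\<theta>i ^^ n) \<eta>) + v n ((\<theta>i ^^ n) \<eta>) \<le> real C}"
  have [measurable]: "(\<lambda>\<eta>. u n ((\<theta>i ^^ n) \<eta>)) \<in> borel_measurable M" "(\<lambda>\<eta>. v n ((\<theta>i ^^ n) \<eta>)) \<in> borel_measurable M" for n
    by (rule measurable_compose[OF measurable_theta_inv_funpow uv_meas(1)]
        measurable_compose[OF measurable_theta_inv_funpow uv_meas(2)])+
  have H: "H \<in> sets M" unfolding H_def by measurable
  have HI: "\<eta> \<in> H" if "\<eta> \<in> space M" "\<And>n. u n ((\<theta>i ^^ n) \<eta>) + v n ((\<theta>i ^^ n) \<eta>) \<le> C" for \<eta> C
  proof -
    obtain k :: nat where "C \<le> real k" using real_arch_simple by blast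
    then show ?thesis using that unfolding H_def by (blast intro: order_trans)
  qed
  have "AE \<eta> in M. \<eta> \<in> Bp \<longrightarrow> \<eta> \<in> H"
    using AE_regular AE_V1_finite inv.recurrent[OF Bi]
  proof (eventually_elim, intro impI)
    case (elim \<eta>)
    assume "\<eta> \<in> Bp"
    then have eta: "\<eta> \<in> \<Omega>bp" "preimages_below Kp \<eta>" unfolding Bp_def by auto
    obtain n where n: "n \<ge> Suc N" "(\<theta>i ^^ n) \<eta> \<in> ?B" using elim(3) by blast
    then obtain k where k: "n = Suc k" "k \<ge> N" using n(1) by (cases n) auto
    note * = n(2)[unfolded k(1)]
    have "\<exists>C. \<forall>n. u n ((\<theta>i ^^ n) \<eta>) + v n ((\<theta>i ^^ n) \<eta>) \<le> C"
    proof (rule gap_bounded_at[OF elim(1) refl eta])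
      show "V1_finite (\<theta>i \<eta>)" using elim(2)[rule_format, of 1] by simp
      show "V1_finite (\<theta>i ((\<theta>i ^^ Suc k) \<eta>))" using elim(2)[rule_format, of "Suc (Suc k)"] by simp
      show "(\<theta>i ^^ Suc k) \<eta> \<in> \<Omega>bi" "images_below Ki ((\<theta>i ^^ Suc k) \<eta>)" using * by blast+
      show "Nmix b d ((\<theta>i ^^ Suc k) \<eta>) \<le> k"
        if "b \<le> Ki" "d \<le> Kp" "b \<in> W1 M l" "d \<in> W1 M l" for b d
        using * that k(2) unfolding mixed_within_def by (blast intro: order_trans)
    qed
    then show "\<eta> \<in> H" using HI regular_space[OF elim(1)] by blast
  qed
  then have "prob Bp \<le> prob H" by (rule finite_measure_mono_AE[OF _ H])
  then have "prob H \<noteq> 0" using Kp unfolding Bp_def by linarith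
  moreover have "AE \<eta> in M. \<eta> \<in> H \<longrightarrow> \<theta> \<eta> \<in> H"
    using AE_regular
  proof (eventually_elim, intro impI)
    case (elim \<eta>)
    assume "\<eta> \<in> H"
    then obtain C where C: "\<And>n. u n ((\<theta>i ^^ n) \<eta>) + v n ((\<theta>i ^^ n) \<eta>) \<le> C" unfolding H_def by auto
    have sp: "\<eta> \<in> space M" using elim by (rule regular_space)
    define C' where "C' = max (u 0 (\<theta> \<eta>) + v 0 (\<theta> \<eta>)) (C + u 1 \<eta> + v 1 \<eta>)"
    have "u n ((\<theta>i ^^ n) (\<theta> \<eta>)) + v n ((\<theta>i ^^ n) (\<theta> \<eta>)) \<le> C'" for n
    proof (cases n)
      case 0
      then show ?thesis unfolding C'_def by simp
    next
      case (Suc m)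
      define \<omega> where "\<omega> = (\<theta>i ^^ m) \<eta>"
      have w: "(\<theta>i ^^ n) (\<theta> \<eta>) = \<omega>"
        unfolding Suc funpow_Suc_right \<omega>_def using sp by simp
      have "regular \<omega>" unfolding \<omega>_def using elim by (rule regular_theta_inv)
      moreover have "(\<theta> ^^ m) \<omega> = \<eta>" unfolding \<omega>_def using sp by simp
      ultimately have "u (m + 1) \<omega> \<le> u m \<omega> + u 1 \<eta>" "v (m + 1) \<omega> \<le> v m \<omega> + v 1 \<eta>"
        using sub_u[of \<omega> m 1] sub_v[of \<omega> m 1] by auto
      moreover have "u m \<omega> + v m \<omega> \<le> C" using C[of m] unfolding \<omega>_def .
      ultimately have "u n \<omega> + v n \<omega> \<le> C + u 1 \<eta> + v 1 \<eta>" unfolding Suc by simp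
      then show ?thesis unfolding w C'_def by simp
    qed
    then show "\<theta> \<eta> \<in> H" using HI[of "\<theta> \<eta>" C'] sp theta_space1 by blast
  qed
  then have "prob H = 0 \<or> prob H = 1" by (rule invariant_prob_0_1[OF H])
  ultimately have "prob H = 1" by simp
  then have "AE \<eta> in M. \<eta> \<in> H" using prob_eq_1[OF H] by simp
  then show ?thesis by eventually_elim (auto simp: H_def)
qed

sublocale cocycle: subadditive_pair M \<theta> u v
proof
  show "integrable M (u n)" "integrable M (v n)" for n by (rule integrable_uv)+
  show "AE \<omega> in M. \<forall>n k. u (n + k) \<omega> \<le> u n \<omega> + u k ((\<theta> ^^ n) \<omega>)"
    using AE_regular by eventually_elim (simp add: sub_u)
  show "AE \<omega> in M. \<forall>n k. v (n + k) \<omega> \<le> v n \<omega> + v k ((\<theta> ^^ n) \<omega>)"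
    using AE_regular by eventually_elim (simp add: sub_v)
  show "AE \<omega> in M. \<forall>n. 0 \<le> u n \<omega> + v n \<omega>"
    using AE_regular by eventually_elim (simp add: uv_nonneg)
  show "AE \<omega> in M. \<exists>C. \<forall>n. u n ((\<theta>i ^^ n) \<omega>) + v n ((\<theta>i ^^ n) \<omega>) \<le> C" by (rule gap_bounded_back)
qed

text \<open>Restricting to preimages that start with \<open>a\<close> costs a constant. At one visit
  to big preimages every point is reached from \<open>a\<close> with weight at least
  \<open>exp t\<close>, while the unrestricted operator up to that time is at most
  \<open>exp (birk logM (Suc k) \<omega>)\<close>; the later steps are common to both.\<close>

lemma Zloop_lower_eventually:
  assumes reg: "regular \<omega>" and V1: "\<And>n. V1_finite ((\<theta> ^^ n) \<omega>)" and a: "enat a < l \<omega>"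
    and rec: "\<forall>m. \<exists>n\<ge>m. (\<theta> ^^ n) \<omega> \<in> {\<eta> \<in> \<Omega>bp. preimages_below K \<eta>}"
  shows "\<exists>c J. \<forall>n\<ge>J. \<forall>x\<in>X ((\<theta> ^^ n) \<omega>). x 0 = a \<longrightarrow> ennreal (exp (- v n \<omega> - c)) \<le> Zloop \<theta> l \<alpha> \<phi> a n \<omega>"
proof -
  have sp: "\<omega> \<in> space M" using reg by (rule regular_space)
  define N where "N = (\<Sum>d\<le>K. Nmix a d \<omega>)"
  obtain j where j: "j \<ge> Suc N" "(\<theta> ^^ j) \<omega> \<in> {\<eta> \<in> \<Omega>bp. preimages_below K \<eta>}" using rec by blast
  then obtain k where k: "j = Suc k" "N \<le> k" by (cases j) auto
  define \<eta> where "\<eta> = (\<theta> ^^ Suc k) \<omega>"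
  have eta: "\<eta> \<in> \<Omega>bp" "preimages_below K \<eta>" using j(2) k unfolding \<eta>_def by auto
  have Nk: "Nmix a d \<omega> \<le> k" if "d \<le> K" for d
  proof -
    have "Nmix a d \<omega> \<le> N" unfolding N_def using that by (intro member_le_sum) auto
    then show ?thesis using k by simp
  qed
  have V1': "V1_finite (\<theta>i \<eta>)" using V1[of k] sp unfolding \<eta>_def by simp
  obtain t where
    t: "\<forall>x\<in>X \<eta>. \<exists>y\<in>X \<omega>. y 0 = a \<and> (\<lambda>i. y (i + Suc k)) = x \<and> t \<le> S \<omega> (Suc k) y"
    using connect[OF reg \<eta>_def eta V1' a Nk] by blast
  let ?F = "\<lambda>y :: nat \<Rightarrow> nat. if y 0 = a then 1 else 0 :: ennreal"
  have low: "ennreal (exp t) \<le> L \<omega> (Suc k) ?F x" if x: "x \<in> X \<eta>" for x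
  proof -
    obtain y where y: "y \<in> X \<omega>" "y 0 = a" "(\<lambda>i. y (i + Suc k)) = x" "t \<le> S \<omega> (Suc k) y" using t x by blast
    have "ennreal (exp t) \<le> ennreal (exp (S \<omega> (Suc k) y)) * ?F y" using y by (simp add: ennreal_leI)
    also have "\<dots> \<le> L \<omega> (Suc k) ?F (\<lambda>i. y (i + Suc k))" by (rule L_ge_branch[OF y(1)])
    finally show ?thesis unfolding y(3) .
  qed
  define c where "c = birk logM (Suc k) \<omega> - t"
  have "ennreal (exp (- v n \<omega> - c)) \<le> Zloop \<theta> l \<alpha> \<phi> a n \<omega>"
    if n: "n \<ge> Suc k" and x: "x \<in> X ((\<theta> ^^ n) \<omega>)" "x 0 = a" for n x
  proof -
    obtain m where m: "n = Suc k + m" using n le_Suc_ex by blast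
    have up: "L \<omega> n (\<lambda>_. 1) x \<le> ennreal (exp (birk logM (Suc k) \<omega>)) * L \<eta> m (\<lambda>_. 1) x"
      unfolding m \<eta>_def
      by (rule L_le_const_mult) (use reg x m L_one_bounds(2) in \<open>auto simp del: funpow.simps ruelle_iter.simps\<close>)
    have dn: "ennreal (exp t) * L \<eta> m (\<lambda>_. 1) x \<le> L \<omega> n ?F x"
      unfolding m \<eta>_def
      by (rule L_ge_const_mult) (use low x m in \<open>auto simp: \<eta>_def simp del: funpow.simps ruelle_iter.simps\<close>)
    have "ennreal (exp (- v n \<omega> - c)) = ennreal (exp (- c)) * ennreal (exp (- v n \<omega>))"
      by (simp add: ennreal_mult[symmetric] exp_add[symmetric])
    also have "\<dots> \<le> ennreal (exp (- c)) * L \<omega> n (\<lambda>_. 1) x"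
      by (intro mult_left_mono exp_v_le_L reg x) auto
    also have "\<dots> \<le> ennreal (exp (- c)) * (ennreal (exp (birk logM (Suc k) \<omega>)) * L \<eta> m (\<lambda>_. 1) x)"
      by (intro mult_left_mono up) auto
    also have "\<dots> = ennreal (exp t) * L \<eta> m (\<lambda>_. 1) x"
      by (simp add: c_def mult.assoc[symmetric] ennreal_mult[symmetric] exp_add[symmetric])
    also have "\<dots> \<le> L \<omega> n ?F x" by (rule dn)
    also have "\<dots> \<le> Zloop \<theta> l \<alpha> \<phi> a n \<omega>" by (rule Zloop_lower) (use n x in auto)
    finally show ?thesis .
  qed
  then show ?thesis by blast
qed

lemma pressure_and_series:
  assumes \<xi>_fib: "AE \<omega> in M. \<xi> \<omega> \<in> X \<omega> \<and> (\<omega> \<in> Omega_letter M l a \<longrightarrow> \<xi> \<omega> 0 = a)"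
    and \<Omega>s: "\<Omega>s \<in> sets M" "prob \<Omega>s > 0" "\<Omega>s \<subseteq> Omega_letter M l a"
  shows "\<exists>p::real. is_gurevic_pressure M \<theta> l \<alpha> \<phi> a \<Omega>s (ereal p) \<and>
     (AE \<omega> in M. (\<forall>s. 0 < s \<and> s < exp (- p) \<longrightarrow> Zseries \<theta> l \<alpha> \<phi> \<xi> \<Omega>s s \<omega> < \<infinity>) \<and>
        Zseries \<theta> l \<alpha> \<phi> \<xi> \<Omega>s (exp (- p)) \<omega> = \<infinity>)"
proof -
  obtain p where rate: "cocycle.has_growth_rate p" using cocycle.growth_rate by blast
  note p = rate[unfolded cocycle.has_growth_rate_def]
  obtain K where K: "{\<eta> \<in> \<Omega>bp. preimages_below K \<eta>} \<in> sets M" "prob {\<eta> \<in> \<Omega>bp. preimages_below K \<eta>} > 0"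
    using uniform_big_preimage by blast
  have "is_gurevic_pressure M \<theta> l \<alpha> \<phi> a \<Omega>s (ereal p)"
    unfolding is_gurevic_pressure_def
    using p AE_regular AE_V1_finite recurrent[OF K] AE_orbit[OF \<xi>_fib] theta_small_o_all[OF logB_integrable]
  proof (eventually_elim, intro impI)
    case (elim \<omega>)
    assume w: "\<omega> \<in> \<Omega>s"
    have "\<exists>c J. \<forall>n\<ge>J. \<forall>x\<in>X ((\<theta> ^^ n) \<omega>). x 0 = a \<longrightarrow> ennreal (exp (- v n \<omega> - c)) \<le> Zloop \<theta> l \<alpha> \<phi> a n \<omega>"
      using elim(3) w \<Omega>s by (intro Zloop_lower_eventually[OF elim(2) _ _ elim(4)]) (auto simp: Omega_letter_def)
    then obtain c J where cJ: "\<And>n x. n \<ge> J \<Longrightarrow> x \<in> X ((\<theta> ^^ n) \<omega>) \<Longrightarrow> x 0 = a \<Longrightarrow>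
        ennreal (exp (- v n \<omega> - c)) \<le> Zloop \<theta> l \<alpha> \<phi> a n \<omega>" by blast
    have xi: "\<xi> ((\<theta> ^^ n) \<omega>) \<in> X ((\<theta> ^^ n) \<omega>)" "\<xi> ((\<theta> ^^ n) \<omega>) 0 = a" "n \<ge> 1" if "n \<in> Jset \<theta> \<Omega>s \<omega>" for n
      using that elim(5) \<Omega>s unfolding Jset_def by auto
    show "((\<lambda>n. eln (Zloop \<theta> l \<alpha> \<phi> a n \<omega>) / ereal (real n)) \<longlongrightarrow> ereal p)
        (sequentially \<sqinter> principal (Jset \<theta> \<Omega>s \<omega>))"
    proof (rule log_average_tendsto[where m=J and f="\<lambda>n. - v n \<omega> - c" and g="\<lambda>n. logB ((\<theta> ^^ n) \<omega>) + u n \<omega>"])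
      fix n assume n: "n \<in> Jset \<theta> \<Omega>s \<omega>" "n \<ge> J"
      show "ennreal (exp (- v n \<omega> - c)) \<le> Zloop \<theta> l \<alpha> \<phi> a n \<omega>" using cJ n xi by blast
      have "Zloop \<theta> l \<alpha> \<phi> a n \<omega> \<le> ennreal (exp (logB ((\<theta> ^^ n) \<omega>))) * L \<omega> n (\<lambda>_. 1) (\<xi> ((\<theta> ^^ n) \<omega>))"
        using xi[OF n(1)] by (intro Zloop_upper elim(2))
      also have "\<dots> \<le> ennreal (exp (logB ((\<theta> ^^ n) \<omega>))) * ennreal (exp (u n \<omega>))"
        using xi[OF n(1)] by (intro mult_left_mono L_le_exp_u elim(2)) auto
      finally show "Zloop \<theta> l \<alpha> \<phi> a n \<omega> \<le> ennreal (exp (logB ((\<theta> ^^ n) \<omega>) + u n \<omega>))"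
        by (simp add: exp_add ennreal_mult)
    next
      fix \<epsilon> :: real assume e: "\<epsilon> > 0"
      then obtain C where C: "\<And>n. v n \<omega> \<le> C + (\<epsilon> - p) * real n" using elim(1) by blast
      have "(p - \<epsilon>) * real n - (C + c) \<le> - v n \<omega> - c" for n
        using C[of n] unfolding left_diff_distrib by linarith
      then show "\<exists>C. \<forall>n. (p - \<epsilon>) * real n - C \<le> - v n \<omega> - c" by blast
      \<comment> \<open>Half of \<open>\<epsilon>\<close> is spent on the growth of
        \<open>u\<close>, the other half on \<open>logB\<close> along the orbit.\<close>
      obtain C where C: "\<And>n. u n \<omega> \<le> C + (p + \<epsilon> / 2) * real n"
        using elim(1)[rule_format, of "\<epsilon> / 2"] e by auto
      obtain D where D: "\<And>n. \<bar>logB ((\<theta> ^^ n) \<omega>)\<bar> \<le> D + \<epsilon> / 2 * real n"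
        using elim(6)[rule_format, of "\<epsilon> / 2"] e by auto
      have "logB ((\<theta> ^^ n) \<omega>) + u n \<omega> \<le> (C + D) + (p + \<epsilon>) * real n" for n
        using C[of n] D[of n] unfolding distrib_right by linarith
      then show "\<exists>C. \<forall>n. logB ((\<theta> ^^ n) \<omega>) + u n \<omega> \<le> C + (p + \<epsilon>) * real n" by blast
    qed
  qed
  moreover have "AE \<omega> in M. (\<forall>s. 0 < s \<and> s < exp (- p) \<longrightarrow> Zseries \<theta> l \<alpha> \<phi> \<xi> \<Omega>s s \<omega> < \<infinity>) \<and>
        Zseries \<theta> l \<alpha> \<phi> \<xi> \<Omega>s (exp (- p)) \<omega> = \<infinity>"
    using p AE_regular AE_orbit[OF \<xi>_fib]
      cocycle.infinitely_often_near_rate[OF rate \<Omega>s(1,2)]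
  proof eventually_elim
    case (elim \<omega>)
    have xi: "\<xi> ((\<theta> ^^ n) \<omega>) \<in> X ((\<theta> ^^ n) \<omega>)" for n using elim(3) by blast
    have up: "Zcal \<theta> l \<alpha> \<phi> \<xi> n \<omega> \<le> ennreal (exp (u n \<omega>))" for n
      unfolding Zcal_def by (rule L_le_exp_u[OF elim(2) xi])
    have low: "ennreal (exp (- v n \<omega>)) \<le> Zcal \<theta> l \<alpha> \<phi> \<xi> n \<omega>" for n
      unfolding Zcal_def by (rule exp_v_le_L[OF elim(2) xi])
    have "Zseries \<theta> l \<alpha> \<phi> \<xi> \<Omega>s s \<omega> < \<infinity>" if s: "0 < s" "s < exp (- p)" for s
    proof -
      \<comment> \<open>Chosen so that \<open>ln s + p = - 2 * \<epsilon>\<close>: one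
        \<open>\<epsilon>\<close> absorbs the slope error of \<open>u n\<close>, the other leaves
        geometric decay with ratio \<open>exp (- \<epsilon>)\<close>.\<close>
      define \<epsilon> where "\<epsilon> = (- p - ln s) / 2"
      have "ln s < - p" using s by (metis ln_exp ln_less_cancel_iff exp_gt_zero)
      then have e: "\<epsilon> > 0" unfolding \<epsilon>_def by simp
      then obtain C where C: "\<And>n. u n \<omega> \<le> C + (p + \<epsilon>) * real n" using elim(1) by blast
      define q where "q = exp (- \<epsilon>)"
      have q: "0 \<le> q" "q < 1" using e unfolding q_def by auto
      have term_le: "ennreal (s ^ n) * Zcal \<theta> l \<alpha> \<phi> \<xi> n \<omega> \<le> ennreal (exp C * q ^ n)" for n
      proof -
        have "s ^ n = exp (real n * ln s)" using s by (simp add: exp_of_nat_mult)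
        then have "s ^ n * exp (u n \<omega>) = exp (real n * ln s + u n \<omega>)" by (simp add: exp_add)
        also have "\<dots> \<le> exp (real n * ln s + (C + (p + \<epsilon>) * real n))" using C[of n] by simp
        also have "real n * ln s + (C + (p + \<epsilon>) * real n) = C + real n * (- \<epsilon>)"
          unfolding \<epsilon>_def by (simp add: field_simps)
        also have "exp (C + real n * (- \<epsilon>)) = exp C * q ^ n"
          unfolding q_def by (simp only: exp_add exp_of_nat_mult)
        finally have le: "s ^ n * exp (u n \<omega>) \<le> exp C * q ^ n" .
        have "ennreal (s ^ n) * Zcal \<theta> l \<alpha> \<phi> \<xi> n \<omega> \<le> ennreal (s ^ n) * ennreal (exp (u n \<omega>))"
          by (intro mult_left_mono up) auto
        also have "\<dots> = ennreal (s ^ n * exp (u n \<omega>))" using s by (simp add: ennreal_mult)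
        also have "\<dots> \<le> ennreal (exp C * q ^ n)" using le by (rule ennreal_leI)
        finally show ?thesis .
      qed
      have "Zseries \<theta> l \<alpha> \<phi> \<xi> \<Omega>s s \<omega> \<le> (\<Sum>n. ennreal (exp C * q ^ n))"
        unfolding Zseries_def using term_le by (intro suminf_le) auto
      also have "\<dots> < \<infinity>"
      proof -
        have "summable (\<lambda>n. exp C * q ^ n)" using q by (intro summable_mult summable_geometric) auto
        then have "(\<Sum>n. ennreal (exp C * q ^ n)) \<noteq> \<top>"
          by (rule ennreal_suminf_neq_top) (use q in simp)
        then show ?thesis unfolding infinity_ennreal_def top.not_eq_extremum .
      qed
      finally show ?thesis .
    qed
    moreover have "Zseries \<theta> l \<alpha> \<phi> \<xi> \<Omega>s (exp (- p)) \<omega> = \<infinity>"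
    proof -
      obtain k where k: "\<And>m. \<exists>n\<ge>m. (\<theta> ^^ n) \<omega> \<in> \<Omega>s \<and> p * real n - k \<le> - v n \<omega>" using elim(4) by blast
      show ?thesis
        unfolding Zseries_def
      proof (rule suminf_ge_infinitely_often[where c="exp (- k)"])
        fix m
        \<comment> \<open>The maximum with 1 is taken because \<open>Jset\<close> contains only
          positive times.\<close>
        obtain n where n: "n \<ge> max m 1" "(\<theta> ^^ n) \<omega> \<in> \<Omega>s" "p * real n - k \<le> - v n \<omega>" using k by blast
        have "exp (- k) \<le> exp (real n * (- p) + (- v n \<omega>))" using n(3) by (simp add: mult.commute)
        also have "\<dots> = exp (- p) ^ n * exp (- v n \<omega>)" by (simp only: exp_add exp_of_nat_mult)
        finally have "ennreal (exp (- k)) \<le> ennreal (exp (- p) ^ n) * ennreal (exp (- v n \<omega>))"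
          by (simp add: ennreal_mult[symmetric] ennreal_leI)
        also have "\<dots> \<le> ennreal (exp (- p) ^ n) * Zcal \<theta> l \<alpha> \<phi> \<xi> n \<omega>"
          by (intro mult_left_mono low) auto
        finally show "\<exists>n\<ge>m. ennreal (exp (- k)) \<le>
            (if n \<in> Jset \<theta> \<Omega>s \<omega> then ennreal (exp (- p) ^ n) * Zcal \<theta> l \<alpha> \<phi> \<xi> n \<omega> else 0)"
          using n by (intro exI[of _ n]) (auto simp: Jset_def)
      qed simp
    qed
    ultimately show ?case by blast
  qed
  ultimately show ?thesis by blast
qed

end

text \<open>That \<open>p\<close> is real expresses finiteness of the pressure, and the quantifier
  over \<open>s\<close> inside \<open>AE\<close> asks for one null set for all \<open>s\<close>.
  (H2) only asserts the existence of Hoelder data, so \<open>r\<close> and \<open>\<kappa>\<close>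
  are chosen before the locale is entered.\<close>

theorem theorem3p4:
  fixes M :: "'w measure" and \<theta> :: "'w \<Rightarrow> 'w" and l :: "'w \<Rightarrow> enat"
    and \<alpha> :: "'w \<Rightarrow> nat \<Rightarrow> nat \<Rightarrow> bool" and \<phi> :: "'w \<Rightarrow> (nat \<Rightarrow> nat) \<Rightarrow> real"
    and Nmix :: "nat \<Rightarrow> nat \<Rightarrow> 'w \<Rightarrow> nat"
    and \<Omega>bi \<Omega>bp :: "'w set" and Ibi Ibp :: "'w \<Rightarrow> nat set"
    and a N :: nat and \<xi> :: "'w \<Rightarrow> nat \<Rightarrow> nat"
  assumes shift: "random_shift M \<theta> l \<alpha>"
    and mixing: "top_mixing M \<theta> l \<alpha> Nmix"
    and bi: "big_image M \<theta> l \<alpha> \<Omega>bi Ibi"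
    and bp: "big_preimage M \<theta> l \<alpha> \<Omega>bp Ibp"
    and pot: "potential M \<theta> l \<alpha> \<phi>"
    and Hst: "Hstar M \<theta> l \<alpha> \<phi> \<Omega>bi \<Omega>bp"
    and S1: "S1 M \<theta> l \<alpha> \<phi>"
    and S2: "S2 M \<theta> l \<alpha> \<phi>"
    and a: "a \<in> W1 M l"
    and \<xi>_meas: "\<xi> \<in> M \<rightarrow>\<^sub>M PiM UNIV (\<lambda>_. count_space UNIV)"
    and \<xi>_fib: "AE \<omega> in M. \<xi> \<omega> \<in> fiber \<theta> l \<alpha> \<omega> \<and> (\<omega> \<in> Omega_letter M l a \<longrightarrow> \<xi> \<omega> 0 = a)"
    and N: "measure M (Omega_star M l Nmix a N) > 0"
  shows "\<exists>p::real.
     is_gurevic_pressure M \<theta> l \<alpha> \<phi> a (Omega_star M l Nmix a N) (ereal p) \<and>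
     (AE \<omega> in M.
        (\<forall>s. 0 < s \<and> s < exp (- p) \<longrightarrow>
           Zseries \<theta> l \<alpha> \<phi> \<xi> (Omega_star M l Nmix a N) s \<omega> < \<infinity>) \<and>
        Zseries \<theta> l \<alpha> \<phi> \<xi> (Omega_star M l Nmix a N) (exp (- p)) \<omega> = \<infinity>)"
proof -
  obtain r \<kappa> where rk: "holder_with M \<theta> l \<alpha> \<phi> 2 r \<kappa>"
    "(\<integral>\<^sup>+\<omega>. (\<Sum>j. ennreal (\<kappa> ((theta_inv M \<theta> ^^ Suc j) \<omega>) * r ^ Suc j)) \<partial>M) < \<infinity>"
    using Hst unfolding Hstar_def H2_def by blast
  have mps: "invertible_ergodic_mps M \<theta>" using shift unfolding random_shift_def by blast
  have V1: "AE \<omega> in M. \<theta> \<omega> \<in> \<Omega>bi \<union> \<Omega>bp \<longrightarrow> variation \<theta> l \<alpha> \<phi> \<omega> 1 < \<infinity>"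
    using Hst unfolding Hstar_def by blast
  interpret bip_shift M \<theta> l \<alpha> \<phi> r \<kappa> Nmix \<Omega>bi \<Omega>bp Ibi Ibp
    by unfold_locales (fact mps shift pot rk S1 S2 mixing bi bp V1)+
  have [measurable]: "Nmix a a \<in> M \<rightarrow>\<^sub>M count_space UNIV"
    using mixing a unfolding top_mixing_def by blast
  have "Omega_star M l Nmix a N = {\<omega> \<in> space M. enat a < l \<omega> \<and> Nmix a a \<omega> \<le> N}"
    unfolding Omega_star_def Omega_letter_def by auto
  also have "\<dots> \<in> sets M" by measurable
  finally show ?thesis
    by (intro pressure_and_series \<xi>_fib N) (auto simp: Omega_star_def)
qed

end
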